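(* Let $(\Omega,I,J,g,q)$ be a finite zero-sum state-blind stochastic game, where $q$ is its kernel. Let $T\in(0,+\infty]$ and let $k:[0,T]\to[0,\infty)$ be nonincreasing and continuous with $\int_0^T k(t)\,dt=1$. For a partition $T_\infty$ of $[0,T)$ with stage durations $h_1,h_2,\ldots$, let $v_{T_\infty,k}:[0,T)\times\Delta(\Omega)\to\mathbb R$ be the value of the state-blind game with $n$-th stage duration $h_n$ and weight function $k$. Then the uniform limit of $v_{T_\infty,k}(t,p)$ as $\sup_i h_i\to0$ (with $h_1+h_2+\cdots=T$) exists and is the unique viscosity solution of the partial differential equation $$0=\frac{d}{dt}v(t,p)+\mathrm{Val}_{I\times J}\Big[k(t)\,g(i,j,p)+\langle p*q(i,j),\nabla v(t,p)\rangle\Big].$$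
   Context: **Game.** $\Omega, I, J$ are finite nonempty sets (states, actions of player 1, actions of player 2), $g:I\times J\times\Omega\to\mathbb R$ is the payoff function of player 1, and the kernel $q$ assigns to each $(i,j)$ an $|\Omega|\times|\Omega|$ matrix $q(i,j)=P(i,j)-\mathrm{Id}$ with $P(i,j)$ row-stochastic. $\Delta(C)$ is the set of probability measures on a finite set $C$. For $p\in\Delta(\Omega)$: $g(i,j,p)=\sum_\omega p(\omega)g(i,j,\omega)$, and for a matrix $\mu$, $(p*\mu)(\omega)=\sum_{\omega'}p(\omega')\mu_{\omega'\omega}$. $\langle\cdot,\cdot\rangle$ is the standard inner product on $\mathbb R^\Omega$, $\nabla$ is the gradient in $p$, and $\mathrm{Val}_{I\times J}[a(i,j)]=\sup_{x\in\Delta(I)}\inf_{y\in\Delta(J)}\sum_{i,j}x(i)y(j)a(i,j)$ (which equals the corresponding $\inf\sup$). **Partitions.** A partition $T_\infty$ of $[0,T)$ is a strictly increasing sequence $(t_n)_{n\ge1}$ with $t_1=0$ and $t_n\to T$; $h_n=t_{n+1}-t_n$. If $T=+\infty$, $[0,T]$ is read as $[0,\infty)$. **State-blind game with stage duration.** Let $t_n\in T_\infty$ be the initial time and $p\in\Delta(\Omega)$ the initial distribution, known to both players. Play starts at stage $n$ with $\omega_n$ drawn from $p$. At each stage $m\ge n$, the players cannot observe the current state, but remember the past actions; they simultaneously choose mixed actions in $\Delta(I)$ and $\Delta(J)$, actions $i_m,j_m$ are drawn accordingly and observed by both players, and $\omega_{m+1}$ is drawn from the law $(\mathrm{Id}+h_m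 q(i_m,j_m))(\omega_m,\cdot)$. Strategies $\sigma,\tau$ are maps from finite sequences of past action pairs to $\Delta(I)$, $\Delta(J)$. Player 1 maximizes and player 2 minimizes $E^{p}_{\sigma,\tau}\big(\sum_{m\ge n}h_m k(t_m)g(i_m,j_m,\omega_m)\big)$. The value ($\sup_\sigma\inf_\tau=\inf_\tau\sup_\sigma$) is denoted $v_{T_\infty,k}(t_n,p)$. For $t=\alpha t_n+(1-\alpha)t_{n+1}$ with $\alpha\in[0,1]$, set $v_{T_\infty,k}(t,p)=\alpha v_{T_\infty,k}(t_n,p)+(1-\alpha)v_{T_\infty,k}(t_{n+1},p)$. The limit in the claim is uniform in both $t$ and $p$. **Viscosity solution.** A function $u:[0,T)\times\Delta(\Omega)\to\mathbb R$ is called a viscosity solution of a differential equation $0=\frac{d}{dt}u(t,p)+H(t,p,u(t,p),\nabla u(t,p))$ if: (1) for any $C^1$ function $\psi:[0,T)\times\Delta(\Omega)\to\mathbb R$ with $u-\psi$ having a strict local maximum at $(\bar t,\bar p)\in[0,T)\times\Delta(\Omega)$, we have $0\le\frac{d}{dt}\psi(\bar t,\bar p)+H(\bar t,\bar p,\psi(\bar t,\bar p),\nabla\psi(\bar t,\bar p))$; (2) for any $C^1$ function $\psi:[0,T)\times\Delta(\Omega)\to\mathbb R$ with $u-\psi$ having a strict local minimum at $(\bar t,\bar p)\in[0,T)\times\Delta(\Omega)$, we have $0\ge\frac{d}{dt}\psi(\bar t,\bar p)+H(\bar t,\bar p,\psi(\bar t,\bar p),\nabla\psi(\bar t,\bar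 p))$. For the equation in the claim, the $H$-term is $\mathrm{Val}_{I\times J}[k(t)g(i,j,p)+\langle p*q(i,j),\nabla v(t,p)\rangle]$.
   Formalization: Uniqueness is stated only among continuous functions on [0,T)×Δ(Ω) that tend to 0 uniformly in p as t→T (the limit is shown to be one); without this it fails, since adding a constant to a solution gives another solution. *)

theory Defs
  imports "HOL-Probability.Probability"
begin

definition prob_simplex :: "(real ^ 'w::finite) set" where
  "prob_simplex = {p. (\<forall>w. 0 \<le> p $ w) \<and> (\<Sum>w\<in>UNIV. p $ w) = 1}"

definition row_stochastic :: "real ^ 'w ^ 'w::finite \<Rightarrow> bool" where
  "row_stochastic P \<longleftrightarrow> (\<forall>w. P $ w \<in> prob_simplex)"

definition kernel_matrix :: "real ^ 'w ^ 'w::finite \<Rightarrow> bool" where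
  "kernel_matrix Q \<longleftrightarrow> (\<exists>P. row_stochastic P \<and> Q = P - mat 1)"

text \<open>Elements of a finite simplex that are only sampled from (mixed actions) are rendered as
  \<open>pmf\<close>s; beliefs over states are vectors, because the equation differentiates in them.
  The conversion below is meaningful only on \<^const>\<open>prob_simplex\<close>.\<close>

definition vec_pmf :: "real ^ 'w::finite \<Rightarrow> 'w pmf" where
  "vec_pmf p = embed_pmf (\<lambda>w. p $ w)"

definition matrix_game_value :: "('i::finite \<Rightarrow> 'j::finite \<Rightarrow> real) \<Rightarrow> real" where
  "matrix_game_value a =
     (SUP x::'i pmf. INF y::'j pmf. \<Sum>i\<in>UNIV. \<Sum>j\<in>UNIV. pmf x i * pmf y j * a i j)"

definition time_domain :: "ereal \<Rightarrow> real set" where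
  "time_domain T = {t. 0 \<le> t \<and> ereal t < T}"

text \<open>Stages are numbered from 0, so \<open>s n\<close> is the starting time of stage number \<open>n + 1\<close>.\<close>

definition partition_of :: "ereal \<Rightarrow> (nat \<Rightarrow> real) \<Rightarrow> bool" where
  "partition_of T s \<longleftrightarrow> s 0 = 0 \<and> strict_mono s \<and> (\<lambda>n. ereal (s n)) \<longlonglongrightarrow> T"

definition duration :: "(nat \<Rightarrow> real) \<Rightarrow> nat \<Rightarrow> real" where
  "duration s n = s (Suc n) - s n"

definition mesh :: "(nat \<Rightarrow> real) \<Rightarrow> ereal" where
  "mesh s = (SUP n. ereal (duration s n))"

definition vanishing_mesh :: "ereal \<Rightarrow> (nat \<Rightarrow> real) filter" where
  "vanishing_mesh T = inf (filtercomap mesh (nhds 0)) (principal {s. partition_of T s})"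

text \<open>Strategies see past action pairs only (oldest first), never the states.\<close>

type_synonym ('i, 'j, 'a) strategy = "('i \<times> 'j) list \<Rightarrow> 'a pmf"

text \<open>A play is a sequence of triples (state, action of player 1, action of player 2); its
  entry number \<open>l\<close> belongs to stage \<open>n + l\<close> when the game starts at stage \<open>n\<close>.\<close>

definition action_history :: "(nat \<Rightarrow> 'w \<times> 'i \<times> 'j) \<Rightarrow> nat \<Rightarrow> ('i \<times> 'j) list" where
  "action_history x l = map (\<lambda>m. snd (x m)) [0..<l]"

definition next_state ::
  "('i \<Rightarrow> 'j \<Rightarrow> real ^ 'w ^ 'w::finite) \<Rightarrow> real \<Rightarrow> 'w \<times> 'i \<times> 'j \<Rightarrow> 'w pmf" where
  "next_state q h = (\<lambda>(w, i, j). vec_pmf ((mat 1 + h *\<^sub>R q i j) $ w))"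

definition stage_law ::
  "('i \<Rightarrow> 'j \<Rightarrow> real ^ 'w ^ 'w::finite) \<Rightarrow> (nat \<Rightarrow> real) \<Rightarrow> nat \<Rightarrow> real ^ 'w \<Rightarrow>
   ('i, 'j, 'i) strategy \<Rightarrow> ('i, 'j, 'j) strategy \<Rightarrow>
   nat \<Rightarrow> (nat \<Rightarrow> 'w \<times> 'i \<times> 'j) \<Rightarrow> ('w \<times> 'i \<times> 'j) pmf" where
  "stage_law q s n p \<sigma> \<tau> l x =
     pair_pmf
       (case l of 0 \<Rightarrow> vec_pmf p | Suc m \<Rightarrow> next_state q (duration s (n + m)) (x m))
       (pair_pmf (\<sigma> (action_history x l)) (\<tau> (action_history x l)))"

text \<open>The law of the play is the projective limit given by the Ionescu-Tulcea theorem for the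
  one-stage laws above; \<open>play_law_locale\<close> below shows that the theorem applies.\<close>

definition play_law ::
  "('i \<Rightarrow> 'j \<Rightarrow> real ^ 'w ^ 'w::finite) \<Rightarrow> (nat \<Rightarrow> real) \<Rightarrow> nat \<Rightarrow> real ^ 'w \<Rightarrow>
   ('i, 'j, 'i) strategy \<Rightarrow> ('i, 'j, 'j) strategy \<Rightarrow> (nat \<Rightarrow> 'w \<times> 'i \<times> 'j) measure" where
  "play_law q s n p \<sigma> \<tau> =
     projective_family.lim UNIV
       (Ionescu_Tulcea.CI (\<lambda>l x. measure_pmf (stage_law q s n p \<sigma> \<tau> l x)) (\<lambda>_. count_space UNIV))
       (\<lambda>_. count_space UNIV)"

definition expected_payoff ::
  "('i \<Rightarrow> 'j \<Rightarrow> 'w::finite \<Rightarrow> real) \<Rightarrow> ('i \<Rightarrow> 'j \<Rightarrow> real ^ 'w ^ 'w) \<Rightarrow> (real \<Rightarrow> real) \<Rightarrow>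
   (nat \<Rightarrow> real) \<Rightarrow> nat \<Rightarrow> real ^ 'w \<Rightarrow> ('i, 'j, 'i) strategy \<Rightarrow> ('i, 'j, 'j) strategy \<Rightarrow> real" where
  "expected_payoff g q k s n p \<sigma> \<tau> =
     (\<integral>x. (\<Sum>l. duration s (n + l) * k (s (n + l)) * (case x l of (w, i, j) \<Rightarrow> g i j w))
        \<partial>play_law q s n p \<sigma> \<tau>)"

definition stage_value ::
  "('i \<Rightarrow> 'j \<Rightarrow> 'w::finite \<Rightarrow> real) \<Rightarrow> ('i \<Rightarrow> 'j \<Rightarrow> real ^ 'w ^ 'w) \<Rightarrow> (real \<Rightarrow> real) \<Rightarrow>
   (nat \<Rightarrow> real) \<Rightarrow> nat \<Rightarrow> real ^ 'w \<Rightarrow> real" where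
  "stage_value g q k s n p = (SUP \<sigma>. INF \<tau>. expected_payoff g q k s n p \<sigma> \<tau>)"

definition game_value ::
  "('i \<Rightarrow> 'j \<Rightarrow> 'w::finite \<Rightarrow> real) \<Rightarrow> ('i \<Rightarrow> 'j \<Rightarrow> real ^ 'w ^ 'w) \<Rightarrow> (real \<Rightarrow> real) \<Rightarrow>
   (nat \<Rightarrow> real) \<Rightarrow> real \<times> (real ^ 'w) \<Rightarrow> real" where
  "game_value g q k s = (\<lambda>(t, p).
     let n = (THE n. s n \<le> t \<and> t < s (Suc n));
         \<alpha> = (s (Suc n) - t) / duration s n
     in \<alpha> * stage_value g q k s n p + (1 - \<alpha>) * stage_value g q k s (Suc n) p)"

text \<open>\<open>C1_on S \<psi> dt grad\<close>: the function \<open>\<psi>\<close> is continuously differentiable on \<open>S\<close>, with time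
  derivative \<open>dt\<close> and gradient \<open>grad\<close> in the second variable. On \<open>S = [0,T) \<times> prob_simplex\<close> the
  gradient is determined only up to multiples of the all-ones vector; this ambiguity does not
  affect the Hamiltonian below, since the entries of \<open>p v* q i j\<close> sum to 0.\<close>

definition C1_on ::
  "(real \<times> 'a::euclidean_space) set \<Rightarrow> (real \<times> 'a \<Rightarrow> real) \<Rightarrow>
   (real \<times> 'a \<Rightarrow> real) \<Rightarrow> (real \<times> 'a \<Rightarrow> 'a) \<Rightarrow> bool" where
  "C1_on S \<psi> dt grad \<longleftrightarrow>
     continuous_on S dt \<and> continuous_on S grad \<and>
     (\<forall>x\<in>S. (\<psi> has_derivative (\<lambda>(r, d). dt x * r + grad x \<bullet> d)) (at x within S))"

definition strict_local_max_on :: "'a::topological_space set \<Rightarrow> ('a \<Rightarrow> real) \<Rightarrow> 'a \<Rightarrow> bool" where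
  "strict_local_max_on S f x \<longleftrightarrow> x \<in> S \<and> (\<forall>\<^sub>F y in at x within S. f y < f x)"

definition strict_local_min_on :: "'a::topological_space set \<Rightarrow> ('a \<Rightarrow> real) \<Rightarrow> 'a \<Rightarrow> bool" where
  "strict_local_min_on S f x \<longleftrightarrow> x \<in> S \<and> (\<forall>\<^sub>F y in at x within S. f x < f y)"

definition viscosity_solution ::
  "(real \<times> 'a::euclidean_space) set \<Rightarrow> (real \<Rightarrow> 'a \<Rightarrow> real \<Rightarrow> 'a \<Rightarrow> real) \<Rightarrow>
   (real \<times> 'a \<Rightarrow> real) \<Rightarrow> bool" where
  "viscosity_solution S H u \<longleftrightarrow>
     (\<forall>\<psi> dt grad t p. C1_on S \<psi> dt grad \<longrightarrow> strict_local_max_on S (\<lambda>x. u x - \<psi> x) (t, p) \<longrightarrow>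
        0 \<le> dt (t, p) + H t p (\<psi> (t, p)) (grad (t, p))) \<and>
     (\<forall>\<psi> dt grad t p. C1_on S \<psi> dt grad \<longrightarrow> strict_local_min_on S (\<lambda>x. u x - \<psi> x) (t, p) \<longrightarrow>
        0 \<ge> dt (t, p) + H t p (\<psi> (t, p)) (grad (t, p)))"

definition hamiltonian ::
  "('i::finite \<Rightarrow> 'j::finite \<Rightarrow> 'w::finite \<Rightarrow> real) \<Rightarrow> ('i \<Rightarrow> 'j \<Rightarrow> real ^ 'w ^ 'w) \<Rightarrow>
   (real \<Rightarrow> real) \<Rightarrow> real \<Rightarrow> real ^ 'w \<Rightarrow> real \<Rightarrow> real ^ 'w \<Rightarrow> real" where
  "hamiltonian g q k t p z \<xi> =
     matrix_game_value (\<lambda>i j. k t * (\<Sum>w\<in>UNIV. p $ w * g i j w) + (p v* q i j) \<bullet> \<xi>)"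

text \<open>The equation is invariant under adding constants to the solution, and for discontinuous
  functions the test-function conditions can be vacuous. Uniqueness is therefore understood, as
  is usual, among continuous functions with terminal value 0 (uniformly in the belief).\<close>

definition terminal_zero :: "ereal \<Rightarrow> (real \<times> (real ^ 'w::finite) \<Rightarrow> real) \<Rightarrow> bool" where
  "terminal_zero T u \<longleftrightarrow>
     uniform_limit prob_simplex (\<lambda>t p. u (t, p)) (\<lambda>_. 0) (filtercomap ereal (at_left T))"

lemma pmf_vec_pmf:
  assumes "p \<in> prob_simplex"
  shows "pmf (vec_pmf p) w = p $ w"
proof -
  have "(\<integral>\<^sup>+ w. ennreal (p $ w) \<partial>count_space UNIV) = 1"
    using assms by (simp add: prob_simplex_def nn_integral_count_space_finite)
  then show ?thesis
    unfolding vec_pmf_def using assms by (intro pmf_embed_pmf) (auto simp: prob_simplex_def)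
qed

lemma stage_matrix_in_simplex:
  assumes "kernel_matrix Q" "0 \<le> h" "h \<le> 1"
  shows "(mat 1 + h *\<^sub>R Q) $ w \<in> prob_simplex"
proof -
  obtain P where P: "\<And>w. P $ w \<in> prob_simplex" and Q: "Q = P - mat 1"
    using assms(1) by (auto simp: kernel_matrix_def row_stochastic_def)
  have eq: "(mat 1 + h *\<^sub>R Q) $ w $ w' = (1 - h) * mat 1 $ w $ w' + h * P $ w $ w'" for w'
    by (simp add: Q algebra_simps)
  have "(\<Sum>w'\<in>UNIV. (mat 1 :: real ^ 'a ^ 'a) $ w $ w') = 1"
    by (simp add: mat_def)
  moreover have "(\<Sum>w'\<in>UNIV. P $ w $ w') = 1" "\<And>w'. 0 \<le> P $ w $ w'"
    using P[of w] by (auto simp: prob_simplex_def)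
  moreover have "0 \<le> (mat 1 :: real ^ 'a ^ 'a) $ w $ w'" for w'
    by (simp add: mat_def)
  ultimately show ?thesis
    using assms(2,3) unfolding prob_simplex_def mem_Collect_eq eq
    by (simp add: sum.distrib flip: sum_distrib_left)
qed

lemma play_law_locale:
  fixes q :: "'i::finite \<Rightarrow> 'j::finite \<Rightarrow> real ^ 'w ^ 'w::finite"
  shows "Ionescu_Tulcea (\<lambda>l x. measure_pmf (stage_law q s n p \<sigma> \<tau> l x)) (\<lambda>_. count_space UNIV)"
proof
  fix l :: nat
  have "PiM {0..<l} (\<lambda>_. count_space (UNIV :: ('w \<times> 'i \<times> 'j) set)) =
        count_space (PiE {0..<l} (\<lambda>_. UNIV))"
    by (intro count_space_PiM_finite) (auto intro: countable_finite)
  then show "(\<lambda>x. measure_pmf (stage_law q s n p \<sigma> \<tau> l x)) \<in>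
      measurable (PiM {0..<l} (\<lambda>_. count_space UNIV)) (subprob_algebra (count_space UNIV))"
    by (simp add: measure_pmf_in_subprob_space)
qed

lemma prob_space_play_law:
  fixes q :: "'i::finite \<Rightarrow> 'j::finite \<Rightarrow> real ^ 'w ^ 'w::finite"
  shows "prob_space (play_law q s n p \<sigma> \<tau>)"
proof -
  interpret Ionescu_Tulcea
    "\<lambda>l x. measure_pmf (stage_law q s n p \<sigma> \<tau> l x)" "\<lambda>_. count_space UNIV"
    by (rule play_law_locale)
  show ?thesis
  proof
    have "emeasure PF.lim (PF.emb UNIV {} (space (PiM {} (\<lambda>_. count_space UNIV)))) =
          emeasure (CI {}) (space (PiM {} (\<lambda>_. count_space UNIV)))"
      by (rule lim) auto
    moreover have "PF.emb UNIV {} (space (PiM {} (\<lambda>_. count_space UNIV))) = space PF.lim"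
      by (auto simp: space_PiM prod_emb_def restrict_def)
    moreover have "emeasure (CI {}) (space (PiM {} (\<lambda>_. count_space UNIV))) = 1"
      using prob_space.emeasure_space_1[OF PF.prob_space_P, of "{}"] PF.space_P[of "{}"] by simp
    ultimately show "emeasure (play_law q s n p \<sigma> \<tau>) (space (play_law q s n p \<sigma> \<tau>)) = 1"
      by (simp add: play_law_def)
  qed
qed

lemma eventually_vanishing_mesh:
  "eventually A (vanishing_mesh T) \<longleftrightarrow>
     (\<exists>\<delta>>0. \<forall>s. partition_of T s \<longrightarrow> mesh s < ereal \<delta> \<longrightarrow> A s)"
  (is "?L \<longleftrightarrow> ?R")
proof
  assume ?L
  then obtain U where U: "eventually U (nhds 0)" "\<And>s. U (mesh s) \<Longrightarrow> partition_of T s \<Longrightarrow> A s"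
    by (auto simp: vanishing_mesh_def eventually_inf_principal eventually_filtercomap)
  then obtain S where S: "open S" "0 \<in> S" "\<And>y. y \<in> S \<Longrightarrow> U y"
    by (auto simp: eventually_nhds)
  obtain a b where ab: "a < 0" "0 < b" "{a<..<b} \<subseteq> S"
    using ereal_open_cont_interval2[OF S(1,2)] by auto
  obtain \<delta> where \<delta>: "0 < ereal \<delta>" "ereal \<delta> < b"
    using ereal_dense2[OF ab(2)] by auto
  have "A s" if s: "partition_of T s" "mesh s < ereal \<delta>" for s
  proof -
    have "0 < ereal (duration s 0)"
      using s(1) strict_monoD[of s 0 "Suc 0"] by (simp add: partition_of_def duration_def)
    also have "\<dots> \<le> mesh s"
      unfolding mesh_def by (rule SUP_upper) simp
    finally have "mesh s \<in> {a<..<b}"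
      using ab(1) \<delta>(2) s(2) by (auto intro: less_trans)
    then show ?thesis
      using ab(3) S(3) U(2) s(1) by blast
  qed
  then show ?R
    using \<delta>(1) by auto
next
  assume ?R
  then obtain \<delta> where \<delta>: "\<delta> > 0" "\<And>s. partition_of T s \<Longrightarrow> mesh s < ereal \<delta> \<Longrightarrow> A s"
    by blast
  have "eventually (\<lambda>y. y < ereal \<delta>) (nhds (0::ereal))"
    using \<delta>(1) eventually_nhds_in_open[of "{..<ereal \<delta>}" 0] by (simp add: zero_ereal_def)
  then show ?L
    unfolding vanishing_mesh_def eventually_inf_principal eventually_filtercomap
    using \<delta>(2) by auto
qed

end

theory Submission
  imports Defs
begin

text \<open>
  The sup-inf values satisfy a dynamic programming equation of Shapley type in the belief:
  \<open>V n p = Val [h k g + V (n + 1) (p + h p q)]\<close>; no minmax theorem is needed for it. Total weights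
  are bounded by \<open>\<integral> k + h k 0\<close>, so the values are Lipschitz in time and belief and small near \<open>T\<close>,
  uniformly in the partition. Hence, up to an error of the order of the mesh, at a maximum of
  \<open>V - \<psi>\<close> over the grid a quadratic test function \<open>\<psi>\<close> satisfies the inequality of a subsolution.
  Doubling of variables can therefore be carried out directly between two discretisations (which
  gives a Cauchy estimate, hence the uniform limit) and between a discretisation and a viscosity
  solution (which gives uniqueness). The limit is a viscosity solution because a strict maximum
  of \<open>v - \<psi>\<close> is a limit of grid maxima of \<open>V - \<psi>\<close>.

  Supersolutions \<open>w\<close> are treated as subsolutions \<open>- w\<close> for the payoff \<open>- g\<close> and the operator
  \<open>a \<mapsto> - Val (- a)\<close>, which like \<open>Val\<close> is monotone, translation equivariant and positively homogeneous;
  nothing else about \<open>Val\<close> enters the comparison and stability arguments.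
\<close>

section \<open>The law of a play\<close>

text \<open>The grids of two partitions need not share points, so their recursions cannot be
  compared stage by stage; a maximum over pairs of times and beliefs replaces the missing common
  recursion. There the time derivatives of the quadratic coupling cancel, and the tilt
  \<open>\<eta> * t\<close> given to one side is contradicted once all errors are below \<eta>. The
  Hamiltonian error contains the gradient \<open>(p - p') / \<epsilon>\<close> multiplied by
  \<open>p - p'\<close>. It vanishes with \<epsilon> because a Lipschitz bound \<open>L\<close> in
  the belief for one of the two functions gives
  \<open>norm (p - p') \<le> 2 * L * \<epsilon>\<close>. Discrete values have such a bound; for a
  continuous viscosity solution none is known beforehand, which is why it is compared with a
  discretisation. No boundary condition on the simplex arises: a step \<open>p + h p q\<close> stays
  in it and so competes at every maximum, also on the boundary. The possibly infinite end
  \<open>T\<close> is cut off: after some \<open>T1 < T\<close> all functions are small, and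
  compactness is used on \<open>[0, t1]\<close> with \<open>t1 < T\<close> only. The parameters are
  fixed in the order accuracy, \<open>T1\<close>, \<eta>, \<epsilon>, \<gamma>, mesh.\<close>

definition path_prob ::
  "('i::finite \<Rightarrow> 'j::finite \<Rightarrow> real ^ 'w ^ 'w::finite) \<Rightarrow> (nat \<Rightarrow> real) \<Rightarrow> nat \<Rightarrow> real ^ 'w \<Rightarrow>
   ('i, 'j, 'i) strategy \<Rightarrow> ('i, 'j, 'j) strategy \<Rightarrow> ('w \<times> 'i \<times> 'j) list \<Rightarrow> real" where
  "path_prob q s n p \<sigma> \<tau> xs =
     (\<Prod>l<length xs. pmf (stage_law q s n p \<sigma> \<tau> l (\<lambda>m. xs ! m)) (xs ! l))"

lemma path_prob_Nil: "path_prob q s n p \<sigma> \<tau> [] = 1"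
  by (simp add: path_prob_def)

text \<open>Causality: only coordinates before \<open>l\<close> are read. A list accessed by
  \<open>!\<close> beyond its length, or a restricted function with \<open>undefined\<close> values,
  may therefore stand for a past.\<close>

lemma stage_law_cong:
  assumes "\<And>m. m < l \<Longrightarrow> x m = y m"
  shows "stage_law q s n p \<sigma> \<tau> l x = stage_law q s n p \<sigma> \<tau> l y"
proof -
  have "action_history x l = action_history y l"
    using assms by (auto simp: action_history_def)
  then show ?thesis
    using assms by (cases l) (auto simp: stage_law_def)
qed

text \<open>Conditioning on the first triple leaves a play of the same kind, begun one stage later.
  The row of \<open>w\<close> is the law of the next state and takes the place of the initial
  belief; the strategies become their continuations after \<open>(i, j)\<close>.\<close>

lemma stage_law_shift:
  fixes q :: "'i::finite \<Rightarrow> 'j::finite \<Rightarrow> real ^ 'w ^ 'w::finite"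
  shows "stage_law q s n p \<sigma> \<tau> (Suc l) (\<lambda>m. ((w, i, j) # xs) ! m) =
    stage_law q s (Suc n) ((mat 1 + duration s n *\<^sub>R q i j) $ w)
      (\<lambda>h. \<sigma> ((i, j) # h)) (\<lambda>h. \<tau> ((i, j) # h)) l (\<lambda>m. xs ! m)"
proof -
  have "[0..<Suc l] = 0 # map Suc [0..<l]"
    by (simp add: upt_conv_Cons map_Suc_upt del: upt_Suc)
  then have "action_history (\<lambda>m. ((w, i, j) # xs) ! m) (Suc l) =
      (i, j) # action_history (\<lambda>m. xs ! m) l"
    by (simp add: action_history_def comp_def del: upt_Suc)
  then show ?thesis
    by (cases l) (auto simp: stage_law_def next_state_def)
qed

lemma path_prob_Cons:
  "path_prob q s n p \<sigma> \<tau> ((w, i, j) # xs) =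
    pmf (vec_pmf p) w * pmf (\<sigma> []) i * pmf (\<tau> []) j *
    path_prob q s (Suc n) ((mat 1 + duration s n *\<^sub>R q i j) $ w)
      (\<lambda>h. \<sigma> ((i, j) # h)) (\<lambda>h. \<tau> ((i, j) # h)) xs"
proof -
  have "pmf (stage_law q s n p \<sigma> \<tau> 0 (\<lambda>m. ((w, i, j) # xs) ! m)) (w, i, j) =
      pmf (vec_pmf p) w * pmf (\<sigma> []) i * pmf (\<tau> []) j"
    by (simp add: stage_law_def pmf_pair action_history_def)
  then show ?thesis
    unfolding path_prob_def
    by (simp only: length_Cons prod.lessThan_Suc_shift stage_law_shift nth_Cons_Suc nth_Cons_0)
qed

lemma map_upt_eq_iff: "map x [0..<L] = xs \<longleftrightarrow> length xs = L \<and> (\<forall>m<L. x m = xs ! m)"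
  by (metis diff_zero length_map length_upt add_0 nth_map_upt nth_equalityI)

text \<open>All factors are finite, so it suffices to follow single points: \<open>C 0 L\<close> is
  the law of the first \<open>L\<close> triples, \<open>eP L\<close> appends one more, and the
  masses of singletons multiply. \<open>CI\<close> and the projective limit then pass the mass on to
  the cylinder.\<close>

lemma emeasure_play_law_path:
  fixes q :: "'i::finite \<Rightarrow> 'j::finite \<Rightarrow> real ^ 'w ^ 'w::finite"
  shows "emeasure (play_law q s n p \<sigma> \<tau>) {x. map x [0..<length xs] = xs} =
      ennreal (path_prob q s n p \<sigma> \<tau> xs)"
proof -
  define P where "P = (\<lambda>l x. measure_pmf (stage_law q s n p \<sigma> \<tau> l x))"
  define M where "M = (\<lambda>_::nat. count_space (UNIV::('w \<times> 'i \<times> 'j) set))"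
  interpret IT: Ionescu_Tulcea P M
    unfolding P_def M_def by (rule play_law_locale)
  have PiM_eq: "PiM {0..<L} M = count_space (PiE {0..<L} (\<lambda>_. UNIV))" for L :: nat
    unfolding M_def by (intro count_space_PiM_finite) (auto intro: countable_finite)
  define f where "f = (\<lambda>L. restrict (\<lambda>m. xs ! m) {0..<L})"
  have f_sp: "f L \<in> space (PiM {0..<L} M)" for L
    by (auto simp: f_def PiM_eq)
  have C: "emeasure (IT.C 0 L (\<lambda>_. undefined)) {f L} = ennreal (\<Prod>l<L. pmf (stage_law q s n p \<sigma> \<tau> l (\<lambda>m. xs ! m)) (xs ! l))" for L
  proof (induction L)
    case 0
    have "f 0 = (\<lambda>_. undefined)" by (auto simp: f_def)
    then show ?case by (simp add: PiM_empty)
  next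
    case (Suc L)
    have u: "(\<lambda>_. undefined) \<in> space (PiM {0..<0} M)" by (simp add: space_PiM)
    have meas: "IT.eP L \<in> measurable (IT.C 0 L (\<lambda>_. undefined)) (subprob_algebra (PiM {0..<Suc L} M))"
      by (subst measurable_cong_sets[OF IT.sets_C[OF u, of L] refl], simp only: add_0, rule IT.measurable_eP)
    have "emeasure (IT.C 0 (Suc L) (\<lambda>_. undefined)) {f (Suc L)} =
        (\<integral>\<^sup>+x. emeasure (IT.eP L x) {f (Suc L)} \<partial>IT.C 0 L (\<lambda>_. undefined))"
      by (simp, rule emeasure_bind[OF _ meas])
         (auto simp: IT.space_C[OF u] PiM_eq f_def)
    also have "\<dots> = (\<integral>\<^sup>+x. ennreal (pmf (stage_law q s n p \<sigma> \<tau> L (\<lambda>m. xs ! m)) (xs ! L)) * indicator {f L} x \<partial>IT.C 0 L (\<lambda>_. undefined))"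
    proof (rule nn_integral_cong)
      fix x assume "x \<in> space (IT.C 0 L (\<lambda>_. undefined))"
      then have x: "x \<in> space (PiM {0..<L} M)" by (simp add: IT.space_C[OF u])
      have sx: "space (M L) = UNIV" by (simp add: M_def)
      \<comment> \<open>Points of the product over \<open>{0..<L}\<close> are
        \<open>undefined\<close> from \<open>L\<close> on. Overwriting position \<open>L\<close>
        thus loses nothing, and \<open>x(L := y)\<close> determines both \<open>x\<close> and
        \<open>y\<close>.\<close>
      have ext: "x m = undefined" if "m \<ge> L" for m
        using x that by (auto simp: PiM_eq PiE_iff extensional_def)
      have fL: "f (Suc L) = (f L)(L := xs ! L)"
        by (auto simp: f_def fun_eq_iff)
      have fu: "f L L = undefined" by (simp add: f_def)
      have xu: "x L = undefined" using ext by simp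
      have iff: "x(L := y) = (f L)(L := xs ! L) \<longleftrightarrow> x = f L \<and> y = xs ! L" for y
        using fu xu by (metis fun_upd_same fun_upd_triv fun_upd_upd)
      have "emeasure (IT.eP L x) {f (Suc L)} = emeasure (P L x) ((\<lambda>y. x(L := y)) -` {f (Suc L)} \<inter> space (M L))"
        by (rule IT.emeasure_eP[OF x]) (simp add: PiM_eq, auto simp: f_def)
      also have "(\<lambda>y. x(L := y)) -` {f (Suc L)} \<inter> space (M L) = (if x = f L then {xs ! L} else {})"
        unfolding fL sx using iff by auto
      also have "emeasure (P L x) \<dots> = ennreal (pmf (stage_law q s n p \<sigma> \<tau> L (\<lambda>m. xs ! m)) (xs ! L)) * indicator {f L} x"
        using stage_law_cong[of L "f L" "\<lambda>m. xs ! m" q s n p \<sigma> \<tau>]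
        by (auto simp: P_def emeasure_pmf_single f_def)
      finally show "emeasure (IT.eP L x) {f (Suc L)} = \<dots>" .
    qed
    also have "\<dots> = ennreal (pmf (stage_law q s n p \<sigma> \<tau> L (\<lambda>m. xs ! m)) (xs ! L)) * emeasure (IT.C 0 L (\<lambda>_. undefined)) {f L}"
      by (rule nn_integral_cmult_indicator) (simp add: IT.sets_C[OF u] PiM_eq, use f_sp[of L] in \<open>simp add: PiM_eq\<close>)
    finally show ?case
      unfolding Suc.IH by (simp add: mult.commute ennreal_mult prod_nonneg)
  qed
  let ?L = "length xs"
  have sets: "{f ?L} \<in> sets (PiM {0..<?L} M)"
    using f_sp[of ?L] by (simp add: PiM_eq)
  have emb: "IT.PF.emb UNIV {0..<?L} {f ?L} = {x. map x [0..<?L] = xs}"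
  proof -
    have "restrict x {0..<?L} = restrict (\<lambda>m. xs ! m) {0..<?L} \<longleftrightarrow> map x [0..<?L] = xs" for x
      unfolding map_upt_eq_iff by (auto simp: restrict_def fun_eq_iff)
    then show ?thesis
      by (intro set_eqI) (simp only: prod_emb_iff M_def f_def space_count_space singleton_iff mem_Collect_eq extensional_UNIV UNIV_I ball_UNIV simp_thms)
  qed
  have "emeasure IT.PF.lim (IT.PF.emb UNIV {0..<?L} {f ?L}) = emeasure (IT.CI {0..<?L}) {f ?L}"
    by (rule IT.lim) (auto simp: sets)
  also have "\<dots> = emeasure (IT.C 0 ?L (\<lambda>_. undefined)) (IT.PF.emb {0..<?L} {0..<?L} {f ?L})"
    by (rule IT.emeasure_CI) (auto simp: sets)
  also have "IT.PF.emb {0..<?L} {0..<?L} {f ?L} = {f ?L}"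
    using sets.sets_into_space[OF sets] by (simp add: prod_emb_id space_PiM)
  finally show ?thesis
    unfolding emb C by (simp add: play_law_def P_def M_def path_prob_def)
qed

lemma finite_lists_length: "finite {xs :: 'a::finite list. length xs = L}"
  using finite_lists_length_eq[of "UNIV::'a set" L] by simp

lemma sets_play_law:
  fixes q :: "'i::finite \<Rightarrow> 'j::finite \<Rightarrow> real ^ 'w ^ 'w::finite"
  shows "sets (play_law q s n p \<sigma> \<tau>) = sets (PiM UNIV (\<lambda>_. count_space UNIV))"
proof -
  interpret IT: Ionescu_Tulcea "\<lambda>l x. measure_pmf (stage_law q s n p \<sigma> \<tau> l x)" "\<lambda>_. count_space UNIV"
    by (rule play_law_locale)
  show ?thesis unfolding play_law_def by (rule IT.PF.sets_lim)
qed

lemma path_event_in_sets: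
  fixes q :: "'i::finite \<Rightarrow> 'j::finite \<Rightarrow> real ^ 'w ^ 'w::finite"
  shows "{x. map x [0..<L] = xs} \<in> sets (play_law q s n p \<sigma> \<tau>)"
proof -
  have "Measurable.pred (PiM UNIV (\<lambda>_. count_space UNIV)) (\<lambda>x::nat \<Rightarrow> 'w \<times> 'i \<times> 'j. \<forall>m<L. x m = xs ! m)"
    by measurable
  then have "{x::nat \<Rightarrow> 'w \<times> 'i \<times> 'j. \<forall>m<L. x m = xs ! m} \<in> sets (PiM UNIV (\<lambda>_. count_space UNIV))"
    by (simp add: pred_def space_PiM)
  moreover have "{x. map x [0..<L] = xs} = (if length xs = L then {x. \<forall>m<L. x m = xs ! m} else {})"
    by (auto simp: map_upt_eq_iff)
  ultimately show ?thesis by (simp add: sets_play_law)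
qed

text \<open>A function of \<open>L\<close> coordinates with finitely many values each is a finite
  combination of indicators of cylinders, and these have the path probabilities as measures.\<close>

lemma integral_play_law:
  fixes q :: "'i::finite \<Rightarrow> 'j::finite \<Rightarrow> real ^ 'w ^ 'w::finite"
    and f :: "('w \<times> 'i \<times> 'j) list \<Rightarrow> real"
  shows "(\<integral>x. f (map x [0..<L]) \<partial>play_law q s n p \<sigma> \<tau>) =
      (\<Sum>xs | length xs = L. path_prob q s n p \<sigma> \<tau> xs * f xs)"
proof -
  let ?M = "play_law q s n p \<sigma> \<tau>"
  interpret prob_space ?M by (rule prob_space_play_law)
  note fin = finite_lists_length[where 'a="'w \<times> 'i \<times> 'j"]
  have eq: "f (map x [0..<L]) = (\<Sum>xs | length xs = L. f xs * indicator {x. map x [0..<L] = xs} x)" for x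
  proof -
    have "(\<Sum>xs | length xs = L. f xs * indicator {x. map x [0..<L] = xs} x) =
      (\<Sum>xs | length xs = L. if map x [0..<L] = xs then f xs else 0)"
      by (intro sum.cong) (auto split: split_indicator)
    also have "\<dots> = f (map x [0..<L])"
      using fin by (subst sum.delta') auto
    finally show ?thesis by simp
  qed
  have m: "measure ?M {x. map x [0..<L] = xs} = path_prob q s n p \<sigma> \<tau> xs" if "length xs = L" for xs
    using emeasure_play_law_path[of q s n p \<sigma> \<tau> xs] that
    by (simp add: measure_def path_prob_def prod_nonneg)
  have "(\<integral>x. f (map x [0..<L]) \<partial>?M) = (\<Sum>xs | length xs = L. f xs * measure ?M {x. map x [0..<L] = xs})"
    unfolding eq using path_event_in_sets[of L _ q s n p \<sigma> \<tau>]
    by (subst Bochner_Integration.integral_sum)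
       (auto intro!: integrable_mult_right integrable_real_indicator emeasure_finite less_top[THEN iffD1])
  then show ?thesis
    using m by (auto intro!: sum.cong)
qed

section \<open>Sup-inf values and value operators\<close>

text \<open>Suprema and infima of reals carry information on bounded sets only, hence the uniform
  bound \<open>B\<close>. Optimal replies may fail to exist, so this rule and the next three speak
  of replies optimal up to \<open>e\<close>.\<close>

lemma supinf_leI:
  fixes f :: "'x \<Rightarrow> 'y \<Rightarrow> real"
  assumes "\<And>x y. \<bar>f x y\<bar> \<le> B" "\<And>e x. e > 0 \<Longrightarrow> \<exists>y. f x y \<le> c + e"
  shows "(SUP x. INF y. f x y) \<le> c"
proof (rule cSUP_least)
  fix x
  have bdd: "bdd_below (range (f x))"
    using assms(1)[of x] by (intro bdd_belowI2[of _ "-B"]) (auto simp: abs_le_iff minus_le_iff)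
  show "(INF y. f x y) \<le> c"
  proof (rule field_le_epsilon)
    fix e :: real assume "e > 0"
    then obtain y where "f x y \<le> c + e" using assms(2) by blast
    then show "(INF y. f x y) \<le> c + e"
      using bdd by (auto intro: cINF_lower2)
  qed
qed simp

lemma supinf_geI:
  fixes f :: "'x \<Rightarrow> 'y \<Rightarrow> real"
  assumes "\<And>x y. \<bar>f x y\<bar> \<le> B" "\<And>e. e > 0 \<Longrightarrow> \<exists>x. \<forall>y. c - e \<le> f x y"
  shows "c \<le> (SUP x. INF y. f x y)"
proof (rule field_le_epsilon)
  fix e :: real assume "e > 0"
  then obtain x where x: "\<And>y. c - e \<le> f x y" using assms(2) by blast
  have bdd: "bdd_below (range (f x))" for x
    using assms(1)[of x] by (intro bdd_belowI2[of _ "-B"]) (auto simp: abs_le_iff minus_le_iff)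
  have "(INF y. f x y) \<le> B" for x
    using cINF_lower[OF bdd[of x], of undefined] assms(1)[of x undefined] by auto
  then have "bdd_above (range (\<lambda>x. INF y. f x y))"
    by (intro bdd_aboveI2)
  moreover have "c - e \<le> (INF y. f x y)"
    by (rule cINF_greatest) (auto intro: x)
  ultimately have "c - e \<le> (SUP x. INF y. f x y)"
    by (meson UNIV_I cSUP_upper2)
  then show "c \<le> (SUP x. INF y. f x y) + e" by simp
qed

lemma supinf_upper:
  fixes f :: "'x \<Rightarrow> 'y \<Rightarrow> real"
  assumes "\<And>x y. \<bar>f x y\<bar> \<le> B" "e > 0"
  shows "\<exists>y. f x y \<le> (SUP x. INF y. f x y) + e"
proof (rule ccontr)
  assume "\<not> ?thesis"
  then have less: "(SUP x. INF y. f x y) + e < f x y" for y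
    by (simp add: not_le)
  have "(SUP x. INF y. f x y) + e \<le> (SUP x. INF y. f x y)"
  proof (rule supinf_geI[OF assms(1)])
    fix d :: real assume "d > 0"
    then show "\<exists>x. \<forall>y. (SUP x. INF y. f x y) + e - d \<le> f x y"
      using less by (intro exI[of _ x]) (auto intro: order_trans[OF _ less_imp_le[OF less]])
  qed
  then show False using assms(2) by simp
qed

lemma supinf_lower:
  fixes f :: "'x \<Rightarrow> 'y \<Rightarrow> real"
  assumes "\<And>x y. \<bar>f x y\<bar> \<le> B" "e > 0"
  shows "\<exists>x. \<forall>y. (SUP x. INF y. f x y) - e \<le> f x y"
proof (rule ccontr)
  assume "\<not> ?thesis"
  then have "\<exists>y. f x y \<le> (SUP x. INF y. f x y) - e" for x
    by (meson less_imp_le not_le)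
  then have "(SUP x. INF y. f x y) \<le> (SUP x. INF y. f x y) - e"
    by (intro supinf_leI[OF assms(1)]) (meson add_increasing2 less_imp_le order_refl order_trans)
  then show False using assms(2) by simp
qed

section \<open>Matrix games in mixed actions and abstract value operators\<close>

definition mixed_payoff :: "'i::finite pmf \<Rightarrow> 'j::finite pmf \<Rightarrow> ('i \<Rightarrow> 'j \<Rightarrow> real) \<Rightarrow> real" where
  "mixed_payoff x y a = (\<Sum>i\<in>UNIV. \<Sum>j\<in>UNIV. pmf x i * pmf y j * a i j)"

lemma mixed_payoff_mono:
  "(\<And>i j. a i j \<le> b i j) \<Longrightarrow> mixed_payoff x y a \<le> mixed_payoff x y b"
  unfolding mixed_payoff_def by (intro sum_mono mult_left_mono) auto

lemma mixed_payoff_add: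
  "mixed_payoff x y (\<lambda>i j. a i j + b i j) = mixed_payoff x y a + mixed_payoff x y b"
  by (simp add: mixed_payoff_def algebra_simps sum.distrib)

lemma mixed_payoff_const: "mixed_payoff x y (\<lambda>i j. c) = c"
  by (simp add: mixed_payoff_def mult.assoc sum_pmf_eq_1 flip: sum_distrib_left sum_distrib_right)

lemma mixed_payoff_cmult: "mixed_payoff x y (\<lambda>i j. c * a i j) = c * mixed_payoff x y a"
  by (simp add: mixed_payoff_def algebra_simps sum_distrib_left)

lemma mixed_payoff_sum:
  "mixed_payoff x y (\<lambda>i j. \<Sum>w\<in>A. f w i j) = (\<Sum>w\<in>A. mixed_payoff x y (f w))"
  by (induction A rule: infinite_finite_induct) (auto simp: mixed_payoff_const mixed_payoff_add)

lemma abs_mixed_payoff_le: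
  assumes "\<And>i j. \<bar>a i j\<bar> \<le> c"
  shows "\<bar>mixed_payoff x y a\<bar> \<le> c"
proof -
  have "mixed_payoff x y a \<le> c"
    using mixed_payoff_mono[of a "\<lambda>i j. c" x y] assms by (auto simp: mixed_payoff_const abs_le_iff)
  moreover have "- c \<le> mixed_payoff x y a"
    using mixed_payoff_mono[of "\<lambda>i j. - c" a x y] assms by (auto simp: mixed_payoff_const abs_le_iff minus_le_iff)
  ultimately show ?thesis by (simp add: abs_le_iff)
qed

lemma finite_matrix_bound:
  fixes a :: "'i::finite \<Rightarrow> 'j::finite \<Rightarrow> real"
  obtains B where "\<And>i j. \<bar>a i j\<bar> \<le> B"
proof
  show "\<bar>a i j\<bar> \<le> (\<Sum>i\<in>UNIV. \<Sum>j\<in>UNIV. \<bar>a i j\<bar>)" for i j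
    by (rule order_trans[OF member_le_sum[of j UNIV "\<lambda>j. \<bar>a i j\<bar>"] member_le_sum[of i UNIV "\<lambda>i. \<Sum>j\<in>UNIV. \<bar>a i j\<bar>"]])
       (auto intro: sum_nonneg)
qed

lemma matrix_game_value_eq: "matrix_game_value a = (SUP x. INF y. mixed_payoff x y a)"
  by (simp add: matrix_game_value_def mixed_payoff_def)

lemma matrix_game_value_upper:
  assumes "e > 0"
  shows "\<exists>y. mixed_payoff x y a \<le> matrix_game_value a + e"
proof -
  obtain A where A: "\<And>i j. \<bar>a i j\<bar> \<le> A"
    using finite_matrix_bound by metis
  show ?thesis
    unfolding matrix_game_value_eq
    by (rule supinf_upper[where f = "\<lambda>x y. mixed_payoff x y a", OF abs_mixed_payoff_le[OF A] assms])
qed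

lemma matrix_game_value_lower:
  assumes "e > 0"
  shows "\<exists>x. \<forall>y. matrix_game_value a - e \<le> mixed_payoff x y a"
proof -
  obtain A where A: "\<And>i j. \<bar>a i j\<bar> \<le> A"
    using finite_matrix_bound by metis
  show ?thesis
    unfolding matrix_game_value_eq
    by (rule supinf_lower[where f = "\<lambda>x y. mixed_payoff x y a", OF abs_mixed_payoff_le[OF A] assms])
qed

text \<open>Monotonicity and translation combine to the one-sided estimate
  \<open>value_operator_le_add\<close>; homogeneity lets a stage duration be factored out of a
  one-stage game.\<close>

definition value_operator :: "(('i \<Rightarrow> 'j \<Rightarrow> real) \<Rightarrow> real) \<Rightarrow> bool" where
  "value_operator F \<longleftrightarrow>
     (\<forall>a b. (\<forall>i j. a i j \<le> b i j) \<longrightarrow> F a \<le> F b) \<and>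
     (\<forall>a c. F (\<lambda>i j. a i j + c) = F a + c) \<and>
     (\<forall>a c. 0 < c \<longrightarrow> F (\<lambda>i j. c * a i j) = c * F a)"

lemma value_operator_mono: "value_operator F \<Longrightarrow> (\<And>i j. a i j \<le> b i j) \<Longrightarrow> F a \<le> F b"
  by (simp add: value_operator_def)

lemma value_operator_add: "value_operator F \<Longrightarrow> F (\<lambda>i j. a i j + c) = F a + c"
  by (simp add: value_operator_def)

lemma value_operator_cmult: "value_operator F \<Longrightarrow> 0 < c \<Longrightarrow> F (\<lambda>i j. c * a i j) = c * F a"
  by (simp add: value_operator_def)

lemma value_operator_le_add:
  "value_operator F \<Longrightarrow> (\<And>i j. a i j \<le> b i j + c) \<Longrightarrow> F a \<le> F b + c"
  using value_operator_mono[of F a "\<lambda>i j. b i j + c"] by (simp add: value_operator_add)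

lemma value_operator_matrix_game_value:
  "value_operator (matrix_game_value :: ('i::finite \<Rightarrow> 'j::finite \<Rightarrow> real) \<Rightarrow> real)"
proof -
  have le: "matrix_game_value a \<le> matrix_game_value b + c"
    if ab: "\<And>i j. a i j \<le> b i j + c" for a b :: "'i \<Rightarrow> 'j \<Rightarrow> real" and c
  proof -
    obtain A B where A: "\<And>i j. \<bar>a i j\<bar> \<le> A" and B: "\<And>i j. \<bar>b i j\<bar> \<le> B"
      using finite_matrix_bound by metis
    have step: "mixed_payoff x y a \<le> mixed_payoff x y b + c" for x y
      using mixed_payoff_mono[OF ab] by (simp add: mixed_payoff_add mixed_payoff_const)
    have "(SUP x. INF y. mixed_payoff x y a) \<le> (SUP x. INF y. mixed_payoff x y b) + c"
    proof (rule supinf_leI[OF abs_mixed_payoff_le[OF A]])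
      fix e :: real and x :: "'i pmf" assume "e > 0"
      from supinf_upper[where f="\<lambda>x y. mixed_payoff x y b", OF abs_mixed_payoff_le[OF B] this]
      obtain y where "mixed_payoff x y b \<le> (SUP x. INF y. mixed_payoff x y b) + e" by blast
      then show "\<exists>y. mixed_payoff x y a \<le> (SUP x. INF y. mixed_payoff x y b) + c + e"
        using step[of x y] by (intro exI[of _ y]) linarith
    qed
    then show ?thesis
      unfolding matrix_game_value_eq .
  qed
  have cm: "matrix_game_value (\<lambda>i j. c * a i j) \<le> c * matrix_game_value a"
    if c: "c > 0" for a :: "'i \<Rightarrow> 'j \<Rightarrow> real" and c
  proof -
    obtain A where A: "\<And>i j. \<bar>a i j\<bar> \<le> A"
      using finite_matrix_bound by metis
    have cA: "\<bar>c * a i j\<bar> \<le> c * A" for i j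
      using A[of i j] c by (simp add: abs_mult)
    show ?thesis
      unfolding matrix_game_value_eq
    proof (rule supinf_leI[OF abs_mixed_payoff_le[OF cA]])
      fix e :: real and x :: "'i pmf" assume "e > 0"
      then have "e / c > 0" using c by simp
      from supinf_upper[where f="\<lambda>x y. mixed_payoff x y a", OF abs_mixed_payoff_le[OF A] this]
      obtain y where "mixed_payoff x y a \<le> (SUP x. INF y. mixed_payoff x y a) + e / c" by blast
      then have "c * mixed_payoff x y a \<le> c * ((SUP x. INF y. mixed_payoff x y a) + e / c)"
        using c by simp
      then show "\<exists>y. mixed_payoff x y (\<lambda>i j. c * a i j) \<le> c * (SUP x. INF y. mixed_payoff x y a) + e"
        using c by (intro exI[of _ y]) (simp add: mixed_payoff_cmult distrib_left)
    qed
  qed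
  have "matrix_game_value (\<lambda>i j. c * a i j) = c * matrix_game_value a"
    if c: "c > 0" for a :: "'i \<Rightarrow> 'j \<Rightarrow> real" and c
  proof (rule antisym)
    \<comment> \<open>The reverse inequality is the one just shown, with the factor
      \<open>inverse c\<close> and the matrix \<open>c * a\<close>.\<close>
    have "matrix_game_value (\<lambda>i j. inverse c * (c * a i j)) \<le> inverse c * matrix_game_value (\<lambda>i j. c * a i j)"
      using c by (intro cm) simp
    also have "(\<lambda>i j. inverse c * (c * a i j)) = a"
      using c by (simp add: mult.assoc[symmetric])
    finally have "matrix_game_value a \<le> matrix_game_value (\<lambda>i j. c * a i j) / c"
      by (simp add: divide_inverse mult.commute)
    then show "c * matrix_game_value a \<le> matrix_game_value (\<lambda>i j. c * a i j)"
      using c by (simp add: pos_le_divide_eq mult.commute)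
  qed (rule cm[OF c])
  moreover have "matrix_game_value (\<lambda>i j. a i j + c) = matrix_game_value a + c" for a :: "'i \<Rightarrow> 'j \<Rightarrow> real" and c
    using le[of "\<lambda>i j. a i j + c" a c] le[of a "\<lambda>i j. a i j + c" "- c"] by auto
  moreover have "matrix_game_value a \<le> matrix_game_value b" if "\<And>i j. a i j \<le> b i j" for a b :: "'i \<Rightarrow> 'j \<Rightarrow> real"
    using le[of a b 0] that by simp
  ultimately show ?thesis
    unfolding value_operator_def by blast
qed

text \<open>For \<open>F = matrix_game_value\<close> this is the infimum over mixed actions of
  player 1 of the supremum over those of player 2: maximizer and minimizer have exchanged
  roles.\<close>

definition dual_operator :: "(('i \<Rightarrow> 'j \<Rightarrow> real) \<Rightarrow> real) \<Rightarrow> ('i \<Rightarrow> 'j \<Rightarrow> real) \<Rightarrow> real" where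
  "dual_operator F a = - F (\<lambda>i j. - a i j)"

lemma value_operator_dual_operator:
  assumes "value_operator F"
  shows "value_operator (dual_operator F)"
proof -
  have "- F (\<lambda>i j. - (a i j + c)) = - F (\<lambda>i j. - a i j) + c" for a c
    using value_operator_add[OF assms, of "\<lambda>i j. - a i j" "- c"] by (simp add: algebra_simps)
  moreover have "- F (\<lambda>i j. - (c * a i j)) = c * - F (\<lambda>i j. - a i j)" if "c > 0" for a c
    using value_operator_cmult[OF assms that, of "\<lambda>i j. - a i j"] by simp
  moreover have "- F (\<lambda>i j. - a i j) \<le> - F (\<lambda>i j. - b i j)" if "\<And>i j. a i j \<le> b i j" for a b
    using value_operator_mono[OF assms, of "\<lambda>i j. - b i j" "\<lambda>i j. - a i j"] that by simp
  ultimately show ?thesis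
    unfolding value_operator_def dual_operator_def by blast
qed

section \<open>Expected stage payoffs\<close>

text \<open>The expected payoff \<open>l\<close> stages after stage \<open>n\<close>, computed on
  beliefs instead of states. Actions chosen without seeing the state carry no information about it,
  so the pair \<open>(i, j)\<close> moves the belief deterministically.\<close>

primrec stage_payoff ::
  "('i::finite \<Rightarrow> 'j::finite \<Rightarrow> 'w::finite \<Rightarrow> real) \<Rightarrow> ('i \<Rightarrow> 'j \<Rightarrow> real ^ 'w ^ 'w) \<Rightarrow> (nat \<Rightarrow> real) \<Rightarrow>
   nat \<Rightarrow> nat \<Rightarrow> real ^ 'w \<Rightarrow> ('i, 'j, 'i) strategy \<Rightarrow> ('i, 'j, 'j) strategy \<Rightarrow> real" where
  "stage_payoff g q s 0 n p \<sigma> \<tau> =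
     mixed_payoff (\<sigma> []) (\<tau> []) (\<lambda>i j. \<Sum>w\<in>UNIV. p $ w * g i j w)"
| "stage_payoff g q s (Suc l) n p \<sigma> \<tau> =
     mixed_payoff (\<sigma> []) (\<tau> []) (\<lambda>i j.
       stage_payoff g q s l (Suc n) (p v* (mat 1 + duration s n *\<^sub>R q i j))
         (\<lambda>h. \<sigma> ((i, j) # h)) (\<lambda>h. \<tau> ((i, j) # h)))"

lemma linear_vector_matrix_mult: "linear (\<lambda>p :: real ^ 'w::finite. p v* A)"
  by (intro linearI) (auto simp: vector_matrix_mult_def vec_eq_iff algebra_simps sum.distrib sum_distrib_left)

lemma vector_matrix_mult_rows: "(p :: real ^ 'w::finite) v* A = (\<Sum>w\<in>UNIV. p $ w *\<^sub>R A $ w)"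
  by (simp add: vector_matrix_mult_def vec_eq_iff mult.commute)

lemma vector_matrix_mult_step:
  "(p :: real ^ 'w::finite) v* (mat 1 + h *\<^sub>R A) = p + h *\<^sub>R (p v* A)"
proof -
  have "p v* (mat 1 + h *\<^sub>R A) = p v* mat 1 + h *\<^sub>R (p v* A)"
    by (simp add: vector_matrix_mult_def vec_eq_iff algebra_simps sum.distrib sum_distrib_left)
  then show ?thesis by simp
qed

text \<open>Strategies are maps of action histories and stay fixed while \<open>p\<close> varies.
  Linearity on the whole space, and not on the simplex alone, allows averaging over states as well
  as evaluation at differences of beliefs.\<close>

lemma linear_stage_payoff: "linear (\<lambda>p. stage_payoff g q s l n p \<sigma> \<tau>)"
proof (induction l arbitrary: n \<sigma> \<tau>)
  case 0
  show ?case
    by (auto intro!: linearI simp: mixed_payoff_add[symmetric] mixed_payoff_cmult[symmetric]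
        algebra_simps sum.distrib sum_distrib_left)
next
  case (Suc l)
  have "linear (\<lambda>p. stage_payoff g q s l (Suc n) (p v* (mat 1 + duration s n *\<^sub>R q i j))
         (\<lambda>h. \<sigma> ((i, j) # h)) (\<lambda>h. \<tau> ((i, j) # h)))" for i j
    using linear_compose[OF linear_vector_matrix_mult Suc.IH] by (simp add: o_def)
  note lin = linear_add[OF this] linear_scale[OF this]
  show ?case
    by (intro linearI) (simp_all add: lin mixed_payoff_add mixed_payoff_cmult)
qed

lemma prob_simplex_step:
  assumes "kernel_matrix Q" "0 \<le> h" "h \<le> 1" "p \<in> prob_simplex"
  shows "p v* (mat 1 + h *\<^sub>R Q) \<in> prob_simplex"
proof -
  have row: "(mat 1 + h *\<^sub>R Q) $ w \<in> prob_simplex" for w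
    using stage_matrix_in_simplex[OF assms(1-3)] .
  have nonneg: "0 \<le> (mat 1 + h *\<^sub>R Q) $ w $ w'" for w w'
    using row[of w] unfolding prob_simplex_def by blast
  have one: "(\<Sum>w'\<in>UNIV. (mat 1 + h *\<^sub>R Q) $ w $ w') = 1" for w
    using row[of w] unfolding prob_simplex_def by blast
  let ?A = "mat 1 + h *\<^sub>R Q"
  have eq: "(p v* ?A) $ w' = (\<Sum>w\<in>UNIV. p $ w * ?A $ w $ w')" for w'
    by (simp add: vector_matrix_mult_rows)
  have "(\<Sum>w'\<in>UNIV. \<Sum>w\<in>UNIV. p $ w * ?A $ w $ w') = (\<Sum>w\<in>UNIV. p $ w * (\<Sum>w'\<in>UNIV. ?A $ w $ w'))"
    unfolding sum_distrib_left by (rule sum.swap)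
  also have "\<dots> = 1"
    using assms(4) unfolding one by (simp add: prob_simplex_def)
  finally show ?thesis
    using assms(4) nonneg unfolding prob_simplex_def mem_Collect_eq eq
    by (auto intro!: sum_nonneg mult_nonneg_nonneg)
qed

lemma sum_lists_Suc:
  fixes F :: "'a::finite list \<Rightarrow> real"
  shows "(\<Sum>xs | length xs = Suc L. F xs) = (\<Sum>y\<in>UNIV. \<Sum>xs | length xs = L. F (y # xs))"
proof -
  have "{xs :: 'a list. length xs = Suc L} = (\<lambda>(y, xs). y # xs) ` (UNIV \<times> {xs. length xs = L})"
    by (auto simp: length_Suc_conv image_iff)
  then have "(\<Sum>xs | length xs = Suc L. F xs) = (\<Sum>(y, xs)\<in>UNIV \<times> {xs. length xs = L}. F (y # xs))"
    by (simp add: sum.reindex inj_on_def case_prod_unfold)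
  then show ?thesis by (simp add: sum.cartesian_product)
qed

lemma sum_triple:
  fixes F :: "'w::finite \<times> 'i::finite \<times> 'j::finite \<Rightarrow> real"
  shows "(\<Sum>y\<in>UNIV. F y) = (\<Sum>w\<in>UNIV. \<Sum>i\<in>UNIV. \<Sum>j\<in>UNIV. F (w, i, j))"
  by (simp add: sum.cartesian_product)

lemma abs_simplex_average_le:
  assumes "p \<in> prob_simplex" "\<And>w. \<bar>f w\<bar> \<le> c"
  shows "\<bar>\<Sum>w\<in>UNIV. p $ w * f w\<bar> \<le> c"
proof -
  have "\<bar>\<Sum>w\<in>UNIV. p $ w * f w\<bar> \<le> (\<Sum>w\<in>UNIV. p $ w * c)"
    using assms by (intro order_trans[OF sum_abs] sum_mono) (auto simp: prob_simplex_def abs_mult intro!: mult_left_mono)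
  also have "\<dots> = c"
    using assms(1) by (simp add: prob_simplex_def flip: sum_distrib_right)
  finally show ?thesis .
qed

text \<open>Durations up to 1 make \<open>Id + h q = (1 - h) Id + h P\<close> a convex combination
  of stochastic matrices, which keeps beliefs in the simplex.\<close>

locale state_blind_game =
  fixes g :: "'i::finite \<Rightarrow> 'j::finite \<Rightarrow> 'w::finite \<Rightarrow> real"
    and q :: "'i \<Rightarrow> 'j \<Rightarrow> real ^ 'w ^ 'w"
    and s :: "nat \<Rightarrow> real" and G :: real
  assumes kernel: "kernel_matrix (q i j)"
    and duration_pos: "0 < duration s n" and duration_le_1: "duration s n \<le> 1"
    and payoff_bound: "\<bar>g i j w\<bar> \<le> G"
begin

lemma belief_step:
  "p \<in> prob_simplex \<Longrightarrow> p v* (mat 1 + duration s n *\<^sub>R q i j) \<in> prob_simplex"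
  using prob_simplex_step kernel duration_pos duration_le_1 by (metis less_imp_le)

lemma stage_matrix_row: "(mat 1 + duration s n *\<^sub>R q i j) $ w \<in> prob_simplex"
  using stage_matrix_in_simplex kernel duration_pos duration_le_1 by (metis less_imp_le)

lemma abs_stage_payoff_le: "p \<in> prob_simplex \<Longrightarrow> \<bar>stage_payoff g q s l n p \<sigma> \<tau>\<bar> \<le> G"
proof (induction l arbitrary: n p \<sigma> \<tau>)
  case 0
  then show ?case
    by (auto intro!: abs_mixed_payoff_le abs_simplex_average_le payoff_bound)
next
  case (Suc l)
  then show ?case
    unfolding stage_payoff.simps by (intro abs_mixed_payoff_le Suc.IH belief_step)
qed

text \<open>The passage from states to beliefs. Splitting off the first triple leaves games started
  from the matrix rows of the possible states; by linearity of \<open>stage_payoff\<close>, their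
  average with weights \<open>p $ w\<close> is the game started from the updated belief.\<close>

lemma sum_path_prob:
  assumes "p \<in> prob_simplex"
  shows "(\<Sum>xs | length xs = Suc l. path_prob q s n p \<sigma> \<tau> xs * (case xs ! l of (w, i, j) \<Rightarrow> g i j w)) =
      stage_payoff g q s l n p \<sigma> \<tau>"
  using assms
proof (induction l arbitrary: n p \<sigma> \<tau>)
  case 0
  have "(\<Sum>xs | length xs = Suc 0. path_prob q s n p \<sigma> \<tau> xs * (case xs ! 0 of (w, i, j) \<Rightarrow> g i j w)) =
      (\<Sum>w\<in>UNIV. mixed_payoff (\<sigma> []) (\<tau> []) (\<lambda>i j. p $ w * g i j w))"
    using 0 unfolding sum_lists_Suc sum_triple
    by (simp add: path_prob_Cons path_prob_Nil pmf_vec_pmf mixed_payoff_def algebra_simps)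
  then show ?case
    by (simp add: mixed_payoff_sum)
next
  case (Suc l)
  let ?\<sigma> = "\<lambda>i j h. \<sigma> ((i, j) # h)" and ?\<tau> = "\<lambda>i j h. \<tau> ((i, j) # h)"
  let ?A = "\<lambda>i j. mat 1 + duration s n *\<^sub>R q i j"
  have "(\<Sum>xs | length xs = Suc (Suc l). path_prob q s n p \<sigma> \<tau> xs * (case xs ! Suc l of (w, i, j) \<Rightarrow> g i j w)) =
      (\<Sum>w\<in>UNIV. \<Sum>i\<in>UNIV. \<Sum>j\<in>UNIV. p $ w * pmf (\<sigma> []) i * pmf (\<tau> []) j *
        (\<Sum>xs | length xs = Suc l. path_prob q s (Suc n) (?A i j $ w) (?\<sigma> i j) (?\<tau> i j) xs *
          (case xs ! l of (w, i, j) \<Rightarrow> g i j w)))"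
    using Suc.prems
    by (subst sum_lists_Suc, subst sum_triple)
       (simp only: path_prob_Cons pmf_vec_pmf nth_Cons_Suc sum_distrib_left mult.assoc)
  also have "\<dots> = (\<Sum>w\<in>UNIV. mixed_payoff (\<sigma> []) (\<tau> []) (\<lambda>i j. p $ w * stage_payoff g q s l (Suc n) (?A i j $ w) (?\<sigma> i j) (?\<tau> i j)))"
    unfolding Suc.IH[OF stage_matrix_row] mixed_payoff_def by (simp only: mult_ac)
  also have "\<dots> = mixed_payoff (\<sigma> []) (\<tau> []) (\<lambda>i j. \<Sum>w\<in>UNIV. p $ w * stage_payoff g q s l (Suc n) (?A i j $ w) (?\<sigma> i j) (?\<tau> i j))"
    by (rule mixed_payoff_sum[symmetric])
  also have "(\<lambda>i j. \<Sum>w\<in>UNIV. p $ w * stage_payoff g q s l (Suc n) (?A i j $ w) (?\<sigma> i j) (?\<tau> i j)) =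
      (\<lambda>i j. stage_payoff g q s l (Suc n) (p v* ?A i j) (?\<sigma> i j) (?\<tau> i j))"
    by (simp only: vector_matrix_mult_rows linear_sum[OF linear_stage_payoff] linear_scale[OF linear_stage_payoff] real_scaleR_def)
  finally show ?case by simp
qed

lemma integral_stage:
  assumes "p \<in> prob_simplex"
  shows "(\<integral>x. (case x l of (w, i, j) \<Rightarrow> g i j w) \<partial>play_law q s n p \<sigma> \<tau>) = stage_payoff g q s l n p \<sigma> \<tau>"
proof -
  have "map x [0..<Suc l] ! l = x l" for x :: "nat \<Rightarrow> 'w \<times> 'i \<times> 'j"
    by (simp add: nth_append)
  then show ?thesis
    using integral_play_law[where f = "\<lambda>xs. case xs ! l of (w, i, j) \<Rightarrow> g i j w" and L = "Suc l"]
    by (simp only: sum_path_prob[OF assms])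
qed

end

section \<open>Dynamic programming\<close>

locale weighted_game = state_blind_game g q s G
  for g :: "'i::finite \<Rightarrow> 'j::finite \<Rightarrow> 'w::finite \<Rightarrow> real" and q s G +
  fixes k :: "real \<Rightarrow> real"
  assumes weight_nonneg: "0 \<le> k (s n)"
    and summable_weight: "summable (\<lambda>n. duration s n * k (s n))"
begin

definition "weight n = duration s n * k (s n)"
definition "tail_weight n = (\<Sum>l. weight (n + l))"

lemma weight_nonneg': "0 \<le> weight n"
  using weight_nonneg[of n] duration_pos[of n] by (simp add: weight_def)

lemma summable_weight_shift: "summable (\<lambda>l. weight (n + l))"
  using summable_ignore_initial_segment[OF summable_weight, of n] by (simp add: weight_def add.commute)

lemma tail_weight_nonneg: "0 \<le> tail_weight n"
  unfolding tail_weight_def by (intro suminf_nonneg summable_weight_shift weight_nonneg')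

lemma G_nonneg: "0 \<le> G"
  using payoff_bound[of undefined undefined undefined] by (meson abs_ge_zero order_trans)

lemma summable_weight_mult:
  assumes "\<And>l. \<bar>f l\<bar> \<le> G"
  shows "summable (\<lambda>l. weight (n + l) * f l)"
  using assms weight_nonneg'
  by (intro summable_comparison_test'[OF summable_mult[OF summable_weight_shift[of n], of G], of 0])
     (auto simp: abs_mult mult.commute intro!: mult_right_mono)

lemma abs_suminf_weight_le:
  assumes "\<And>l. \<bar>f l\<bar> \<le> G"
  shows "\<bar>\<Sum>l. weight (n + l) * f l\<bar> \<le> G * tail_weight n"
proof -
  have "(\<Sum>l. weight (n + l) * f l) \<le> (\<Sum>l. weight (n + l) * G)"
    using assms weight_nonneg'
    by (intro suminf_le summable_weight_mult summable_mult2 summable_weight_shift) (auto simp: abs_le_iff intro!: mult_left_mono)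
  moreover have "(\<Sum>l. weight (n + l) * - G) \<le> (\<Sum>l. weight (n + l) * f l)"
  proof (intro suminf_le summable_weight_mult summable_mult2 summable_weight_shift assms)
    show "weight (n + l) * - G \<le> weight (n + l) * f l" for l
      using assms[of l] weight_nonneg' by (intro mult_left_mono) (auto simp: abs_le_iff)
  qed (simp add: G_nonneg)
  ultimately show ?thesis
    using suminf_mult2[OF summable_weight_shift[of n], of G] suminf_mult2[OF summable_weight_shift[of n], of "- G"]
    by (simp add: tail_weight_def abs_le_iff mult.commute)
qed

text \<open>The series is dominated by \<open>G\<close> times the summable weights and may be
  integrated term by term. From here on the arguments use this series of stage payoffs in place of
  the law of the play.\<close>

lemma expected_payoff_eq:
  assumes p: "p \<in> prob_simplex"
  shows "expected_payoff g q k s n p \<sigma> \<tau> = (\<Sum>l. weight (n + l) * stage_payoff g q s l n p \<sigma> \<tau>)"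
proof -
  let ?M = "play_law q s n p \<sigma> \<tau>"
  let ?f = "\<lambda>l x. case x l of (w, i, j) \<Rightarrow> g i j w"
  interpret prob_space ?M by (rule prob_space_play_law)
  have meas: "?f l \<in> borel_measurable ?M" for l
  proof -
    have "(\<lambda>y. case y of (w, i, j) \<Rightarrow> g i j w) \<circ> (\<lambda>x. x l) \<in> borel_measurable ?M"
      by (rule measurable_comp[of _ _ "count_space UNIV"])
         (auto simp: measurable_cong_sets[OF sets_play_law refl])
    then show ?thesis by (simp add: o_def)
  qed
  have b: "\<bar>?f l x\<bar> \<le> G" for l x
    by (auto split: prod.split intro: payoff_bound)
  have int: "integrable ?M (\<lambda>x. weight (n + l) * ?f l x)" for l
    by (intro integrable_mult_right integrable_const_bound[of _ G] AE_I2 meas) (simp add: b)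
  have norm_le: "norm (weight (n + l) * ?f l x) \<le> weight (n + l) * G" for l x
    using b[of x l] weight_nonneg'[of "n + l"] by (auto simp: abs_mult intro!: mult_left_mono)
  have "(\<integral>x. (\<Sum>l. weight (n + l) * ?f l x) \<partial>?M) = (\<Sum>l. (\<integral>x. weight (n + l) * ?f l x \<partial>?M))"
  proof (rule integral_suminf[OF int])
    show "AE x in ?M. summable (\<lambda>l. norm (weight (n + l) * ?f l x))"
      using norm_le by (intro AE_I2 summable_comparison_test'[OF summable_mult2[OF summable_weight_shift[of n], of G], of 0]) auto
    have "norm (\<integral>x. norm (weight (n + l) * ?f l x) \<partial>?M) \<le> weight (n + l) * G" for l
    proof -
      have "(\<integral>x. norm (weight (n + l) * ?f l x) \<partial>?M) \<le> (\<integral>x. weight (n + l) * G \<partial>?M)"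
        using int norm_le by (intro integral_mono) auto
      then show ?thesis by (simp add: prob_space)
    qed
    then show "summable (\<lambda>l. \<integral>x. norm (weight (n + l) * ?f l x) \<partial>?M)"
      by (intro summable_comparison_test'[OF summable_mult2[OF summable_weight_shift[of n], of G], of 0]) auto
  qed
  also have "\<dots> = (\<Sum>l. weight (n + l) * stage_payoff g q s l n p \<sigma> \<tau>)"
    using integral_stage[OF p] by simp
  finally show ?thesis
    by (simp add: expected_payoff_def weight_def)
qed

lemma abs_expected_payoff_le:
  "p \<in> prob_simplex \<Longrightarrow> \<bar>expected_payoff g q k s n p \<sigma> \<tau>\<bar> \<le> G * tail_weight n"
  by (simp add: expected_payoff_eq abs_suminf_weight_le abs_stage_payoff_le)

lemma expected_payoff_Suc:
  assumes p: "p \<in> prob_simplex"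
  shows "expected_payoff g q k s n p \<sigma> \<tau> =
    mixed_payoff (\<sigma> []) (\<tau> []) (\<lambda>i j. weight n * (\<Sum>w\<in>UNIV. p $ w * g i j w) +
      expected_payoff g q k s (Suc n) (p v* (mat 1 + duration s n *\<^sub>R q i j))
        (\<lambda>h. \<sigma> ((i, j) # h)) (\<lambda>h. \<tau> ((i, j) # h)))"
proof -
  let ?E = "\<lambda>i j l. stage_payoff g q s l (Suc n) (p v* (mat 1 + duration s n *\<^sub>R q i j))
        (\<lambda>h. \<sigma> ((i, j) # h)) (\<lambda>h. \<tau> ((i, j) # h))"
  have sums: "(\<lambda>l. weight (Suc n + l) * ?E i j l) sums expected_payoff g q k s (Suc n) (p v* (mat 1 + duration s n *\<^sub>R q i j))
        (\<lambda>h. \<sigma> ((i, j) # h)) (\<lambda>h. \<tau> ((i, j) # h))" for i j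
    unfolding expected_payoff_eq[OF belief_step[OF p]]
    by (intro summable_sums summable_weight_mult abs_stage_payoff_le belief_step p)
  have "(\<lambda>l. mixed_payoff (\<sigma> []) (\<tau> []) (\<lambda>i j. weight (Suc n + l) * ?E i j l)) sums
     mixed_payoff (\<sigma> []) (\<tau> []) (\<lambda>i j. expected_payoff g q k s (Suc n) (p v* (mat 1 + duration s n *\<^sub>R q i j))
        (\<lambda>h. \<sigma> ((i, j) # h)) (\<lambda>h. \<tau> ((i, j) # h)))"
    unfolding mixed_payoff_def by (intro sums_sum sums_mult sums)
  then have tail: "(\<lambda>l. weight (n + Suc l) * stage_payoff g q s (Suc l) n p \<sigma> \<tau>) sums
     mixed_payoff (\<sigma> []) (\<tau> []) (\<lambda>i j. expected_payoff g q k s (Suc n) (p v* (mat 1 + duration s n *\<^sub>R q i j))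
        (\<lambda>h. \<sigma> ((i, j) # h)) (\<lambda>h. \<tau> ((i, j) # h)))"
    by (simp add: mixed_payoff_cmult)
  have "(\<lambda>l. weight (n + l) * stage_payoff g q s l n p \<sigma> \<tau>) sums expected_payoff g q k s n p \<sigma> \<tau>"
    unfolding expected_payoff_eq[OF p]
    by (intro summable_sums summable_weight_mult abs_stage_payoff_le p)
  with sums_Suc[OF tail] have "expected_payoff g q k s n p \<sigma> \<tau> =
     mixed_payoff (\<sigma> []) (\<tau> []) (\<lambda>i j. expected_payoff g q k s (Suc n) (p v* (mat 1 + duration s n *\<^sub>R q i j))
        (\<lambda>h. \<sigma> ((i, j) # h)) (\<lambda>h. \<tau> ((i, j) # h))) + weight (n + 0) * stage_payoff g q s 0 n p \<sigma> \<tau>"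
    using sums_unique2 by blast
  then show ?thesis
    by (simp add: mixed_payoff_add mixed_payoff_cmult)
qed

lemma stage_value_upper:
  assumes "p \<in> prob_simplex" "e > 0"
  shows "\<exists>\<tau>. expected_payoff g q k s n p \<sigma> \<tau> \<le> stage_value g q k s n p + e"
  unfolding stage_value_def
  by (rule supinf_upper[where f = "expected_payoff g q k s n p", OF abs_expected_payoff_le[OF assms(1)] assms(2)])

lemma stage_value_lower:
  assumes "p \<in> prob_simplex" "e > 0"
  shows "\<exists>\<sigma>. \<forall>\<tau>. stage_value g q k s n p - e \<le> expected_payoff g q k s n p \<sigma> \<tau>"
  unfolding stage_value_def
  by (rule supinf_lower[where f = "expected_payoff g q k s n p", OF abs_expected_payoff_le[OF assms(1)] assms(2)])

lemma stage_value_leI: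
  assumes "p \<in> prob_simplex" "\<And>e \<sigma>. e > 0 \<Longrightarrow> \<exists>\<tau>. expected_payoff g q k s n p \<sigma> \<tau> \<le> c + e"
  shows "stage_value g q k s n p \<le> c"
  unfolding stage_value_def
  by (rule supinf_leI[where f = "expected_payoff g q k s n p", OF abs_expected_payoff_le[OF assms(1)] assms(2)])

lemma stage_value_geI:
  assumes "p \<in> prob_simplex" "\<And>e. e > 0 \<Longrightarrow> \<exists>\<sigma>. \<forall>\<tau>. c - e \<le> expected_payoff g q k s n p \<sigma> \<tau>"
  shows "c \<le> stage_value g q k s n p"
  unfolding stage_value_def
  by (rule supinf_geI[where f = "expected_payoff g q k s n p", OF abs_expected_payoff_le[OF assms(1)] assms(2)])

text \<open>Sup-inf composes over stages because player 2 replies to a known strategy at every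
  history. Upper bound: against \<sigma>, a reply to \<open>\<sigma> []\<close> is glued to one
  reply per action pair against the continuation of \<sigma>. Lower bound: a first mixed action is
  glued to one guaranteeing continuation per action pair. The first stage and the continuations each
  lose \<open>e / 2\<close>.\<close>

lemma stage_value_dynamic_programming:
  assumes p: "p \<in> prob_simplex"
  shows "stage_value g q k s n p = matrix_game_value (\<lambda>i j. weight n * (\<Sum>w\<in>UNIV. p $ w * g i j w) +
      stage_value g q k s (Suc n) (p v* (mat 1 + duration s n *\<^sub>R q i j)))"
proof -
  define P where "P i j = p v* (mat 1 + duration s n *\<^sub>R q i j)" for i j
  define r where "r i j = weight n * (\<Sum>w\<in>UNIV. p $ w * g i j w)" for i j
  define V where "V i j = stage_value g q k s (Suc n) (P i j)" for i j
  define a where "a i j = r i j + V i j" for i j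
  have P: "P i j \<in> prob_simplex" for i j
    unfolding P_def by (rule belief_step[OF p])
  have E: "expected_payoff g q k s n p \<sigma> \<tau> = mixed_payoff (\<sigma> []) (\<tau> []) (\<lambda>i j. r i j +
      expected_payoff g q k s (Suc n) (P i j) (\<lambda>h. \<sigma> ((i, j) # h)) (\<lambda>h. \<tau> ((i, j) # h)))" for \<sigma> \<tau>
    unfolding r_def P_def by (rule expected_payoff_Suc[OF p])
  have "stage_value g q k s n p \<le> matrix_game_value a"
  proof (rule stage_value_leI[OF p])
    fix e :: real and \<sigma> :: "('i, 'j, 'i) strategy" assume e: "e > 0"
    obtain y where y: "mixed_payoff (\<sigma> []) y a \<le> matrix_game_value a + e / 2"
      using matrix_game_value_upper[of "e / 2"] e by (auto simp: field_simps)
    define Q where "Q i j \<tau> \<longleftrightarrow> expected_payoff g q k s (Suc n) (P i j) (\<lambda>h. \<sigma> ((i, j) # h)) \<tau> \<le> V i j + e / 2" for i j \<tau>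
    have "\<exists>\<tau>. Q i j \<tau>" for i j
      unfolding Q_def V_def using e by (intro stage_value_upper P) simp
    then obtain \<tau> where \<tau>: "\<And>i j. Q i j (\<tau> i j)"
      by metis
    define \<tau>' where "\<tau>' = (\<lambda>h. case h of [] \<Rightarrow> y | ij # h \<Rightarrow> \<tau> (fst ij) (snd ij) h)"
    have "expected_payoff g q k s n p \<sigma> \<tau>' = mixed_payoff (\<sigma> []) y (\<lambda>i j. r i j +
        expected_payoff g q k s (Suc n) (P i j) (\<lambda>h. \<sigma> ((i, j) # h)) (\<tau> i j))"
      unfolding E by (simp add: \<tau>'_def)
    also have "\<dots> \<le> mixed_payoff (\<sigma> []) y (\<lambda>i j. a i j + e / 2)"
    proof (rule mixed_payoff_mono)
      show "r i j + expected_payoff g q k s (Suc n) (P i j) (\<lambda>h. \<sigma> ((i, j) # h)) (\<tau> i j) \<le> a i j + e / 2" for i j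
        using \<tau>[of i j] by (simp add: Q_def a_def)
    qed
    also have "\<dots> \<le> matrix_game_value a + e"
      using y by (simp add: mixed_payoff_add mixed_payoff_const)
    finally show "\<exists>\<tau>. expected_payoff g q k s n p \<sigma> \<tau> \<le> matrix_game_value a + e"
      by (rule exI[of _ \<tau>'])
  qed
  moreover have "matrix_game_value a \<le> stage_value g q k s n p"
  proof (rule stage_value_geI[OF p])
    fix e :: real assume e: "e > 0"
    obtain x where x: "\<And>y. matrix_game_value a - e / 2 \<le> mixed_payoff x y a"
      using matrix_game_value_lower[of "e / 2" a] e by auto
    define Q where "Q i j \<sigma> \<longleftrightarrow> (\<forall>\<tau>. V i j - e / 2 \<le> expected_payoff g q k s (Suc n) (P i j) \<sigma> \<tau>)" for i j \<sigma>
    have "\<exists>\<sigma>. Q i j \<sigma>" for i j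
      unfolding Q_def V_def using e by (intro stage_value_lower P) simp
    then obtain \<sigma> where \<sigma>: "\<And>i j. Q i j (\<sigma> i j)"
      by metis
    define \<sigma>' where "\<sigma>' = (\<lambda>h. case h of [] \<Rightarrow> x | ij # h \<Rightarrow> \<sigma> (fst ij) (snd ij) h)"
    have "matrix_game_value a - e \<le> expected_payoff g q k s n p \<sigma>' \<tau>" for \<tau>
    proof -
      have "matrix_game_value a - e \<le> mixed_payoff x (\<tau> []) (\<lambda>i j. a i j + - (e / 2))"
        using x[of "\<tau> []"] unfolding mixed_payoff_add mixed_payoff_const by simp
      also have "\<dots> \<le> mixed_payoff x (\<tau> []) (\<lambda>i j. r i j +
          expected_payoff g q k s (Suc n) (P i j) (\<sigma> i j) (\<lambda>h. \<tau> ((i, j) # h)))"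
      proof (rule mixed_payoff_mono)
        show "a i j + - (e / 2) \<le> r i j + expected_payoff g q k s (Suc n) (P i j) (\<sigma> i j) (\<lambda>h. \<tau> ((i, j) # h))" for i j
          using \<sigma>[of i j] by (simp add: Q_def a_def algebra_simps)
      qed
      also have "\<dots> = expected_payoff g q k s n p \<sigma>' \<tau>"
        unfolding E by (simp add: \<sigma>'_def)
      finally show ?thesis .
    qed
    then show "\<exists>\<sigma>. \<forall>\<tau>. matrix_game_value a - e \<le> expected_payoff g q k s n p \<sigma> \<tau>" by blast
  qed
  ultimately show ?thesis
    unfolding a_def r_def V_def P_def by (rule antisym)
qed

lemma abs_stage_value_le:
  assumes p: "p \<in> prob_simplex"
  shows "\<bar>stage_value g q k s n p\<bar> \<le> G * tail_weight n"
proof -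
  have b: "expected_payoff g q k s n p \<sigma> \<tau> \<le> G * tail_weight n"
    "- (G * tail_weight n) \<le> expected_payoff g q k s n p \<sigma> \<tau>" for \<sigma> \<tau>
    using abs_expected_payoff_le[OF p, of n \<sigma> \<tau>] by (auto simp: abs_le_iff)
  have "stage_value g q k s n p \<le> G * tail_weight n"
    using b(1) by (intro stage_value_leI[OF p]) (auto intro!: exI add_increasing2)
  moreover have "- (G * tail_weight n) \<le> stage_value g q k s n p"
    using b(2) by (intro stage_value_geI[OF p]) (auto intro!: exI order_trans[OF _ b(2)])
  ultimately show ?thesis by (simp add: abs_le_iff)
qed

text \<open>The same strategies can be played from both beliefs. Each stage payoff is linear in the
  belief and bounded by \<open>G\<close> at the vertices \<open>axis w 1\<close>, so it changes by
  at most \<open>G\<close> times the sum distance; summing the weights gives the factor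
  \<open>tail_weight n\<close>.\<close>

lemma stage_value_le_lipschitz:
  assumes p: "p \<in> prob_simplex" and p': "p' \<in> prob_simplex"
  shows "stage_value g q k s n p \<le> stage_value g q k s n p' + G * tail_weight n * (\<Sum>w\<in>UNIV. \<bar>p $ w - p' $ w\<bar>)"
    (is "_ \<le> _ + ?c")
proof -
  have le: "expected_payoff g q k s n p \<sigma> \<tau> \<le> expected_payoff g q k s n p' \<sigma> \<tau> + ?c" for \<sigma> \<tau>
  proof -
    let ?D = "\<Sum>w\<in>UNIV. \<bar>p $ w - p' $ w\<bar>"
    let ?S = "\<lambda>l p. stage_payoff g q s l n p \<sigma> \<tau>"
    have diff: "?S l p - ?S l p' \<le> G * ?D" for l
    proof -
      have axis: "axis w 1 \<in> prob_simplex" for w :: 'w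
        by (auto simp: prob_simplex_def axis_def)
      have "?S l p - ?S l p' = ?S l (p - p')"
        using linear_diff[OF linear_stage_payoff] by metis
      also have "\<dots> = ?S l (\<Sum>w\<in>UNIV. (p - p') $ w *\<^sub>R axis w 1)"
        by (simp only: basis_expansion flip: scalar_mult_eq_scaleR)
      also have "\<dots> = (\<Sum>w\<in>UNIV. (p - p') $ w * ?S l (axis w 1))"
        by (simp only: linear_sum[OF linear_stage_payoff] linear_scale[OF linear_stage_payoff] real_scaleR_def)
      also have "\<dots> \<le> (\<Sum>w\<in>UNIV. \<bar>p $ w - p' $ w\<bar> * G)"
      proof (rule sum_mono)
        fix w
        have "(p - p') $ w * ?S l (axis w 1) \<le> \<bar>p $ w - p' $ w\<bar> * \<bar>?S l (axis w 1)\<bar>"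
          by (metis abs_ge_self abs_mult vector_minus_component)
        also have "\<dots> \<le> \<bar>p $ w - p' $ w\<bar> * G"
          by (intro mult_left_mono abs_stage_payoff_le axis) auto
        finally show "(p - p') $ w * ?S l (axis w 1) \<le> \<bar>p $ w - p' $ w\<bar> * G" .
      qed
      finally show ?thesis by (simp add: sum_distrib_left mult.commute)
    qed
    have sm: "summable (\<lambda>l. weight (n + l) * ?S l p')" "summable (\<lambda>l. weight (n + l) * (G * ?D))"
      by (intro summable_weight_mult abs_stage_payoff_le p') (intro summable_mult2 summable_weight_shift)
    have "expected_payoff g q k s n p \<sigma> \<tau> \<le> (\<Sum>l. weight (n + l) * ?S l p' + weight (n + l) * (G * ?D))"
      unfolding expected_payoff_eq[OF p]
      by (intro suminf_le summable_add sm summable_weight_mult abs_stage_payoff_le p)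
         (use diff weight_nonneg' in \<open>auto simp flip: distrib_left intro!: mult_left_mono simp: diff_le_eq add.commute\<close>)
    also have "\<dots> = expected_payoff g q k s n p' \<sigma> \<tau> + tail_weight n * (G * ?D)"
      unfolding suminf_add[OF sm, symmetric] expected_payoff_eq[OF p'] tail_weight_def
      by (simp add: suminf_mult2[OF summable_weight_shift])
    finally show ?thesis by (simp add: mult_ac)
  qed
  show ?thesis
  proof (rule stage_value_leI[OF p])
    fix e :: real and \<sigma> assume "e > 0"
    from stage_value_upper[OF p' this, of n \<sigma>]
    obtain \<tau> where "expected_payoff g q k s n p' \<sigma> \<tau> \<le> stage_value g q k s n p' + e" ..
    then show "\<exists>\<tau>. expected_payoff g q k s n p \<sigma> \<tau> \<le> stage_value g q k s n p' + ?c + e"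
      using le[of \<sigma> \<tau>] by (intro exI[of _ \<tau>]) simp
  qed
qed

end

section \<open>Weights of fine partitions\<close>

locale continuous_game =
  fixes T :: ereal and k :: "real \<Rightarrow> real"
    and g :: "'i::finite \<Rightarrow> 'j::finite \<Rightarrow> 'w::finite \<Rightarrow> real"
    and q :: "'i \<Rightarrow> 'j \<Rightarrow> real ^ 'w ^ 'w"
  assumes kernel: "kernel_matrix (q i j)"
    and T_pos: "0 < T"
    and k_continuous: "continuous_on {t. 0 \<le> t \<and> ereal t \<le> T} k"
    and k_antimono: "antimono_on {t. 0 \<le> t \<and> ereal t \<le> T} k"
    and k_nonneg: "0 \<le> t \<Longrightarrow> ereal t \<le> T \<Longrightarrow> 0 \<le> k t"
    and k_integral: "(k has_integral 1) {t. 0 \<le> t \<and> ereal t \<le> T}"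
begin

definition "payoff_const = (\<Sum>i\<in>UNIV. \<Sum>j\<in>UNIV. \<Sum>w\<in>UNIV. \<bar>g i j w\<bar>)"
definition "kernel_const = (\<Sum>i\<in>UNIV. \<Sum>j\<in>UNIV. \<Sum>w\<in>UNIV. norm (q i j $ w))"

lemma sum_le_triple_sum:
  fixes f :: "'i \<Rightarrow> 'j \<Rightarrow> 'w \<Rightarrow> real"
  assumes "\<And>i j w. 0 \<le> f i j w"
  shows "(\<Sum>w\<in>UNIV. f i j w) \<le> (\<Sum>i\<in>UNIV. \<Sum>j\<in>UNIV. \<Sum>w\<in>UNIV. f i j w)"
proof -
  have "(\<Sum>w\<in>UNIV. f i j w) \<le> (\<Sum>j\<in>UNIV. \<Sum>w\<in>UNIV. f i j w)"
    using assms by (intro member_le_sum[of j UNIV "\<lambda>j. \<Sum>w\<in>UNIV. f i j w"]) (simp_all add: sum_nonneg)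
  also have "\<dots> \<le> (\<Sum>i\<in>UNIV. \<Sum>j\<in>UNIV. \<Sum>w\<in>UNIV. f i j w)"
    using assms by (intro member_le_sum[of i UNIV "\<lambda>i. \<Sum>j\<in>UNIV. \<Sum>w\<in>UNIV. f i j w"]) (simp_all add: sum_nonneg)
  finally show ?thesis .
qed

lemma payoff_const_nonneg: "0 \<le> payoff_const"
  unfolding payoff_const_def by (intro sum_nonneg) auto

lemma kernel_const_nonneg: "0 \<le> kernel_const"
  unfolding kernel_const_def by (intro sum_nonneg) auto

lemma abs_payoff_le: "\<bar>g i j w\<bar> \<le> payoff_const"
proof -
  have "\<bar>g i j w\<bar> \<le> (\<Sum>w\<in>UNIV. \<bar>g i j w\<bar>)"
    by (rule member_le_sum[of w UNIV "\<lambda>w. \<bar>g i j w\<bar>"]) auto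
  then show ?thesis
    using sum_le_triple_sum[of "\<lambda>i j w. \<bar>g i j w\<bar>" i j] by (simp add: payoff_const_def)
qed

lemma abs_average_payoff_le: "\<bar>\<Sum>w\<in>UNIV. p $ w * g i j w\<bar> \<le> payoff_const * norm p"
proof -
  have "\<bar>\<Sum>w\<in>UNIV. p $ w * g i j w\<bar> \<le> (\<Sum>w\<in>UNIV. \<bar>g i j w\<bar> * norm p)"
    by (intro order_trans[OF sum_abs] sum_mono)
       (auto simp: abs_mult mult.commute intro!: mult_right_mono component_le_norm_cart)
  also have "\<dots> \<le> payoff_const * norm p"
    using sum_le_triple_sum[of "\<lambda>i j w. \<bar>g i j w\<bar>" i j]
    by (auto simp: payoff_const_def simp flip: sum_distrib_right intro!: mult_right_mono)
  finally show ?thesis .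
qed

lemma norm_drift_le: "norm (p v* q i j) \<le> kernel_const * norm p"
proof -
  have "norm (p v* q i j) \<le> (\<Sum>w\<in>UNIV. norm (q i j $ w) * norm p)"
    unfolding vector_matrix_mult_rows
    by (intro order_trans[OF norm_sum] sum_mono)
       (auto simp: mult.commute intro!: mult_right_mono component_le_norm_cart)
  also have "\<dots> \<le> kernel_const * norm p"
    using sum_le_triple_sum[of "\<lambda>i j w. norm (q i j $ w)" i j]
    by (auto simp: kernel_const_def simp flip: sum_distrib_right intro!: mult_right_mono)
  finally show ?thesis .
qed

lemma norm_simplex_le_1: "(p :: real ^ 'w) \<in> prob_simplex \<Longrightarrow> norm p \<le> 1"
  using norm_le_l1_cart[of p] by (simp add: prob_simplex_def)

lemma norm_drift_simplex_le: "p \<in> prob_simplex \<Longrightarrow> norm (p v* q i j) \<le> kernel_const"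
  using norm_drift_le[of p i j] mult_left_mono[OF norm_simplex_le_1[of p] kernel_const_nonneg] by simp

lemma k_antimonoD: "0 \<le> t \<Longrightarrow> t \<le> t' \<Longrightarrow> ereal t' \<le> T \<Longrightarrow> k t' \<le> k t"
proof -
  assume *: "0 \<le> t" "t \<le> t'" "ereal t' \<le> T"
  then have "ereal t \<le> T" by (meson ereal_less_eq(3) order_trans)
  with * show ?thesis using k_antimono by (auto simp: monotone_on_def)
qed

lemma k_le_k0: "0 \<le> t \<Longrightarrow> ereal t \<le> T \<Longrightarrow> k t \<le> k 0"
  by (rule k_antimonoD) auto

lemma k0_nonneg: "0 \<le> k 0"
  using k_nonneg[of 0] T_pos by (simp add: zero_ereal_def)

lemma interval_subset: "0 \<le> a \<Longrightarrow> ereal b \<le> T \<Longrightarrow> {a..b} \<subseteq> {t. 0 \<le> t \<and> ereal t \<le> T}"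
  by (auto intro: order_trans[of "ereal _" "ereal b"])

lemma k_integrable_on: "0 \<le> a \<Longrightarrow> ereal b \<le> T \<Longrightarrow> k integrable_on {a..b}"
  by (intro integrable_continuous_real continuous_on_subset[OF k_continuous] interval_subset)

lemma integral_k_le_1: "0 \<le> a \<Longrightarrow> ereal b \<le> T \<Longrightarrow> integral {a..b} k \<le> 1"
proof -
  assume *: "0 \<le> a" "ereal b \<le> T"
  have "integral {a..b} k \<le> integral {t. 0 \<le> t \<and> ereal t \<le> T} k"
    using * k_integral by (intro integral_subset_le interval_subset k_integrable_on) (auto intro: k_nonneg)
  then show ?thesis using k_integral by (simp add: integral_unique)
qed

lemma integral_k_tail:
  assumes "e > 0"
  obtains T1 where "0 \<le> T1" "ereal T1 < T" "\<And>b. T1 \<le> b \<Longrightarrow> ereal b < T \<Longrightarrow> integral {T1..b} k \<le> e"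
proof (cases T)
  case (real r)
  with T_pos have r: "r > 0" by simp
  \<comment> \<open>Since \<open>k\<close> is at most \<open>k 0\<close>, a final stretch of length
    \<open>e / (k 0 + 1)\<close> carries an integral of at most \<open>e\<close>; the
    \<open>+ 1\<close> keeps the denominator positive.\<close>
  define T1 where "T1 = max 0 (r - e / (k 0 + 1))"
  have d: "e / (k 0 + 1) > 0" using assms k0_nonneg by (intro divide_pos_pos) auto
  have T1: "0 \<le> T1" "T1 < r" "r - e / (k 0 + 1) \<le> T1"
    using r d by (auto simp: T1_def)
  have "integral {T1..b} k \<le> e" if b: "T1 \<le> b" "ereal b < T" for b
  proof -
    have b': "b < r" using b(2) by (simp add: real)
    have "integral {T1..b} k \<le> integral {T1..b} (\<lambda>_. k 0)"
    proof (rule integral_le)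
      show "k integrable_on {T1..b}" using T1(1) b(2) by (intro k_integrable_on) auto
      show "k x \<le> k 0" if "x \<in> {T1..b}" for x
        using that T1(1) b' by (intro k_le_k0) (auto simp: real)
    qed (rule integrable_const_ivl)
    also have "\<dots> = k 0 * (b - T1)" using b by (simp add: mult.commute)
    also have "\<dots> \<le> k 0 * (e / (k 0 + 1))"
    proof (rule mult_left_mono)
      show "b - T1 \<le> e / (k 0 + 1)" using b' T1(3) by linarith
    qed (rule k0_nonneg)
    also have "\<dots> \<le> e"
      using k0_nonneg assms by (simp add: divide_le_eq)
    finally show ?thesis .
  qed
  then show ?thesis
    using that[of T1] T1 by (simp add: real)
next
  case PInf
  \<comment> \<open>On the half-line the gauge definition of the integral supplies a
    \<open>B\<close> such that \<open>[0, B]\<close> already carries more than \<open>1 - e\<close>,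
    while no integral of \<open>k\<close> exceeds 1.\<close>
  obtain B where B: "B > 0" "\<And>a b. ball 0 B \<subseteq> cbox a b \<Longrightarrow>
      (\<exists>z. ((\<lambda>x. if x \<in> {t. 0 \<le> t \<and> ereal t \<le> T} then k x else 0) has_integral z) (cbox a b) \<and> norm (z - 1) < e)"
    using k_integral assms unfolding has_integral'[of k] by blast
  have int: "integral {0..B} k > 1 - e"
  proof -
    have "ball 0 B \<subseteq> cbox (-B) B" by (auto simp: dist_real_def)
    from B(2)[OF this] obtain z where z: "((\<lambda>x. if x \<in> {t. 0 \<le> t \<and> ereal t \<le> T} then k x else 0) has_integral z) (cbox (-B) B)" "norm (z - 1) < e"
      by blast
    have "((\<lambda>x. if x \<in> {0..} then k x else 0) has_integral z) {-B..B}"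
      using z(1) by (simp add: PInf)
    then have "(k has_integral z) ({0..} \<inter> {-B..B})"
      by (simp only: has_integral_restrict_Int)
    also have "{0..} \<inter> {-B..B} = {0..B}" using B(1) by auto
    finally show ?thesis using z(2) by (auto simp: integral_unique abs_less_iff)
  qed
  have "integral {B..b} k \<le> e" if "B \<le> b" for b
  proof -
    have "integral {0..B} k + integral {B..b} k = integral {0..b} k"
      using that B(1) by (intro Henstock_Kurzweil_Integration.integral_combine k_integrable_on) (auto simp: PInf)
    then show ?thesis using integral_k_le_1[of 0 b] int by (simp add: PInf)
  qed
  then show ?thesis using that[of B] B(1) by (simp add: PInf)
qed (use T_pos in auto)

end

locale fine_partition = continuous_game T k g q
  for T :: ereal and k :: "real \<Rightarrow> real"
    and g :: "'i::finite \<Rightarrow> 'j::finite \<Rightarrow> 'w::finite \<Rightarrow> real"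
    and q :: "'i \<Rightarrow> 'j \<Rightarrow> real ^ 'w ^ 'w" +
  fixes s :: "nat \<Rightarrow> real" and \<delta> :: real
  assumes partition: "partition_of T s" and mesh_less: "mesh s < ereal \<delta>" and \<delta>_le_1: "\<delta> \<le> 1"
begin

lemma s_0: "s 0 = 0" and s_strict_mono: "strict_mono s"
  using partition by (auto simp: partition_of_def)

lemma s_nonneg: "0 \<le> s n"
  using strict_mono_less_eq[OF s_strict_mono, of 0 n] by (simp add: s_0)

lemma s_less_T: "ereal (s n) < T"
proof -
  have "ereal (s (Suc n)) \<le> T"
  proof (rule LIMSEQ_le_const)
    show "(\<lambda>n. ereal (s n)) \<longlonglongrightarrow> T" using partition by (simp add: partition_of_def)
    show "\<exists>N. \<forall>m\<ge>N. ereal (s (Suc n)) \<le> ereal (s m)"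
      by (rule exI[of _ "Suc n"]) (simp add: strict_mono_less_eq[OF s_strict_mono])
  qed
  moreover have "s n < s (Suc n)" using s_strict_mono by (simp add: strict_mono_def)
  ultimately show ?thesis by (meson less_ereal.simps(1) less_le_trans)
qed

lemma duration_positive: "0 < duration s n"
  using s_strict_mono by (simp add: duration_def strict_mono_def)

lemma duration_less: "duration s n < \<delta>"
proof -
  have "ereal (duration s n) \<le> mesh s"
    unfolding mesh_def by (rule SUP_upper) simp
  then show ?thesis using mesh_less by (metis le_less_trans less_ereal.simps(1))
qed

lemma \<delta>_pos: "0 < \<delta>"
  using duration_positive[of 0] duration_less[of 0] by linarith

lemma s_Suc: "s (Suc n) = s n + duration s n"
  by (simp add: duration_def)

lemma k_s_nonneg: "0 \<le> k (s n)"
  using k_nonneg s_nonneg s_less_T by (meson less_imp_le)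

text \<open>Write \<open>h\<^sub>m k(s\<^sub>m) = h\<^sub>m k(s\<^sub>m\<^sub>+\<^sub>1) + h\<^sub>m (k(s\<^sub>m) - k(s\<^sub>m\<^sub>+\<^sub>1))\<close>: the first term is below the integral,
  the second one is at most \<open>\<delta> (k(s\<^sub>m) - k(s\<^sub>m\<^sub>+\<^sub>1))\<close> since \<open>k\<close> is nonincreasing, and this telescopes.\<close>

lemma weight_sum_le:
  "(\<Sum>m<N. duration s (n + m) * k (s (n + m))) \<le> integral {s n..s (n + N)} k + \<delta> * (k (s n) - k (s (n + N)))"
proof (induction N)
  case (Suc N)
  let ?m = "n + N"
  have le: "s n \<le> s ?m" "s ?m \<le> s (Suc ?m)"
    by (auto simp: strict_mono_less_eq[OF s_strict_mono])
  have anti: "k (s (Suc ?m)) \<le> k (s ?m)"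
    using s_nonneg le s_less_T by (intro k_antimonoD) (auto intro: less_imp_le)
  have "integral {s ?m..s (Suc ?m)} (\<lambda>_. k (s (Suc ?m))) \<le> integral {s ?m..s (Suc ?m)} k"
  proof (rule integral_le)
    show "k integrable_on {s ?m..s (Suc ?m)}"
      using s_nonneg[of ?m] s_less_T[of "Suc ?m"] by (intro k_integrable_on) auto
    show "k (s (Suc ?m)) \<le> k x" if "x \<in> {s ?m..s (Suc ?m)}" for x
      using that s_nonneg[of ?m] s_less_T[of "Suc ?m"] by (intro k_antimonoD) auto
  qed (rule integrable_const_ivl)
  then have "duration s ?m * k (s (Suc ?m)) \<le> integral {s ?m..s (Suc ?m)} k"
    using le by (simp add: duration_def mult.commute)
  moreover have "duration s ?m * (k (s ?m) - k (s (Suc ?m))) \<le> \<delta> * (k (s ?m) - k (s (Suc ?m)))"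
    using anti duration_less[of ?m] by (intro mult_right_mono) auto
  moreover have "integral {s n..s ?m} k + integral {s ?m..s (Suc ?m)} k = integral {s n..s (Suc ?m)} k"
    using le s_nonneg s_less_T by (intro Henstock_Kurzweil_Integration.integral_combine k_integrable_on) (auto intro: less_imp_le)
  ultimately show ?case
    using Suc.IH by (simp add: algebra_simps)
qed simp

lemma weight_sum_le_const:
  assumes "\<And>N. integral {s n..s (n + N)} k \<le> c"
  shows "(\<Sum>m<N. duration s (n + m) * k (s (n + m))) \<le> c + \<delta> * k 0"
proof -
  have "k (s n) - k (s (n + N)) \<le> k 0"
    using k_le_k0[OF s_nonneg less_imp_le[OF s_less_T], of n] k_s_nonneg[of "n + N"] by linarith
  then have "\<delta> * (k (s n) - k (s (n + N))) \<le> \<delta> * k 0"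
    using \<delta>_pos by (intro mult_left_mono) auto
  then show ?thesis
    using weight_sum_le[of n N] assms[of N] by linarith
qed

sublocale weighted_game g q s payoff_const k
proof
  show "summable (\<lambda>n. duration s n * k (s n))"
  proof (rule summableI_nonneg_bounded)
    show "(\<Sum>m<N. duration s m * k (s m)) \<le> 1 + \<delta> * k 0" for N
      using weight_sum_le_const[of 0 1 N] integral_k_le_1[OF s_nonneg less_imp_le[OF s_less_T]] by simp
  qed (simp add: duration_positive k_s_nonneg less_imp_le)
  show "duration s n \<le> 1" for n
    using duration_less[of n] \<delta>_le_1 by linarith
qed (auto simp: kernel duration_positive k_s_nonneg abs_payoff_le)

lemma tail_weight_le:
  assumes "\<And>N. integral {s n..s (n + N)} k \<le> c"
  shows "tail_weight n \<le> c + \<delta> * k 0"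
  unfolding tail_weight_def
  using weight_sum_le_const[OF assms] by (intro suminf_le_const summable_weight_shift) (simp add: weight_def)

end

section \<open>Doubling of variables\<close>

definition ham ::
  "(('i \<Rightarrow> 'j \<Rightarrow> real) \<Rightarrow> real) \<Rightarrow> ('i \<Rightarrow> 'j \<Rightarrow> 'w::finite \<Rightarrow> real) \<Rightarrow> ('i \<Rightarrow> 'j \<Rightarrow> real ^ 'w ^ 'w) \<Rightarrow>
   (real \<Rightarrow> real) \<Rightarrow> real \<Rightarrow> real ^ 'w \<Rightarrow> real ^ 'w \<Rightarrow> real" where
  "ham F g q k t p \<xi> = F (\<lambda>i j. k t * (\<Sum>w\<in>UNIV. p $ w * g i j w) + (p v* q i j) \<bullet> \<xi>)"

text \<open>A test function \<psi> from below for \<open>w\<close> becomes \<open>- \<psi>\<close>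
  from above for \<open>- w\<close>, with the opposite gradient. This identity turns the
  supersolution inequality of the one into the subsolution inequality of the other.\<close>

lemma ham_dual:
  "ham (dual_operator F) (\<lambda>i j w. - g i j w) q k t p \<xi> = - ham F g q k t p (- \<xi>)"
  by (simp add: ham_def dual_operator_def sum_negf)

text \<open>The coupling term of the doubled variables as a function of one half
  \<open>(t, p)\<close>, the other half \<open>(b, a)\<close> being frozen. The tilt
  \<open>- \<eta> * t\<close> supplies the strictness of the comparison.\<close>

definition penalty :: "real \<Rightarrow> real \<Rightarrow> 'a::euclidean_space \<Rightarrow> real \<Rightarrow> real \<Rightarrow> 'a \<Rightarrow> real" where
  "penalty \<epsilon> \<eta> a b t p = (norm (p - a))\<^sup>2 / (2 * \<epsilon>) + (t - b)\<^sup>2 / (2 * \<epsilon>) - \<eta> * t"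

text \<open>The subsolution inequality up to \<gamma>, tested with penalties of fixed \<epsilon>,
  \<eta> and at global maxima. Doubling asks for no more, and in this form it makes sense on a grid
  as well as on an interval. \<open>(t - b) / \<epsilon> - \<eta>\<close> and
  \<open>(p - a) / \<epsilon>\<close> are the derivatives of the penalty.\<close>

definition approx_sub ::
  "(real \<Rightarrow> real ^ 'w \<Rightarrow> real ^ 'w \<Rightarrow> real) \<Rightarrow> real set \<Rightarrow> real \<Rightarrow> real \<Rightarrow> real \<Rightarrow> real \<Rightarrow>
   (real \<times> (real ^ 'w::finite) \<Rightarrow> real) \<Rightarrow> bool" where
  "approx_sub H S t0 \<epsilon> \<eta> \<gamma> u \<longleftrightarrow>
     (\<forall>t\<in>S. \<forall>p\<in>prob_simplex. \<forall>b a. t \<le> t0 \<longrightarrow>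
        (\<forall>t'\<in>S. \<forall>p'\<in>prob_simplex.
           u (t', p') - penalty \<epsilon> \<eta> a b t' p' \<le> u (t, p) - penalty \<epsilon> \<eta> a b t p) \<longrightarrow>
        0 \<le> (t - b) / \<epsilon> - \<eta> + H t p ((1 / \<epsilon>) *\<^sub>R (p - a)) + \<gamma>)"

lemma approx_subD:
  assumes "approx_sub H S t0 \<epsilon> \<eta> \<gamma> u" "t \<in> S" "p \<in> prob_simplex" "t \<le> t0"
    "\<And>t' p'. t' \<in> S \<Longrightarrow> p' \<in> prob_simplex \<Longrightarrow>
       u (t', p') - penalty \<epsilon> \<eta> a b t' p' \<le> u (t, p) - penalty \<epsilon> \<eta> a b t p"
  shows "0 \<le> (t - b) / \<epsilon> - \<eta> + H t p ((1 / \<epsilon>) *\<^sub>R (p - a)) + \<gamma>"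
  using assms unfolding approx_sub_def by blast

text \<open>The discrete counterpart of inserting a test function into the equation:
  \<open>V0 + h * (A + e)\<close> leaves \<open>F\<close> by translation, \<open>h\<close> by
  homogeneity; then \<open>V0\<close> cancels and \<open>h\<close> is divided out.\<close>

lemma one_step_inequality:
  assumes F: "value_operator F" and h: "0 < h"
    and V0: "V0 = F (\<lambda>i j. h * c i j + V1 i j)"
    and V1: "\<And>i j. V1 i j \<le> V0 + h * (A + d i j + e)"
  shows "0 \<le> A + F (\<lambda>i j. c i j + d i j) + e"
proof -
  have "F (\<lambda>i j. h * c i j + V1 i j) \<le> F (\<lambda>i j. h * (c i j + d i j)) + (V0 + h * (A + e))"
  proof (rule value_operator_le_add[OF F])
    show "h * c i j + V1 i j \<le> h * (c i j + d i j) + (V0 + h * (A + e))" for i j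
      using V1[of i j] by (simp add: algebra_simps)
  qed
  then have "V0 \<le> h * F (\<lambda>i j. c i j + d i j) + (V0 + h * (A + e))"
    unfolding value_operator_cmult[OF F h] by (simp only: V0[symmetric])
  then have "0 \<le> h * (A + F (\<lambda>i j. c i j + d i j) + e)"
    by (simp add: algebra_simps)
  then show ?thesis
    using h by (simp add: zero_le_mult_iff)
qed

text \<open>The penalty is quadratic, so its expansion along a step is exact. The last summand is
  the consistency error, which \<gamma> has to absorb.\<close>

lemma penalty_step:
  assumes "\<epsilon> > 0"
  shows "penalty \<epsilon> \<eta> a b (t + h) (p + h *\<^sub>R d) - penalty \<epsilon> \<eta> a b t p =
    h * ((t - b) / \<epsilon> - \<eta> + d \<bullet> ((1 / \<epsilon>) *\<^sub>R (p - a)) + h * ((norm d)\<^sup>2 + 1) / (2 * \<epsilon>))"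
proof -
  define X where "X = d \<bullet> (p - a)"
  have "p + h *\<^sub>R d - a = (p - a) + h *\<^sub>R d" by simp
  then have N: "(norm (p + h *\<^sub>R d - a))\<^sup>2 = (norm (p - a))\<^sup>2 + 2 * h * X + h\<^sup>2 * (norm d)\<^sup>2"
    unfolding X_def
    by (simp only: power2_norm_eq_inner inner_add_left inner_add_right)
       (simp add: inner_commute algebra_simps power2_eq_square)
  have X: "d \<bullet> ((1 / \<epsilon>) *\<^sub>R (p - a)) = X / \<epsilon>"
    by (simp add: X_def)
  show ?thesis
    unfolding penalty_def N X using assms by (simp add: field_simps power2_eq_square)
qed

section \<open>Dynamic programming gives approximate subsolutions\<close>

context fine_partition
begin

lemma belief_step': "p \<in> prob_simplex \<Longrightarrow> p + duration s n *\<^sub>R (p v* q i j) \<in> prob_simplex"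
  using belief_step by (simp add: vector_matrix_mult_step)

text \<open>At a maximum over the grid the successors \<open>(s (Suc n), p + h p q)\<close> of all
  action pairs are admissible competitors. Their increments of \<open>u\<close> are therefore at
  most those of the penalty, which is what \<open>one_step_inequality\<close> consumes.\<close>

lemma scheme_approx_sub:
  assumes F: "value_operator F"
    and dp: "\<And>n p. p \<in> prob_simplex \<Longrightarrow> u (s n, p) = F (\<lambda>i j. duration s n * (k (s n) * (\<Sum>w\<in>UNIV. p $ w * f i j w)) +
        u (s (Suc n), p + duration s n *\<^sub>R (p v* q i j)))"
    and S: "S = range s \<inter> {..t1}" and t1: "t0 + \<delta> \<le> t1" and \<epsilon>: "0 < \<epsilon>"
    and \<gamma>: "\<delta> * (kernel_const\<^sup>2 + 1) / (2 * \<epsilon>) \<le> \<gamma>"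
  shows "approx_sub (ham F f q k) S t0 \<epsilon> \<eta> \<gamma> u"
  unfolding approx_sub_def ham_def
proof (intro ballI allI impI)
  fix t b and p a :: "real ^ 'w"
  assume t: "t \<in> S" and p: "p \<in> prob_simplex" and t0: "t \<le> t0"
    and max: "\<forall>t'\<in>S. \<forall>p'\<in>prob_simplex.
           u (t', p') - penalty \<epsilon> \<eta> a b t' p' \<le> u (t, p) - penalty \<epsilon> \<eta> a b t p"
  obtain n where n: "t = s n" using t S by auto
  let ?h = "duration s n" and ?d = "\<lambda>i j. p v* q i j"
  have "s (Suc n) \<le> t1"
    using t0 t1 duration_less[of n] by (simp add: n s_Suc)
  then have Suc: "s (Suc n) \<in> S" by (simp add: S)
  show "0 \<le> (t - b) / \<epsilon> - \<eta> + F (\<lambda>i j. k t * (\<Sum>w\<in>UNIV. p $ w * f i j w) + ?d i j \<bullet> ((1 / \<epsilon>) *\<^sub>R (p - a))) + \<gamma>"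
    unfolding n
  proof (rule one_step_inequality[OF F duration_pos dp[OF p]])
    fix i j
    have "u (s (Suc n), p + ?h *\<^sub>R ?d i j) - u (s n, p) \<le>
        penalty \<epsilon> \<eta> a b (s (Suc n)) (p + ?h *\<^sub>R ?d i j) - penalty \<epsilon> \<eta> a b (s n) p"
      using max[rule_format, OF Suc belief_step'[OF p], of n i j] by (simp add: n)
    also have "\<dots> = ?h * ((s n - b) / \<epsilon> - \<eta> + ?d i j \<bullet> ((1 / \<epsilon>) *\<^sub>R (p - a)) + ?h * ((norm (?d i j))\<^sup>2 + 1) / (2 * \<epsilon>))"
      unfolding s_Suc by (rule penalty_step[OF \<epsilon>])
    also have "\<dots> \<le> ?h * ((s n - b) / \<epsilon> - \<eta> + ?d i j \<bullet> ((1 / \<epsilon>) *\<^sub>R (p - a)) + \<gamma>)"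
    proof (intro mult_left_mono add_left_mono)
      have "?h * ((norm (?d i j))\<^sup>2 + 1) / (2 * \<epsilon>) \<le> \<delta> * (kernel_const\<^sup>2 + 1) / (2 * \<epsilon>)"
        using \<epsilon> duration_less[of n] duration_pos[of n] norm_drift_simplex_le[OF p, of i j]
        by (intro divide_right_mono mult_mono add_mono power_mono) auto
      then show "?h * ((norm (?d i j))\<^sup>2 + 1) / (2 * \<epsilon>) \<le> \<gamma>"
        using \<gamma> by linarith
    qed (use duration_pos[of n] in simp)
    finally show "u (s (Suc n), p + ?h *\<^sub>R ?d i j) \<le>
        u (s n, p) + ?h * ((s n - b) / \<epsilon> - \<eta> + ?d i j \<bullet> ((1 / \<epsilon>) *\<^sub>R (p - a)) + \<gamma>)"
      by simp
  qed
qed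

end

section \<open>Comparison at a maximum of the doubled function\<close>

context continuous_game
begin

text \<open>The three errors stem from the weight at different times, from the payoff at different
  beliefs and from the drift at different beliefs. The last one grows with the gradient \<xi>, so
  its use requires a bound on \<xi>.\<close>

lemma ham_diff_le:
  assumes F: "value_operator F" and p: "p \<in> prob_simplex" "p' \<in> prob_simplex"
    and t': "0 \<le> t'" "ereal t' \<le> T"
  shows "ham F g q k t p \<xi> \<le> ham F g q k t' p' \<xi> +
    (\<bar>k t - k t'\<bar> * payoff_const + k 0 * payoff_const * norm (p - p') + kernel_const * norm (p - p') * norm \<xi>)"
  unfolding ham_def
proof (rule value_operator_le_add[OF F])
  fix i j
  let ?r = "\<lambda>p. \<Sum>w\<in>UNIV. p $ w * g i j w"
  have r: "?r (p - p') = ?r p - ?r p'"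
    by (simp add: algebra_simps sum_subtractf)
  have d: "(p - p') v* q i j = p v* q i j - p' v* q i j"
    by (rule linear_diff[OF linear_vector_matrix_mult])
  have "(k t - k t') * ?r p \<le> \<bar>k t - k t'\<bar> * payoff_const"
  proof -
    have "\<bar>?r p\<bar> \<le> payoff_const"
      using abs_average_payoff_le[of p i j] mult_left_mono[OF norm_simplex_le_1[OF p(1)] payoff_const_nonneg] by simp
    then have "\<bar>k t - k t'\<bar> * \<bar>?r p\<bar> \<le> \<bar>k t - k t'\<bar> * payoff_const"
      by (intro mult_left_mono) auto
    then show ?thesis
      using abs_ge_self[of "(k t - k t') * ?r p"] unfolding abs_mult by linarith
  qed
  moreover have "k t' * (?r p - ?r p') \<le> k 0 * payoff_const * norm (p - p')"
  proof -
    have "k t' * (?r p - ?r p') \<le> k t' * (payoff_const * norm (p - p'))"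
      using abs_average_payoff_le[of "p - p'" i j] k_nonneg[OF t'] unfolding r by (intro mult_left_mono) linarith+
    also have "\<dots> \<le> k 0 * (payoff_const * norm (p - p'))"
      using k_le_k0[OF t'] payoff_const_nonneg by (intro mult_right_mono) auto
    finally show ?thesis by (simp only: mult.assoc)
  qed
  moreover have "(p v* q i j) \<bullet> \<xi> - (p' v* q i j) \<bullet> \<xi> \<le> kernel_const * norm (p - p') * norm \<xi>"
    unfolding inner_diff_left[symmetric] d[symmetric]
    by (intro order_trans[OF norm_cauchy_schwarz] mult_right_mono norm_drift_le) auto
  ultimately show "k t * ?r p + (p v* q i j) \<bullet> \<xi> \<le> k t' * ?r p' + (p' v* q i j) \<bullet> \<xi> +
      (\<bar>k t - k t'\<bar> * payoff_const + k 0 * payoff_const * norm (p - p') + kernel_const * norm (p - p') * norm \<xi>)"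
    unfolding left_diff_distrib right_diff_distrib by linarith
qed

lemma compact_prob_simplex: "compact (prob_simplex :: (real ^ 'w) set)"
proof -
  have "closed {p :: real ^ 'w. (\<forall>w. 0 \<le> p $ w) \<and> (\<Sum>w\<in>UNIV. p $ w) = 1}"
    by (intro closed_Collect_conj closed_Collect_all closed_Collect_le closed_Collect_eq continuous_intros)
  then show ?thesis
    using norm_simplex_le_1 by (auto simp: compact_eq_bounded_closed prob_simplex_def bounded_iff)
qed

text \<open>\<rho> bounds the distance of the two times at the maximum, \<omega> is the resulting
  oscillation of the weight, and \<kappa> bounds both functions after \<open>T1\<close>. The
  Lipschitz condition is a disjunction, since controlling the belief distance takes one regular
  function. The two times in the conclusion may differ because two grids need not meet.\<close>

lemma doubling_of_variables:
  fixes u w :: "real \<times> (real ^ 'w) \<Rightarrow> real"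
  assumes F: "value_operator F"
    and S: "compact S" "S \<subseteq> {0..t1}" and R: "compact R" "R \<subseteq> {0..t1}"
    and t01: "0 \<le> T1" "T1 < t0" "t0 < t1" "ereal t1 < T"
    and u: "continuous_on (S \<times> prob_simplex) u" and w: "continuous_on (R \<times> prob_simplex) w"
    and u_bound: "\<And>t p. t \<in> S \<Longrightarrow> p \<in> prob_simplex \<Longrightarrow> \<bar>u (t, p)\<bar> \<le> B"
    and w_bound: "\<And>t p. t \<in> R \<Longrightarrow> p \<in> prob_simplex \<Longrightarrow> \<bar>w (t, p)\<bar> \<le> B"
    and lip: "(\<forall>t\<in>S. \<forall>p\<in>prob_simplex. \<forall>p'\<in>prob_simplex. u (t, p) - u (t, p') \<le> L * norm (p - p')) \<or>
      (\<forall>t\<in>R. \<forall>p\<in>prob_simplex. \<forall>p'\<in>prob_simplex. w (t, p) - w (t, p') \<le> L * norm (p - p'))"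
    and tail: "\<And>t p. t \<in> S \<Longrightarrow> T1 \<le> t \<Longrightarrow> p \<in> prob_simplex \<Longrightarrow> u (t, p) \<le> \<kappa>"
      "\<And>t p. t \<in> R \<Longrightarrow> T1 \<le> t \<Longrightarrow> p \<in> prob_simplex \<Longrightarrow> - \<kappa> \<le> w (t, p)"
    and sub: "approx_sub (ham F g q k) S t0 \<epsilon> \<eta> \<gamma> u"
    and super: "approx_sub (ham (dual_operator F) (\<lambda>i j w. - g i j w) q k) R t0 \<epsilon> 0 \<gamma> (\<lambda>x. - w x)"
    and pos: "0 < \<epsilon>" "0 < \<eta>" "0 \<le> \<kappa>" "0 < L" "0 < \<rho>"
    and \<rho>: "\<rho> \<le> t0 - T1" "2 * \<epsilon> * (2 * B + \<eta> * t1) \<le> \<rho>\<^sup>2"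
    and modulus: "\<And>t t'. t \<in> {0..t1} \<Longrightarrow> t' \<in> {0..t1} \<Longrightarrow> \<bar>t - t'\<bar> \<le> \<rho> \<Longrightarrow> \<bar>k t - k t'\<bar> * payoff_const \<le> \<omega>"
    and small: "\<omega> + (k 0 * payoff_const * (2 * L) + kernel_const * (2 * L) * (2 * L)) * \<epsilon> + 2 * \<gamma> < \<eta>"
    and x: "t \<in> S" "t' \<in> R" "p \<in> prob_simplex"
  shows "u (t, p) - w (t', p) \<le> 2 * \<kappa> + \<eta> * t1 + (t - t')\<^sup>2 / (2 * \<epsilon>)"
proof -
  define \<Phi> where "\<Phi> = (\<lambda>x. case x of ((t, p), (t', p')) \<Rightarrow>
      u (t, p) - w (t', p') - (norm (p - p'))\<^sup>2 / (2 * \<epsilon>) - (t - t')\<^sup>2 / (2 * \<epsilon>) + \<eta> * t)"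
  let ?K = "(S \<times> (prob_simplex :: (real ^ 'w) set)) \<times> (R \<times> (prob_simplex :: (real ^ 'w) set))"
  have "continuous_on ?K (\<lambda>x. u (fst x))" "continuous_on ?K (\<lambda>x. w (snd x))"
    by (auto intro!: continuous_on_compose2[OF u] continuous_on_compose2[OF w] continuous_intros)
  then have "continuous_on ?K (\<lambda>x. u (fst x) - w (snd x) - (norm (snd (fst x) - snd (snd x)))\<^sup>2 / (2 * \<epsilon>)
      - (fst (fst x) - fst (snd x))\<^sup>2 / (2 * \<epsilon>) + \<eta> * fst (fst x))"
    using pos(1) by (intro continuous_intros) auto
  then have cont: "continuous_on ?K \<Phi>"
    by (simp add: \<Phi>_def case_prod_unfold)
  have comp: "compact ?K"
    by (intro compact_Times S R compact_prob_simplex)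
  have ne: "?K \<noteq> {}" using x by auto
  obtain z where z: "z \<in> ?K" "\<And>y. y \<in> ?K \<Longrightarrow> \<Phi> y \<le> \<Phi> z"
    using continuous_attains_sup[OF comp ne cont] by blast
  obtain \<tau> \<pi> \<tau>' \<pi>' where z_eq: "z = ((\<tau>, \<pi>), (\<tau>', \<pi>'))" by (metis surj_pair)
  with z(1) have in_dom: "\<tau> \<in> S" "\<pi> \<in> prob_simplex" "\<tau>' \<in> R" "\<pi>' \<in> prob_simplex" by auto
  have max: "u (t, p) - w (t', p') - (norm (p - p'))\<^sup>2 / (2 * \<epsilon>) - (t - t')\<^sup>2 / (2 * \<epsilon>) + \<eta> * t \<le>
      u (\<tau>, \<pi>) - w (\<tau>', \<pi>') - (norm (\<pi> - \<pi>'))\<^sup>2 / (2 * \<epsilon>) - (\<tau> - \<tau>')\<^sup>2 / (2 * \<epsilon>) + \<eta> * \<tau>"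
    if "t \<in> S" "p \<in> prob_simplex" "t' \<in> R" "p' \<in> prob_simplex" for t p t' p'
    using z(2)[of "((t, p), (t', p'))"] that by (simp add: \<Phi>_def z_eq)
  have \<tau>: "\<tau> \<in> {0..t1}" "\<tau>' \<in> {0..t1}" using in_dom S R by auto
  have "u (\<tau>, \<pi>) - w (\<tau>', \<pi>') - (norm (\<pi> - \<pi>'))\<^sup>2 / (2 * \<epsilon>) - (\<tau> - \<tau>')\<^sup>2 / (2 * \<epsilon>) + \<eta> * \<tau> \<le> 2 * \<kappa> + \<eta> * t1"
    (is "?max \<le> _")
  proof (rule ccontr)
    assume "\<not> ?thesis"
    then have big: "2 * \<kappa> + \<eta> * t1 < ?max" by simp
    have \<eta>\<tau>: "\<eta> * \<tau> \<le> \<eta> * t1" using \<tau> pos by auto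
    have t1: "0 \<le> \<eta> * t1" using t01 pos by auto
    have sq: "0 \<le> (norm (\<pi> - \<pi>'))\<^sup>2 / (2 * \<epsilon>)" "0 \<le> (\<tau> - \<tau>')\<^sup>2 / (2 * \<epsilon>)" using pos by auto
    \<comment> \<open>The supposed maximum is positive, so the time penalty is below
      \<open>u - w + \<eta> * \<tau>\<close> at the maximum point.\<close>
    have "(\<tau> - \<tau>')\<^sup>2 / (2 * \<epsilon>) \<le> 2 * B + \<eta> * t1"
      using big sq(1) \<eta>\<tau> t1 pos(3) u_bound[OF in_dom(1,2)] w_bound[OF in_dom(3,4)] by linarith
    then have "(\<tau> - \<tau>')\<^sup>2 \<le> \<rho>\<^sup>2"
      using \<rho>(2) pos(1) by (simp add: pos_divide_le_eq algebra_simps)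
    then have close: "\<bar>\<tau> - \<tau>'\<bar> \<le> \<rho>"
      using pos(5) by (simp add: abs_le_square_iff[symmetric])
    have n: "norm (\<pi> - \<pi>') \<le> 2 * L * \<epsilon>"
    proof -
      \<comment> \<open>The competitor moves the belief of the Lipschitz function onto the other
        belief and keeps both times: the belief penalty disappears at a cost of at most
        \<open>L * norm (\<pi> - \<pi>')\<close>.\<close>
      have "(norm (\<pi> - \<pi>'))\<^sup>2 / (2 * \<epsilon>) \<le> L * norm (\<pi> - \<pi>')"
        using lip
      proof
        assume "\<forall>t\<in>S. \<forall>p\<in>prob_simplex. \<forall>p'\<in>prob_simplex. u (t, p) - u (t, p') \<le> L * norm (p - p')"
        then have "u (\<tau>, \<pi>) - u (\<tau>, \<pi>') \<le> L * norm (\<pi> - \<pi>')" using in_dom by blast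
        then show ?thesis using max[OF in_dom(1) in_dom(4) in_dom(3,4)] by simp
      next
        assume "\<forall>t\<in>R. \<forall>p\<in>prob_simplex. \<forall>p'\<in>prob_simplex. w (t, p) - w (t, p') \<le> L * norm (p - p')"
        then have "w (\<tau>', \<pi>) - w (\<tau>', \<pi>') \<le> L * norm (\<pi> - \<pi>')" using in_dom by blast
        then show ?thesis using max[OF in_dom(1,2) in_dom(3) in_dom(2)] by simp
      qed
      then have "norm (\<pi> - \<pi>') * norm (\<pi> - \<pi>') \<le> (2 * L * \<epsilon>) * norm (\<pi> - \<pi>')"
        using pos(1) by (simp add: divide_le_eq power2_eq_square algebra_simps)
      then show ?thesis
        using pos by (cases "norm (\<pi> - \<pi>') = 0") (auto simp: mult_le_cancel_right)
    qed
    show False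
    proof (cases "\<tau> \<le> t0 \<and> \<tau>' \<le> t0")
      case True
      \<comment> \<open>Freezing either half gives a one-variable maximum. After dualisation both
        inequalities have the gradient \<open>?\<xi>\<close>; in their sum the time derivatives
        cancel, and \<eta> stands against the errors.\<close>
      let ?\<xi> = "(1 / \<epsilon>) *\<^sub>R (\<pi> - \<pi>')"
      have "0 \<le> (\<tau> - \<tau>') / \<epsilon> - \<eta> + ham F g q k \<tau> \<pi> ?\<xi> + \<gamma>"
      proof (rule approx_subD[OF sub in_dom(1,2)])
        show "\<tau> \<le> t0" using True by simp
        show "u (t', p') - penalty \<epsilon> \<eta> \<pi>' \<tau>' t' p' \<le> u (\<tau>, \<pi>) - penalty \<epsilon> \<eta> \<pi>' \<tau>' \<tau> \<pi>"
          if "t' \<in> S" "p' \<in> prob_simplex" for t' p'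
          using max[OF that in_dom(3,4)] by (simp add: penalty_def)
      qed
      moreover have "0 \<le> (\<tau>' - \<tau>) / \<epsilon> - 0 + ham (dual_operator F) (\<lambda>i j w. - g i j w) q k \<tau>' \<pi>' ((1 / \<epsilon>) *\<^sub>R (\<pi>' - \<pi>)) + \<gamma>"
      proof (rule approx_subD[OF super in_dom(3,4)])
        show "\<tau>' \<le> t0" using True by simp
        show "- w (t', p') - penalty \<epsilon> 0 \<pi> \<tau> t' p' \<le> - w (\<tau>', \<pi>') - penalty \<epsilon> 0 \<pi> \<tau> \<tau>' \<pi>'"
          if "t' \<in> R" "p' \<in> prob_simplex" for t' p'
          using max[OF in_dom(1,2) that] by (simp add: penalty_def norm_minus_commute power2_commute)
      qed
      moreover have "- ((1 / \<epsilon>) *\<^sub>R (\<pi>' - \<pi>)) = ?\<xi>"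
        by (simp add: algebra_simps)
      ultimately have "\<eta> \<le> ham F g q k \<tau> \<pi> ?\<xi> - ham F g q k \<tau>' \<pi>' ?\<xi> + 2 * \<gamma>"
        unfolding ham_dual by (simp add: diff_divide_distrib)
      also have "\<dots> \<le> (\<bar>k \<tau> - k \<tau>'\<bar> * payoff_const + k 0 * payoff_const * norm (\<pi> - \<pi>') + kernel_const * norm (\<pi> - \<pi>') * norm ?\<xi>) + 2 * \<gamma>"
      proof -
        have "ereal \<tau>' \<le> T" using \<tau>(2) t01(4) by (meson atLeastAtMost_iff ereal_less_eq(3) less_imp_le order_trans)
        then show ?thesis
          using ham_diff_le[OF F in_dom(2,4), of \<tau>' \<tau> ?\<xi>] \<tau>(2) by simp
      qed
      also have "\<dots> \<le> (\<omega> + k 0 * payoff_const * (2 * L * \<epsilon>) + kernel_const * (2 * L * \<epsilon>) * (2 * L)) + 2 * \<gamma>"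
      proof -
        have "norm ?\<xi> \<le> 2 * L" using n pos(1) by (simp add: divide_le_eq)
        then show ?thesis
          using modulus[OF \<tau> close] n k0_nonneg payoff_const_nonneg kernel_const_nonneg pos
          by (intro add_mono mult_mono mult_left_mono) auto
      qed
      also have "\<dots> < \<eta>" using small by (simp add: algebra_simps)
      finally show False by simp
    next
      \<comment> \<open>One time lies beyond \<open>t0\<close>. As the times differ by at most
        \<open>\<rho> \<le> t0 - T1\<close>, both lie beyond \<open>T1\<close>, where the tail
        bounds apply.\<close>
      case False
      then have "T1 \<le> \<tau>" "T1 \<le> \<tau>'" using close \<rho>(1) t01(2) by auto
      then have "u (\<tau>, \<pi>) \<le> \<kappa>" "- \<kappa> \<le> w (\<tau>', \<pi>')"
        using tail in_dom by auto
      then show False using big sq \<eta>\<tau> by linarith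
    qed
  qed
  moreover have "0 \<le> \<eta> * t" using x S pos by auto
  ultimately show ?thesis
    using max[OF x(1,3,2,3)] by simp
qed

end

section \<open>Regularity of the discrete values\<close>

context continuous_game
begin

definition "value_bound = payoff_const * (1 + k 0)"
text \<open>\<open>CARD('w)\<close> passes from the sum norm to the Euclidean norm, and the
  \<open>+ 1\<close> makes the constant positive. In \<open>value_speed\<close>, one stage
  contributes its own weight and, through this Lipschitz constant, the drift of the belief.\<close>

definition "value_lip = payoff_const * (1 + k 0) * CARD('w) + 1"
definition "value_speed = k 0 * payoff_const + value_lip * kernel_const"

lemma value_bound_nonneg: "0 \<le> value_bound"
  using payoff_const_nonneg k0_nonneg by (simp add: value_bound_def)

lemma value_lip_pos: "0 < value_lip"
proof -
  have "0 \<le> payoff_const * (1 + k 0) * CARD('w)"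
    using payoff_const_nonneg k0_nonneg by (intro mult_nonneg_nonneg) auto
  then show ?thesis by (simp add: value_lip_def)
qed

lemma value_speed_nonneg: "0 \<le> value_speed"
  using payoff_const_nonneg k0_nonneg value_lip_pos kernel_const_nonneg by (simp add: value_speed_def)

lemma integral_k_tail_uniform:
  assumes "e > 0"
  obtains T1 where "0 \<le> T1" "ereal T1 < T" "\<And>a b. T1 \<le> a \<Longrightarrow> ereal b < T \<Longrightarrow> integral {a..b} k \<le> e"
proof -
  obtain T1 where T1: "0 \<le> T1" "ereal T1 < T" "\<And>b. T1 \<le> b \<Longrightarrow> ereal b < T \<Longrightarrow> integral {T1..b} k \<le> e"
    using integral_k_tail[OF assms] by blast
  have "integral {a..b} k \<le> e" if "T1 \<le> a" "ereal b < T" for a b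
  proof (cases "a \<le> b")
    case True
    have nonneg: "0 \<le> k x" if x: "x \<in> {T1..b}" for x
    proof (rule k_nonneg)
      have "ereal x \<le> ereal b" using x by simp
      then show "ereal x \<le> T" using \<open>ereal b < T\<close> by (meson less_imp_le order_trans)
      show "0 \<le> x" using x T1(1) by simp
    qed
    have le: "ereal b \<le> T" using that(2) by (rule less_imp_le)
    have a: "0 \<le> a" using that(1) T1(1) by linarith
    have sub: "{a..b} \<subseteq> {T1..b}" using that(1) by simp
    have "integral {a..b} k \<le> integral {T1..b} k"
      by (rule integral_subset_le[OF sub k_integrable_on[OF a le] k_integrable_on[OF T1(1) le]])
         (use nonneg in blast)
    also have "\<dots> \<le> e" using that True by (intro T1(3)) linarith
    finally show ?thesis .
  qed (use assms in simp)
  then show ?thesis by (rule that[OF T1(1,2)])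
qed

end

context fine_partition
begin

lemma s_mono: "n \<le> m \<Longrightarrow> s n \<le> s m"
  by (simp add: strict_mono_less_eq[OF s_strict_mono])

lemma locate:
  assumes "0 \<le> t" "ereal t < T"
  obtains n where "s n \<le> t" "t < s (Suc n)"
proof -
  have "(\<lambda>n. ereal (s n)) \<longlonglongrightarrow> T" using partition by (simp add: partition_of_def)
  then have "eventually (\<lambda>n. ereal t < ereal (s n)) sequentially"
    using assms(2) by (rule order_tendstoD(1))
  then obtain N where "t < s N" by (auto simp: eventually_sequentially)
  moreover have "\<not> t < s 0" using assms(1) s_0 by simp
  ultimately obtain n where "\<forall>i\<le>n. \<not> t < s i" "t < s (Suc n)"
    using ex_least_nat_less[of "\<lambda>m. t < s m" N] by blast
  then show ?thesis using that[of n] by (simp add: not_less)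
qed

lemma finite_grid:
  assumes "ereal t1 < T"
  shows "finite (range s \<inter> {..t1})"
proof (cases "0 \<le> t1")
  case True
  then obtain n where n: "s n \<le> t1" "t1 < s (Suc n)" using locate assms by blast
  have "range s \<inter> {..t1} \<subseteq> s ` {..n}"
  proof safe
    fix m assume "s m \<le> t1"
    then have "s m < s (Suc n)" using n by simp
    then show "s m \<in> s ` {..n}" by (simp add: strict_mono_less[OF s_strict_mono])
  qed
  then show ?thesis by (rule finite_subset) simp
next
  case False
  then have "range s \<inter> {..t1} = {}" using s_nonneg by (auto simp: not_le) (meson less_le_trans not_less)
  then show ?thesis by simp
qed

lemma game_value_between:
  assumes "s n \<le> t" "t < s (Suc n)"
  shows "game_value g q k s (t, p) =
    (s (Suc n) - t) / duration s n * stage_value g q k s n p +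
    (1 - (s (Suc n) - t) / duration s n) * stage_value g q k s (Suc n) p"
proof -
  have "(THE n. s n \<le> t \<and> t < s (Suc n)) = n"
  proof (rule the_equality)
    fix m assume m: "s m \<le> t \<and> t < s (Suc m)"
    have "s m < s (Suc n)" "s n < s (Suc m)" using assms m by auto
    then show "m = n" by (simp add: strict_mono_less[OF s_strict_mono])
  qed (use assms in simp)
  then show ?thesis by (simp add: game_value_def Let_def)
qed

lemma game_value_grid: "game_value g q k s (s n, p) = stage_value g q k s n p"
  using game_value_between[of n "s n" p] duration_pos[of n] by (simp add: duration_def)

lemma game_value_dynamic_programming:
  assumes "p \<in> prob_simplex"
  shows "game_value g q k s (s n, p) =
    matrix_game_value (\<lambda>i j. duration s n * (k (s n) * (\<Sum>w\<in>UNIV. p $ w * g i j w)) +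
        game_value g q k s (s (Suc n), p + duration s n *\<^sub>R (p v* q i j)))"
  using stage_value_dynamic_programming[OF assms]
  by (simp add: game_value_grid vector_matrix_mult_step weight_def mult.assoc)

lemma game_value_dynamic_programming_dual:
  assumes "p \<in> prob_simplex"
  shows "- game_value g q k s (s n, p) =
    dual_operator matrix_game_value (\<lambda>i j. duration s n * (k (s n) * (\<Sum>w\<in>UNIV. p $ w * - g i j w)) +
        - game_value g q k s (s (Suc n), p + duration s n *\<^sub>R (p v* q i j)))"
  by (simp add: dual_operator_def sum_negf game_value_dynamic_programming[OF assms] add.commute)

lemma tail_weight_le_const: "tail_weight n \<le> 1 + k 0"
proof -
  have "tail_weight n \<le> 1 + \<delta> * k 0"
    using s_nonneg s_less_T by (intro tail_weight_le integral_k_le_1) (auto intro: less_imp_le)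
  also have "\<dots> \<le> 1 + k 0"
    using \<delta>_le_1 k0_nonneg mult_right_mono[of \<delta> 1 "k 0"] by simp
  finally show ?thesis .
qed

lemma abs_stage_value_le_bound: "p \<in> prob_simplex \<Longrightarrow> \<bar>stage_value g q k s n p\<bar> \<le> value_bound"
  using abs_stage_value_le[of p n] mult_left_mono[OF tail_weight_le_const payoff_const_nonneg, of n]
  by (simp add: value_bound_def)

lemma abs_stage_value_le_tail:
  assumes "p \<in> prob_simplex" "T1 \<le> s n" "\<And>a b. T1 \<le> a \<Longrightarrow> ereal b < T \<Longrightarrow> integral {a..b} k \<le> e"
  shows "\<bar>stage_value g q k s n p\<bar> \<le> payoff_const * (e + \<delta> * k 0)"
proof -
  have "tail_weight n \<le> e + \<delta> * k 0"
    using assms s_less_T by (intro tail_weight_le) auto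
  then show ?thesis
    using abs_stage_value_le[OF assms(1), of n] mult_left_mono[OF _ payoff_const_nonneg] by fastforce
qed

lemma stage_value_lipschitz:
  assumes "p \<in> prob_simplex" "p' \<in> prob_simplex"
  shows "stage_value g q k s n p - stage_value g q k s n p' \<le> value_lip * norm (p - p')"
proof -
  have "(\<Sum>w\<in>UNIV. \<bar>p $ w - p' $ w\<bar>) \<le> (\<Sum>w\<in>(UNIV :: 'w set). norm (p - p'))"
    using component_le_norm_cart[of "p - p'"] by (intro sum_mono) simp
  then have "payoff_const * tail_weight n * (\<Sum>w\<in>UNIV. \<bar>p $ w - p' $ w\<bar>) \<le>
      payoff_const * (1 + k 0) * (CARD('w) * norm (p - p'))"
    using tail_weight_le_const[of n] payoff_const_nonneg k0_nonneg
    by (intro mult_mono) (auto intro: sum_nonneg tail_weight_nonneg)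
  also have "\<dots> \<le> value_lip * norm (p - p')"
    by (simp add: value_lip_def algebra_simps)
  finally show ?thesis
    using stage_value_le_lipschitz[OF assms, of n] by linarith
qed

lemma stage_value_Suc_diff:
  assumes p: "p \<in> prob_simplex"
  shows "\<bar>stage_value g q k s n p - stage_value g q k s (Suc n) p\<bar> \<le> value_speed * duration s n"
proof -
  let ?h = "duration s n" and ?V = "stage_value g q k s (Suc n)"
  let ?a = "\<lambda>i j. weight n * (\<Sum>w\<in>UNIV. p $ w * g i j w) + ?V (p v* (mat 1 + ?h *\<^sub>R q i j))"
  have bound: "\<bar>?a i j - ?V p\<bar> \<le> value_speed * ?h" for i j
  proof -
    let ?p = "p v* (mat 1 + ?h *\<^sub>R q i j)"
    have step: "?p \<in> prob_simplex" by (rule belief_step[OF p])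
    have "norm (?p - p) \<le> ?h * kernel_const"
      using norm_drift_simplex_le[OF p, of i j] duration_pos[of n] by (simp add: vector_matrix_mult_step)
    then have "value_lip * norm (?p - p) \<le> value_lip * (?h * kernel_const)"
      using value_lip_pos by (intro mult_left_mono) auto
    then have V: "\<bar>?V ?p - ?V p\<bar> \<le> value_lip * (?h * kernel_const)"
      using stage_value_lipschitz[OF step p, of "Suc n"] stage_value_lipschitz[OF p step, of "Suc n"]
      by (simp add: norm_minus_commute abs_le_iff)
    have "\<bar>\<Sum>w\<in>UNIV. p $ w * g i j w\<bar> \<le> payoff_const"
      by (rule abs_simplex_average_le[OF p abs_payoff_le])
    then have "weight n * \<bar>\<Sum>w\<in>UNIV. p $ w * g i j w\<bar> \<le> (?h * k 0) * payoff_const"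
      using k_le_k0[OF s_nonneg less_imp_le[OF s_less_T], of n] duration_pos[of n] k0_nonneg payoff_const_nonneg k_s_nonneg[of n]
      unfolding weight_def by (intro mult_mono) auto
    then have "\<bar>weight n * (\<Sum>w\<in>UNIV. p $ w * g i j w)\<bar> \<le> (?h * k 0) * payoff_const"
      using weight_nonneg'[of n] by (simp add: abs_mult)
    then have "\<bar>?a i j - ?V p\<bar> \<le> (?h * k 0) * payoff_const + value_lip * (?h * kernel_const)"
      using V by linarith
    then show ?thesis by (simp add: value_speed_def algebra_simps)
  qed
  \<comment> \<open>The entries \<open>?a i j\<close> are close to the constant \<open>?V p\<close>.
    Comparison with the zero matrix, whose value is 0 by homogeneity with factor 2, makes the value
    of \<open>?a\<close> equally close.\<close>
  let ?Z = "matrix_game_value (\<lambda>(i :: 'i) (j :: 'j). 0)"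
  have le1: "matrix_game_value ?a \<le> ?Z + (?V p + value_speed * ?h)"
  proof (rule value_operator_le_add[OF value_operator_matrix_game_value])
    show "?a i j \<le> 0 + (?V p + value_speed * ?h)" for i j
      using bound[of i j] by linarith
  qed
  have le2: "?Z \<le> matrix_game_value ?a + (value_speed * ?h - ?V p)"
  proof (rule value_operator_le_add[OF value_operator_matrix_game_value])
    show "0 \<le> ?a i j + (value_speed * ?h - ?V p)" for i j
      using bound[of i j] by linarith
  qed
  have "?Z = 0"
    using value_operator_cmult[OF value_operator_matrix_game_value, of 2 "\<lambda>(i::'i) (j::'j). 0"] by simp
  then show ?thesis
    using le1 le2 unfolding stage_value_dynamic_programming[OF p, of n] by linarith
qed

lemma stage_value_time_lipschitz:
  assumes p: "p \<in> prob_simplex"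
  shows "\<bar>stage_value g q k s n p - stage_value g q k s m p\<bar> \<le> value_speed * \<bar>s n - s m\<bar>"
proof -
  have *: "\<bar>stage_value g q k s n p - stage_value g q k s (n + l) p\<bar> \<le> value_speed * (s (n + l) - s n)" for n l
  proof (induction l)
    case (Suc l)
    then show ?case
      using stage_value_Suc_diff[OF p, of "n + l"] by (simp add: duration_def algebra_simps)
  qed simp
  show ?thesis
  proof (cases "n \<le> m")
    case True
    then show ?thesis using *[of n "m - n"] s_mono[OF True] by simp
  next
    case False
    then show ?thesis using *[of m "n - m"] s_mono[of m n] by (simp add: abs_minus_commute)
  qed
qed

lemma game_value_near_grid:
  assumes "s n \<le> t" "t < s (Suc n)" "p \<in> prob_simplex"
  shows "\<bar>game_value g q k s (t, p) - stage_value g q k s n p\<bar> \<le> value_speed * \<delta>"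
proof -
  let ?\<alpha> = "(s (Suc n) - t) / duration s n"
  have \<alpha>: "0 \<le> ?\<alpha>" "?\<alpha> \<le> 1"
    using assms duration_pos[of n] by (auto simp: duration_def)
  have "game_value g q k s (t, p) - stage_value g q k s n p = (1 - ?\<alpha>) * (stage_value g q k s (Suc n) p - stage_value g q k s n p)"
    unfolding game_value_between[OF assms(1,2)] by (simp add: algebra_simps)
  then have "\<bar>game_value g q k s (t, p) - stage_value g q k s n p\<bar> = (1 - ?\<alpha>) * \<bar>stage_value g q k s n p - stage_value g q k s (Suc n) p\<bar>"
    using \<alpha> by (simp add: abs_mult abs_minus_commute)
  also have "\<dots> \<le> 1 * (value_speed * duration s n)"
    using \<alpha> stage_value_Suc_diff[OF assms(3), of n] by (intro mult_mono) auto
  also have "\<dots> \<le> value_speed * \<delta>"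
    using duration_less[of n] value_speed_nonneg by (auto intro!: mult_left_mono)
  finally show ?thesis .
qed

text \<open>Of the three errors \<open>value_speed * \<delta>\<close>, two come from replacing the
  times by the preceding grid points and one from the distance of these points, which can exceed
  \<open>\<bar>t - t'\<bar>\<close> by \<delta>.\<close>

lemma game_value_almost_lipschitz:
  assumes "0 \<le> t" "ereal t < T" "0 \<le> t'" "ereal t' < T" "p \<in> prob_simplex" "p' \<in> prob_simplex"
  shows "\<bar>game_value g q k s (t, p) - game_value g q k s (t', p')\<bar> \<le>
    value_speed * \<bar>t - t'\<bar> + value_lip * norm (p - p') + 3 * value_speed * \<delta>"
proof -
  obtain n where n: "s n \<le> t" "t < s (Suc n)" using locate assms by blast
  obtain m where m: "s m \<le> t'" "t' < s (Suc m)" using locate assms by blast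
  have "\<bar>s n - s m\<bar> \<le> \<bar>t - t'\<bar> + \<delta>"
    using n m duration_less[of n] duration_less[of m] by (simp add: duration_def)
  then have "value_speed * \<bar>s n - s m\<bar> \<le> value_speed * (\<bar>t - t'\<bar> + \<delta>)"
    using value_speed_nonneg by (intro mult_left_mono)
  then have "\<bar>stage_value g q k s n p - stage_value g q k s m p\<bar> \<le> value_speed * \<bar>t - t'\<bar> + value_speed * \<delta>"
    using stage_value_time_lipschitz[OF assms(5), of n m] by (simp add: distrib_left)
  moreover have "\<bar>stage_value g q k s m p - stage_value g q k s m p'\<bar> \<le> value_lip * norm (p - p')"
    using stage_value_lipschitz[OF assms(5,6), of m] stage_value_lipschitz[OF assms(6,5), of m]
    by (simp add: abs_le_iff norm_minus_commute)
  ultimately show ?thesis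
    using game_value_near_grid[OF n assms(5)] game_value_near_grid[OF m assms(6)] by linarith
qed

lemma continuous_on_grid:
  "continuous_on ((range s \<inter> {..t1}) \<times> prob_simplex) (game_value g q k s)"
proof -
  have "\<bar>game_value g q k s (s n, p) - game_value g q k s (s m, p')\<bar> \<le> (value_speed + value_lip) * dist (s n, p) (s m, p')"
    if "p \<in> prob_simplex" "p' \<in> prob_simplex" for n m p p'
  proof -
    have "\<bar>s n - s m\<bar> \<le> dist (s n, p) (s m, p')" "norm (p - p') \<le> dist (s n, p) (s m, p')"
      using dist_fst_le[of "(s n, p)" "(s m, p')"] dist_snd_le[of "(s n, p)" "(s m, p')"]
      by (auto simp: dist_norm)
    then have "value_speed * \<bar>s n - s m\<bar> + value_lip * norm (p - p') \<le> (value_speed + value_lip) * dist (s n, p) (s m, p')"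
      using value_speed_nonneg value_lip_pos by (simp add: distrib_right add_mono mult_left_mono)
    then show ?thesis
      using stage_value_time_lipschitz[OF that(1), of n m] stage_value_lipschitz[OF that, of m]
        stage_value_lipschitz[OF that(2,1), of m]
      by (simp add: game_value_grid abs_le_iff norm_minus_commute)
  qed
  then have "(value_speed + value_lip)-lipschitz_on ((range s \<inter> {..t1}) \<times> prob_simplex) (game_value g q k s)"
    using value_speed_nonneg value_lip_pos by (intro lipschitz_onI) (auto simp: dist_real_def)
  then show ?thesis by (rule lipschitz_on_continuous_on)
qed

end

section \<open>Comparison of approximate solutions\<close>

context continuous_game
begin

text \<open>\<open>S\<close> is the set of times on which \<open>u\<close> is considered (a grid or an interval). The inequality is
  required only up to \<open>t0 < t1\<close>, so that the grid point following a maximum still lies in \<open>S\<close>; from \<open>T1\<close>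
  on, \<open>u\<close> is negligible.\<close>

definition candidate where
  "candidate F f t1 t0 T1 B \<kappa> \<epsilon> \<eta> \<gamma> S u \<longleftrightarrow>
     compact S \<and> S \<subseteq> {0..t1} \<and> continuous_on (S \<times> (prob_simplex :: (real ^ 'w) set)) u \<and>
     (\<forall>t\<in>S. \<forall>p\<in>prob_simplex. \<bar>u (t, p)\<bar> \<le> B) \<and>
     (\<forall>t\<in>S. T1 \<le> t \<longrightarrow> (\<forall>p\<in>prob_simplex. \<bar>u (t, p)\<bar> \<le> \<kappa>)) \<and>
     approx_sub (ham F f q k) S t0 \<epsilon> \<eta> \<gamma> u"

text \<open>The parameters depend on the times and bounds but not on \<open>S\<close>,
  \<open>R\<close>, \<open>u\<close>, \<open>w\<close>. Hence the mesh may be adapted to \<epsilon>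
  and \<gamma> afterwards.\<close>

lemma candidate_comparison:
  assumes F: "value_operator F" and t01: "0 \<le> T1" "T1 < t0" "t0 < t1" "ereal t1 < T"
    and pos: "0 \<le> B" "0 < L" "0 \<le> \<kappa>" "0 < e"
  obtains \<epsilon> \<eta> \<gamma> where "0 < \<epsilon>" "0 < \<eta>" "0 < \<gamma>"
    "\<And>S R u w t t' p.
       candidate F g t1 t0 T1 B \<kappa> \<epsilon> \<eta> \<gamma> S u \<Longrightarrow>
       candidate (dual_operator F) (\<lambda>i j w. - g i j w) t1 t0 T1 B \<kappa> \<epsilon> 0 \<gamma> R (\<lambda>x. - w x) \<Longrightarrow>
       (\<forall>t\<in>S. \<forall>p\<in>prob_simplex. \<forall>p'\<in>prob_simplex. u (t, p) - u (t, p') \<le> L * norm (p - p')) \<or>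
       (\<forall>t\<in>R. \<forall>p\<in>prob_simplex. \<forall>p'\<in>prob_simplex. w (t, p) - w (t, p') \<le> L * norm (p - p')) \<Longrightarrow>
       t \<in> S \<Longrightarrow> t' \<in> R \<Longrightarrow> p \<in> prob_simplex \<Longrightarrow>
       u (t, p) - w (t', p) \<le> 2 * \<kappa> + e + (t - t')\<^sup>2 / (2 * \<epsilon>)"
proof -
  have cancel: "a / (4 * b) * b = a / 4" if "b \<noteq> 0" for a b :: real
    using that by simp
  \<comment> \<open>The tilt contributes at most \<open>\<eta> * t1\<close> to the final estimate,
    which becomes \<open>e\<close>.\<close>
  define \<eta> where "\<eta> = e / t1"
  have t1: "0 < t1" using t01 by linarith
  have \<eta>: "0 < \<eta>" "\<eta> * t1 = e" using t1 pos by (auto simp: \<eta>_def)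
  have "{0..t1} \<subseteq> {t. 0 \<le> t \<and> ereal t \<le> T}"
    using t01(4) by (intro interval_subset) auto
  then have "uniformly_continuous_on {0..t1} k"
    by (intro compact_uniformly_continuous continuous_on_subset[OF k_continuous]) auto
  moreover have "0 < \<eta> / (4 * (payoff_const + 1))"
    using \<eta>(1) payoff_const_nonneg by (intro divide_pos_pos) auto
  ultimately obtain \<rho>0 where \<rho>0: "0 < \<rho>0"
    "\<And>t t'. t \<in> {0..t1} \<Longrightarrow> t' \<in> {0..t1} \<Longrightarrow> dist t' t < \<rho>0 \<Longrightarrow> dist (k t') (k t) < \<eta> / (4 * (payoff_const + 1))"
    unfolding uniformly_continuous_on_def by blast
  define \<rho> where "\<rho> = min (\<rho>0 / 2) (t0 - T1)"
  have \<rho>: "0 < \<rho>" "\<rho> < \<rho>0" "\<rho> \<le> t0 - T1" using \<rho>0(1) t01 by (auto simp: \<rho>_def)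
  have modulus: "\<bar>k t - k t'\<bar> * payoff_const \<le> \<eta> / 4"
    if "t \<in> {0..t1}" "t' \<in> {0..t1}" "\<bar>t - t'\<bar> \<le> \<rho>" for t t'
  proof -
    have "\<bar>k t - k t'\<bar> \<le> \<eta> / (4 * (payoff_const + 1))"
      using \<rho>0(2)[of t' t] that \<rho>(2) by (simp add: dist_real_def)
    then have "\<bar>k t - k t'\<bar> * payoff_const \<le> \<eta> / (4 * (payoff_const + 1)) * (payoff_const + 1)"
      using payoff_const_nonneg \<eta>(1) by (intro mult_mono) auto
    then show ?thesis using payoff_const_nonneg by (subst (asm) cancel) auto
  qed
  define C where "C = k 0 * payoff_const * (2 * L) + kernel_const * (2 * L) * (2 * L)"
  have C: "0 \<le> C"
    using k0_nonneg payoff_const_nonneg kernel_const_nonneg pos by (simp add: C_def)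
  \<comment> \<open>The first entry keeps the two times within \<rho>, the second makes the belief
    part \<open>C * \<epsilon>\<close> of the Hamiltonian error at most
    \<open>\<eta> / 4\<close>.\<close>
  define \<epsilon> where "\<epsilon> = min (\<rho>\<^sup>2 / (2 * (2 * B + e))) (\<eta> / (4 * (C + 1)))"
  have \<epsilon>: "0 < \<epsilon>"
    using \<rho>(1) pos \<eta>(1) C by (simp add: \<epsilon>_def)
  have "\<epsilon> * (2 * (2 * B + e)) \<le> \<rho>\<^sup>2 / (2 * (2 * B + e)) * (2 * (2 * B + e))"
    using pos by (intro mult_right_mono) (auto simp: \<epsilon>_def)
  also have "\<dots> = \<rho>\<^sup>2" using pos by simp
  finally have \<epsilon>1: "2 * \<epsilon> * (2 * B + \<eta> * t1) \<le> \<rho>\<^sup>2" by (simp add: \<eta>(2) mult_ac)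
  have "C * \<epsilon> \<le> (C + 1) * (\<eta> / (4 * (C + 1)))"
    using C \<epsilon> \<eta>(1) by (intro mult_mono) (auto simp: \<epsilon>_def)
  also have "\<dots> = \<eta> / 4"
    using C cancel[of "C + 1" \<eta>] by (simp add: mult.commute[of "C + 1"])
  finally have \<epsilon>2: "C * \<epsilon> \<le> \<eta> / 4" .
  show ?thesis
  proof (rule that[OF \<epsilon> \<eta>(1)])
    \<comment> \<open>With \<open>\<gamma> = \<eta> / 16\<close> the errors total
      \<open>\<eta> / 4 + \<eta> / 4 + \<eta> / 8\<close>, which is less than \<eta>.\<close>
    show "0 < \<eta> / 16" using \<eta> by simp
    fix S R u w t t' and p :: "real ^ 'w"
    assume c: "candidate F g t1 t0 T1 B \<kappa> \<epsilon> \<eta> (\<eta> / 16) S u"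
       "candidate (dual_operator F) (\<lambda>i j w. - g i j w) t1 t0 T1 B \<kappa> \<epsilon> 0 (\<eta> / 16) R (\<lambda>x. - w x)"
      and lip: "(\<forall>t\<in>S. \<forall>p\<in>prob_simplex. \<forall>p'\<in>prob_simplex. u (t, p) - u (t, p') \<le> L * norm (p - p')) \<or>
       (\<forall>t\<in>R. \<forall>p\<in>prob_simplex. \<forall>p'\<in>prob_simplex. w (t, p) - w (t, p') \<le> L * norm (p - p'))"
      and x: "t \<in> S" "t' \<in> R" "p \<in> prob_simplex"
    have w: "continuous_on (R \<times> (prob_simplex :: (real ^ 'w) set)) w"
      using c(2) continuous_on_minus[of "R \<times> prob_simplex" "\<lambda>x. - w x"] by (auto simp: candidate_def)
    have u': "continuous_on (S \<times> (prob_simplex :: (real ^ 'w) set)) u" "compact S" "S \<subseteq> {0..t1}"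
      "approx_sub (ham F g q k) S t0 \<epsilon> \<eta> (\<eta> / 16) u"
      "\<And>t p. t \<in> S \<Longrightarrow> p \<in> prob_simplex \<Longrightarrow> \<bar>u (t, p)\<bar> \<le> B"
      "\<And>t p. t \<in> S \<Longrightarrow> T1 \<le> t \<Longrightarrow> p \<in> prob_simplex \<Longrightarrow> \<bar>u (t, p)\<bar> \<le> \<kappa>"
      using c(1) unfolding candidate_def by blast+
    have w': "compact R" "R \<subseteq> {0..t1}"
      "approx_sub (ham (dual_operator F) (\<lambda>i j w. - g i j w) q k) R t0 \<epsilon> 0 (\<eta> / 16) (\<lambda>x. - w x)"
      "\<And>t p. t \<in> R \<Longrightarrow> p \<in> prob_simplex \<Longrightarrow> \<bar>w (t, p)\<bar> \<le> B"
      "\<And>t p. t \<in> R \<Longrightarrow> T1 \<le> t \<Longrightarrow> p \<in> prob_simplex \<Longrightarrow> \<bar>w (t, p)\<bar> \<le> \<kappa>"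
      using c(2) unfolding candidate_def abs_minus_cancel by blast+
    have small: "\<eta> / 4 + (k 0 * payoff_const * (2 * L) + kernel_const * (2 * L) * (2 * L)) * \<epsilon> + 2 * (\<eta> / 16) < \<eta>"
      using \<epsilon>2 \<eta>(1) by (simp add: C_def)
    have tail_u: "u (t, p) \<le> \<kappa>" if "t \<in> S" "T1 \<le> t" "p \<in> prob_simplex" for t p
      using u'(6)[OF that] by linarith
    have tail_w: "- \<kappa> \<le> w (t, p)" if "t \<in> R" "T1 \<le> t" "p \<in> prob_simplex" for t p
      using w'(5)[OF that] by linarith
    show "u (t, p) - w (t', p) \<le> 2 * \<kappa> + e + (t - t')\<^sup>2 / (2 * \<epsilon>)"
      using doubling_of_variables[OF F u'(2,3) w'(1,2) t01 u'(1) w u'(5) w'(4) lip tail_u tail_w u'(4) w'(3)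
          \<epsilon> \<eta>(1) pos(3,2) \<rho>(1,3) \<epsilon>1 modulus small x]
      by (simp add: \<eta>(2))
  qed
qed

end

context fine_partition
begin

lemma game_value_candidate:
  assumes t01: "0 \<le> T1" "T1 < t0" "t0 + \<delta> \<le> t1" "ereal t1 < T"
    and tail: "\<And>a b. T1 \<le> a \<Longrightarrow> ereal b < T \<Longrightarrow> integral {a..b} k \<le> e"
    and \<kappa>: "payoff_const * (e + \<delta> * k 0) \<le> \<kappa>" and B: "value_bound \<le> B"
    and \<epsilon>: "0 < \<epsilon>" and \<gamma>: "\<delta> * (kernel_const\<^sup>2 + 1) / (2 * \<epsilon>) \<le> \<gamma>"
  shows "candidate matrix_game_value g t1 t0 T1 B \<kappa> \<epsilon> \<eta> \<gamma> (range s \<inter> {..t1}) (game_value g q k s)"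
    and "candidate (dual_operator matrix_game_value) (\<lambda>i j w. - g i j w) t1 t0 T1 B \<kappa> \<epsilon> \<eta> \<gamma>
      (range s \<inter> {..t1}) (\<lambda>x. - game_value g q k s x)"
proof -
  let ?S = "range s \<inter> {..t1}"
  have S: "compact ?S" "?S \<subseteq> {0..t1}"
    using finite_imp_compact[OF finite_grid[OF t01(4)]] s_nonneg by auto
  have bound: "\<forall>t\<in>?S. \<forall>p\<in>prob_simplex. \<bar>game_value g q k s (t, p)\<bar> \<le> B"
    by (auto simp: game_value_grid intro: order_trans[OF abs_stage_value_le_bound B])
  have tail': "\<forall>t\<in>?S. T1 \<le> t \<longrightarrow> (\<forall>p\<in>prob_simplex. \<bar>game_value g q k s (t, p)\<bar> \<le> \<kappa>)"
  proof safe
    fix n and p :: "real ^ 'w" assume "T1 \<le> s n" "p \<in> prob_simplex"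
    from abs_stage_value_le_tail[OF this(2,1) tail]
    show "\<bar>game_value g q k s (s n, p)\<bar> \<le> \<kappa>"
      using \<kappa> by (simp add: game_value_grid)
  qed
  have "approx_sub (ham matrix_game_value g q k) ?S t0 \<epsilon> \<eta> \<gamma> (game_value g q k s)"
    by (rule scheme_approx_sub[OF value_operator_matrix_game_value game_value_dynamic_programming refl t01(3) \<epsilon> \<gamma>])
  then show "candidate matrix_game_value g t1 t0 T1 B \<kappa> \<epsilon> \<eta> \<gamma> ?S (game_value g q k s)"
    using S bound tail' continuous_on_grid unfolding candidate_def by blast
  have "approx_sub (ham (dual_operator matrix_game_value) (\<lambda>i j w. - g i j w) q k) ?S t0 \<epsilon> \<eta> \<gamma> (\<lambda>x. - game_value g q k s x)"
    by (rule scheme_approx_sub[OF value_operator_dual_operator[OF value_operator_matrix_game_value]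
          game_value_dynamic_programming_dual refl t01(3) \<epsilon> \<gamma>])
  then show "candidate (dual_operator matrix_game_value) (\<lambda>i j w. - g i j w) t1 t0 T1 B \<kappa> \<epsilon> \<eta> \<gamma>
      ?S (\<lambda>x. - game_value g q k s x)"
    using S bound tail' continuous_on_minus[OF continuous_on_grid] unfolding candidate_def abs_minus_cancel by blast
qed

end

section \<open>Existence of the limit\<close>

text \<open>A finite \<open>T\<close> must be approached without being reached: the remaining time
  shrinks by the factor \<open>1 - c\<close> at each stage, so the first stage is the longest. For
  infinite \<open>T\<close> equal stages do. Such partitions supply the discretisations from which
  facts about the limit are read off.\<close>

lemma partition_exists:
  assumes T: "0 < T" and \<delta>: "0 < \<delta>"
  shows "\<exists>s. partition_of T s \<and> mesh s < ereal \<delta>"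
proof (cases T)
  case (real r)
  with T have r: "0 < r" by simp
  define c where "c = min (1 / 2) (\<delta> / (2 * r))"
  have c: "0 < c" "c \<le> 1 / 2" "r * c \<le> \<delta> / 2"
    using r \<delta> by (auto simp: c_def min_def field_simps)
  define s where "s n = r * (1 - (1 - c) ^ n)" for n
  have dur: "duration s n = r * c * (1 - c) ^ n" for n
    by (simp add: duration_def s_def algebra_simps)
  have pos: "0 < (1 - c) ^ n" and le1: "(1 - c) ^ n \<le> 1" for n
    using c by (auto intro: power_le_one)
  have "s n < s (Suc n)" for n
  proof -
    have "0 < duration s n" using dur[of n] pos[of n] r c(1) by simp
    then show ?thesis by (simp add: duration_def)
  qed
  then have "strict_mono s" by (simp add: strict_mono_Suc_iff)
  moreover have "s \<longlonglongrightarrow> r * (1 - 0)"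
    unfolding s_def using c by (intro tendsto_intros LIMSEQ_realpow_zero) auto
  then have "(\<lambda>n. ereal (s n)) \<longlonglongrightarrow> T" by (simp add: real)
  ultimately have "partition_of T s" by (simp add: partition_of_def s_def)
  moreover have "mesh s \<le> ereal (\<delta> / 2)"
    unfolding mesh_def
  proof (rule SUP_least)
    fix n
    have "r * c * (1 - c) ^ n \<le> r * c * 1" using le1[of n] r c by (intro mult_left_mono) auto
    then show "ereal (duration s n) \<le> ereal (\<delta> / 2)" using c by (simp add: dur)
  qed
  ultimately show ?thesis using \<delta> by (intro exI[of _ s]) (auto intro: le_less_trans)
next
  case PInf
  define s where "s n = real n * (\<delta> / 2)" for n
  have "strict_mono s" using \<delta> by (simp add: strict_mono_Suc_iff s_def)
  moreover have "filterlim s at_top sequentially"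
    unfolding s_def using \<delta> by (intro filterlim_at_top_mult_tendsto_pos[where c = "\<delta> / 2"] filterlim_real_sequentially) auto
  then have "(\<lambda>n. ereal (s n)) \<longlonglongrightarrow> T"
    unfolding PInf by (simp add: tendsto_PInfty_eq_at_top)
  ultimately have "partition_of T s" by (simp add: partition_of_def s_def)
  moreover have "mesh s \<le> ereal (\<delta> / 2)"
    unfolding mesh_def by (rule SUP_least) (simp add: duration_def s_def algebra_simps)
  ultimately show ?thesis using \<delta> by (intro exI[of _ s]) (auto intro: le_less_trans)
qed (use T in simp)

context fine_partition
begin

lemma abs_game_value_le_tail:
  assumes "T1 + \<delta> \<le> t" "0 \<le> T1" "ereal t < T" "p \<in> prob_simplex"
    and tail: "\<And>a b. T1 \<le> a \<Longrightarrow> ereal b < T \<Longrightarrow> integral {a..b} k \<le> e"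
  shows "\<bar>game_value g q k s (t, p)\<bar> \<le> payoff_const * (e + \<delta> * k 0) + value_speed * \<delta>"
proof -
  have "0 \<le> t" using assms(1,2) \<delta>_pos by linarith
  then obtain n where n: "s n \<le> t" "t < s (Suc n)" using locate assms(3) by blast
  have "T1 \<le> s n" using n(2) duration_less[of n] assms(1) by (simp add: duration_def)
  then show ?thesis
    using game_value_near_grid[OF n assms(4)] abs_stage_value_le_tail[OF assms(4) _ tail] by fastforce
qed

end

section \<open>Choice of the constants and the Cauchy estimate\<close>

context continuous_game
begin

lemma fine_partitionI:
  "partition_of T s \<Longrightarrow> mesh s < ereal \<delta> \<Longrightarrow> \<delta> \<le> 1 \<Longrightarrow> fine_partition T k q s \<delta>"
  by (intro fine_partition.intro fine_partition_axioms.intro continuous_game_axioms)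

lemma intermediate_times:
  assumes "ereal T1 < T" "ereal tm < T"
  obtains T1' t0 t1 where "T1 \<le> T1'" "tm \<le> T1'" "T1' < t0" "t0 < t1" "ereal t1 < T"
proof -
  have "ereal (max T1 tm) < T" using assms by (simp add: max_def)
  then obtain t1 where t1: "ereal (max T1 tm) < ereal t1" "ereal t1 < T" using ereal_dense2 by blast
  then show ?thesis using that[of "max T1 tm" "(max T1 tm + t1) / 2" t1] by simp
qed

text \<open>If the tail integral and \<open>\<delta> * k 0\<close> are both at most this number, the
  tail weight is at most twice it, and the values there are bounded by \<kappa>.\<close>

definition "tail_level \<kappa> = \<kappa> / (2 * (payoff_const + 1))"

lemma tail_level_pos: "0 < \<kappa> \<Longrightarrow> 0 < tail_level \<kappa>"
  using payoff_const_nonneg by (simp add: tail_level_def)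

lemma choose_mesh:
  assumes pos: "0 < \<kappa>" "0 < \<epsilon>" "0 < \<gamma>" "0 < d" "0 < e"
  obtains \<delta> where "0 < \<delta>" "\<delta> \<le> 1" "\<delta> \<le> d" "payoff_const * (tail_level \<kappa> + \<delta> * k 0) \<le> \<kappa>"
    "\<delta> * (kernel_const\<^sup>2 + 1) / (2 * \<epsilon>) \<le> \<gamma>" "value_speed * \<delta> \<le> e" "\<delta>\<^sup>2 / (2 * \<epsilon>) \<le> e"
proof -
  let ?e1 = "tail_level \<kappa>"
  \<comment> \<open>The entries after \<open>1\<close> and \<open>d\<close> serve, in this order,
    the tail bound, the consistency error, the distance of a value from its grid value, and the
    squared offset of two grids. The last one uses
    \<open>\<delta>\<^sup>2 \<le> \<delta>\<close>.\<close>
  define \<delta> where "\<delta> = Min {1, d, ?e1 / (k 0 + 1), \<gamma> * (2 * \<epsilon>) / (kernel_const\<^sup>2 + 1), e / (value_speed + 1), \<epsilon> * e * 2}"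
  have KC: "0 < kernel_const\<^sup>2 + 1" by (simp add: add_nonneg_pos)
  have \<delta>_pos: "0 < \<delta>"
    unfolding \<delta>_def using tail_level_pos[OF pos(1)] k0_nonneg pos KC value_speed_nonneg by (subst Min_gr_iff) auto
  have \<delta>: "\<delta> \<le> 1" "\<delta> \<le> d" "\<delta> \<le> ?e1 / (k 0 + 1)" "\<delta> \<le> \<gamma> * (2 * \<epsilon>) / (kernel_const\<^sup>2 + 1)"
    "\<delta> \<le> e / (value_speed + 1)" "\<delta> \<le> \<epsilon> * e * 2"
    unfolding \<delta>_def by (rule Min_le; simp)+
  have "payoff_const * (?e1 + \<delta> * k 0) \<le> \<kappa>"
  proof -
    have "\<delta> * (k 0 + 1) \<le> ?e1" using \<delta>(3) k0_nonneg by (simp add: pos_le_divide_eq)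
    then have "?e1 + \<delta> * k 0 \<le> 2 * ?e1" using \<delta>_pos by (simp add: algebra_simps)
    then have "payoff_const * (?e1 + \<delta> * k 0) \<le> (payoff_const + 1) * (2 * ?e1)"
      using payoff_const_nonneg \<delta>_pos tail_level_pos[OF pos(1)] k0_nonneg by (intro mult_mono) auto
    also have "\<dots> = \<kappa>"
    proof -
      have "c * (2 * (\<kappa> / (2 * c))) = \<kappa>" if "c \<noteq> 0" for c :: real using that by simp
      then show ?thesis using payoff_const_nonneg by (simp only: tail_level_def)
    qed
    finally show ?thesis .
  qed
  moreover have "\<delta> * (kernel_const\<^sup>2 + 1) / (2 * \<epsilon>) \<le> \<gamma>"
    using \<delta>(4) KC pos by (simp add: pos_le_divide_eq pos_divide_le_eq)
  moreover have "value_speed * \<delta> \<le> e"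
  proof -
    have "\<delta> * (value_speed + 1) \<le> e"
      using pos_le_divide_eq[THEN iffD1, OF _ \<delta>(5)] value_speed_nonneg by linarith
    moreover have "\<delta> * (value_speed + 1) = value_speed * \<delta> + \<delta>"
      by (simp add: algebra_simps)
    ultimately show ?thesis using \<delta>_pos by linarith
  qed
  moreover have "\<delta>\<^sup>2 / (2 * \<epsilon>) \<le> e"
  proof -
    have "\<delta>\<^sup>2 \<le> \<delta>" using \<delta>(1) \<delta>_pos by (simp add: power2_eq_square mult_left_le)
    then have "\<delta>\<^sup>2 \<le> e * (2 * \<epsilon>)" using \<delta>(6) by (simp add: mult_ac)
    then show ?thesis using pos by (simp add: pos_divide_le_eq)
  qed
  ultimately show ?thesis
    using that[OF \<delta>_pos \<delta>(1,2)] by blast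
qed

text \<open>Accounting in eighths of \<open>e\<close>: moving each of the two values to its own grid
  costs one, the tails \<open>2 * \<kappa>\<close> cost two, the tilt one, and the offset of the two
  grid points one.\<close>

lemma game_value_cauchy:
  assumes e: "0 < e"
  obtains \<delta> where "0 < \<delta>" "\<And>s s' t p. partition_of T s \<Longrightarrow> mesh s < ereal \<delta> \<Longrightarrow> partition_of T s' \<Longrightarrow> mesh s' < ereal \<delta> \<Longrightarrow>
      0 \<le> t \<Longrightarrow> ereal t < T \<Longrightarrow> p \<in> prob_simplex \<Longrightarrow> game_value g q k s (t, p) - game_value g q k s' (t, p) \<le> e"
proof -
  define \<kappa> where "\<kappa> = e / 8"
  define e1 where "e1 = tail_level \<kappa>"
  have \<kappa>: "0 < \<kappa>" using e by (simp add: \<kappa>_def)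
  have e1: "0 < e1" using tail_level_pos[OF \<kappa>] by (simp add: e1_def)
  obtain T0 where T0: "0 \<le> T0" "ereal T0 < T" "\<And>a b. T0 \<le> a \<Longrightarrow> ereal b < T \<Longrightarrow> integral {a..b} k \<le> e1"
    using integral_k_tail_uniform[OF e1] by blast
  obtain T1 t0 t1 where t01: "T0 \<le> T1" "T1 < t0" "t0 < t1" "ereal t1 < T"
    using intermediate_times[OF T0(2) T0(2)] by metis
  have tail: "integral {a..b} k \<le> e1" if "T1 \<le> a" "ereal b < T" for a b
    using T0(3) t01(1) that by simp
  have T1: "0 \<le> T1" using T0(1) t01(1) by simp
  have e8: "0 < e / 8" using e by simp
  obtain \<epsilon> \<eta> \<gamma> where pos: "0 < \<epsilon>" "0 < \<eta>" "0 < \<gamma>" and comparison: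
    "\<And>S R u w t t' p.
       candidate matrix_game_value g t1 t0 T1 value_bound \<kappa> \<epsilon> \<eta> \<gamma> S u \<Longrightarrow>
       candidate (dual_operator matrix_game_value) (\<lambda>i j w. - g i j w) t1 t0 T1 value_bound \<kappa> \<epsilon> 0 \<gamma> R (\<lambda>x. - w x) \<Longrightarrow>
       (\<forall>t\<in>S. \<forall>p\<in>prob_simplex. \<forall>p'\<in>prob_simplex. u (t, p) - u (t, p') \<le> value_lip * norm (p - p')) \<or>
       (\<forall>t\<in>R. \<forall>p\<in>prob_simplex. \<forall>p'\<in>prob_simplex. w (t, p) - w (t, p') \<le> value_lip * norm (p - p')) \<Longrightarrow>
       t \<in> S \<Longrightarrow> t' \<in> R \<Longrightarrow> p \<in> prob_simplex \<Longrightarrow>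
       u (t, p) - w (t', p) \<le> 2 * \<kappa> + e / 8 + (t - t')\<^sup>2 / (2 * \<epsilon>)"
    using candidate_comparison[OF value_operator_matrix_game_value T1 t01(2-4) value_bound_nonneg value_lip_pos less_imp_le[OF \<kappa>] e8]
    by blast
  have "0 < min (t1 - t0) (t0 - T1)" using t01 by simp
  then obtain \<delta> where \<delta>_pos: "0 < \<delta>" and \<delta>: "\<delta> \<le> 1" "\<delta> \<le> min (t1 - t0) (t0 - T1)"
    and \<delta>k: "payoff_const * (e1 + \<delta> * k 0) \<le> \<kappa>" and \<delta>\<gamma>: "\<delta> * (kernel_const\<^sup>2 + 1) / (2 * \<epsilon>) \<le> \<gamma>"
    and \<delta>v: "value_speed * \<delta> \<le> e / 8" and \<delta>2: "\<delta>\<^sup>2 / (2 * \<epsilon>) \<le> e / 8"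
    using choose_mesh[OF \<kappa> pos(1,3) _ e8] unfolding e1_def by metis
  show ?thesis
  proof (rule that[OF \<delta>_pos])
    fix s s' t and p :: "real ^ 'w"
    assume s: "partition_of T s" "mesh s < ereal \<delta>" and s': "partition_of T s'" "mesh s' < ereal \<delta>"
      and t: "0 \<le> t" "ereal t < T" and p: "p \<in> prob_simplex"
    interpret A: fine_partition T k g q s \<delta> by (rule fine_partitionI[OF s \<delta>(1)])
    interpret B: fine_partition T k g q s' \<delta> by (rule fine_partitionI[OF s' \<delta>(1)])
    show "game_value g q k s (t, p) - game_value g q k s' (t, p) \<le> e"
    proof (cases "t \<le> t1")
      \<comment> \<open>At late times both values are at most \<open>\<kappa> + e / 8\<close> in
        absolute value. The room \<delta> after \<open>T1\<close> ensures that the grid point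
        preceding \<open>t\<close> is late as well.\<close>
      case False
      then have "T1 + \<delta> \<le> t" using t01 \<delta>(2) by simp
      then show ?thesis
        using A.abs_game_value_le_tail[OF _ T1 t(2) p tail] B.abs_game_value_le_tail[OF _ T1 t(2) p tail] \<delta>k \<delta>v e
        unfolding \<kappa>_def by fastforce
    next
      case True
      obtain n where n: "s n \<le> t" "t < s (Suc n)" using A.locate t by blast
      obtain m where m: "s' m \<le> t" "t < s' (Suc m)" using B.locate t by blast
      have "\<bar>s n - s' m\<bar> \<le> \<delta>"
        using n m A.duration_less[of n] B.duration_less[of m] by (simp add: duration_def)
      then have "(s n - s' m)\<^sup>2 \<le> \<delta>\<^sup>2"
        using \<delta>_pos by (simp add: abs_le_square_iff[symmetric])
      then have "(s n - s' m)\<^sup>2 / (2 * \<epsilon>) \<le> e / 8"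
        using \<delta>2 pos by (intro order_trans[OF divide_right_mono \<delta>2]) auto
      moreover have "game_value g q k s (s n, p) - game_value g q k s' (s' m, p) \<le> 2 * \<kappa> + e / 8 + (s n - s' m)\<^sup>2 / (2 * \<epsilon>)"
      proof (rule comparison)
        show "candidate matrix_game_value g t1 t0 T1 value_bound \<kappa> \<epsilon> \<eta> \<gamma> (range s \<inter> {..t1}) (game_value g q k s)"
          using \<delta>(2) by (intro A.game_value_candidate[OF T1 t01(2) _ t01(4) tail \<delta>k order_refl pos(1) \<delta>\<gamma>]) auto
        show "candidate (dual_operator matrix_game_value) (\<lambda>i j w. - g i j w) t1 t0 T1 value_bound \<kappa> \<epsilon> 0 \<gamma> (range s' \<inter> {..t1})
            (\<lambda>x. - game_value g q k s' x)"
          using \<delta>(2) by (intro B.game_value_candidate[OF T1 t01(2) _ t01(4) tail \<delta>k order_refl pos(1) \<delta>\<gamma>]) auto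
        show "(\<forall>t\<in>range s \<inter> {..t1}. \<forall>p\<in>prob_simplex. \<forall>p'\<in>prob_simplex.
            game_value g q k s (t, p) - game_value g q k s (t, p') \<le> value_lip * norm (p - p')) \<or>
          (\<forall>t\<in>range s' \<inter> {..t1}. \<forall>p\<in>prob_simplex. \<forall>p'\<in>prob_simplex.
            game_value g q k s' (t, p) - game_value g q k s' (t, p') \<le> value_lip * norm (p - p'))"
          using A.stage_value_lipschitz by (auto simp: A.game_value_grid)
      qed (use n m True p in auto)
      ultimately show ?thesis
        using A.game_value_near_grid[OF n p] B.game_value_near_grid[OF m p] \<delta>v e
        by (simp add: A.game_value_grid B.game_value_grid \<kappa>_def)
    qed
  qed
qed

text \<open>The family \<open>U\<close> is left arbitrary so that the notion also covers the negated
  values that enter through duality.\<close>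

definition is_limit :: "((nat \<Rightarrow> real) \<Rightarrow> real \<times> (real ^ 'w) \<Rightarrow> real) \<Rightarrow> (real \<times> (real ^ 'w) \<Rightarrow> real) \<Rightarrow> bool" where
  "is_limit U v \<longleftrightarrow> (\<forall>e>0. \<exists>\<delta>>0. \<forall>s. partition_of T s \<longrightarrow> mesh s < ereal \<delta> \<longrightarrow>
     (\<forall>x\<in>time_domain T \<times> prob_simplex. \<bar>U s x - v x\<bar> \<le> e))"

lemma is_limitE:
  assumes "is_limit U v" "0 < e" "0 < d"
  obtains \<delta> where "0 < \<delta>" "\<delta> \<le> d"
    "\<And>s x. partition_of T s \<Longrightarrow> mesh s < ereal \<delta> \<Longrightarrow> x \<in> time_domain T \<times> prob_simplex \<Longrightarrow> \<bar>U s x - v x\<bar> \<le> e"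
proof -
  from assms(1)[unfolded is_limit_def, rule_format, OF assms(2)]
  obtain \<delta> where \<delta>: "0 < \<delta>" "\<forall>s. partition_of T s \<longrightarrow> mesh s < ereal \<delta> \<longrightarrow>
     (\<forall>x\<in>time_domain T \<times> prob_simplex. \<bar>U s x - v x\<bar> \<le> e)" by blast
  show ?thesis
  proof (rule that)
    show "0 < min \<delta> d" "min \<delta> d \<le> d" using \<delta>(1) assms(3) by simp_all
    fix s and x :: "real \<times> (real ^ 'w)" assume *: "partition_of T s" "mesh s < ereal (min \<delta> d)" "x \<in> time_domain T \<times> prob_simplex"
    have "mesh s < ereal \<delta>" using *(2) by (rule less_le_trans) simp
    then show "\<bar>U s x - v x\<bar> \<le> e" using \<delta>(2) *(1,3) by blast
  qed
qed

lemma limit_exists: "\<exists>v. is_limit (game_value g q k) v"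
proof -
  let ?D = "time_domain T \<times> (prob_simplex :: (real ^ 'w) set)"
  \<comment> \<open>The limit is defined along one fixed sequence of partitions; the Cauchy estimate
    then bounds the distance of every fine partition from it.\<close>
  have "\<exists>\<sigma>. \<forall>j. partition_of T (\<sigma> j) \<and> mesh (\<sigma> j) < ereal (inverse (real (Suc j)))"
    using partition_exists[OF T_pos] by (intro choice allI) simp
  then obtain \<sigma> where \<sigma>: "\<And>j. partition_of T (\<sigma> j)" "\<And>j. mesh (\<sigma> j) < ereal (inverse (real (Suc j)))" by blast
  have close: "\<exists>\<delta>>0. (\<forall>s x. partition_of T s \<longrightarrow> mesh s < ereal \<delta> \<longrightarrow> x \<in> ?D \<longrightarrow>
      (\<exists>N. \<forall>j\<ge>N. \<bar>game_value g q k s x - game_value g q k (\<sigma> j) x\<bar> \<le> e)) \<and>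
      (\<forall>x\<in>?D. \<exists>N. \<forall>i\<ge>N. \<forall>j\<ge>N. \<bar>game_value g q k (\<sigma> i) x - game_value g q k (\<sigma> j) x\<bar> \<le> e)" if e: "0 < e" for e
  proof -
    obtain \<delta> where \<delta>: "0 < \<delta>" "\<And>s s' t p. partition_of T s \<Longrightarrow> mesh s < ereal \<delta> \<Longrightarrow> partition_of T s' \<Longrightarrow> mesh s' < ereal \<delta> \<Longrightarrow>
      0 \<le> t \<Longrightarrow> ereal t < T \<Longrightarrow> p \<in> prob_simplex \<Longrightarrow> game_value g q k s (t, p) - game_value g q k s' (t, p) \<le> e"
      using game_value_cauchy[OF e] by metis
    have *: "\<bar>game_value g q k s x - game_value g q k s' x\<bar> \<le> e"
      if "partition_of T s" "mesh s < ereal \<delta>" "partition_of T s'" "mesh s' < ereal \<delta>" "x \<in> ?D" for s s' x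
      using \<delta>(2)[of s s' "fst x" "snd x"] \<delta>(2)[of s' s "fst x" "snd x"] that
      by (auto simp: time_domain_def abs_le_iff)
    obtain N where N: "inverse (real (Suc N)) < \<delta>" using reals_Archimedean \<delta>(1) by blast
    have m: "mesh (\<sigma> j) < ereal \<delta>" if "N \<le> j" for j
    proof -
      have "inverse (real (Suc j)) \<le> inverse (real (Suc N))"
        using that by (intro le_imp_inverse_le) auto
      then show ?thesis using \<sigma>(2)[of j] N by (meson ereal_less_eq(3) less_le_trans less_imp_le order_trans)
    qed
    show ?thesis
      using \<delta>(1) * \<sigma>(1) m by (intro exI[of _ \<delta>] conjI) blast+
  qed
  define v where "v x = lim (\<lambda>j. game_value g q k (\<sigma> j) x)" for x
  have lim: "(\<lambda>j. game_value g q k (\<sigma> j) x) \<longlonglongrightarrow> v x" if "x \<in> ?D" for x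
  proof -
    have "Cauchy (\<lambda>j. game_value g q k (\<sigma> j) x)"
    proof (rule metric_CauchyI)
      fix e :: real assume "0 < e"
      then have "0 < e / 2" by simp
      from close[OF this] that obtain N where N: "\<forall>i\<ge>N. \<forall>j\<ge>N. \<bar>game_value g q k (\<sigma> i) x - game_value g q k (\<sigma> j) x\<bar> \<le> e / 2"
        by blast
      have "dist (game_value g q k (\<sigma> i) x) (game_value g q k (\<sigma> j) x) < e" if "N \<le> i" "N \<le> j" for i j
      proof -
        have "\<bar>game_value g q k (\<sigma> i) x - game_value g q k (\<sigma> j) x\<bar> \<le> e / 2" using N that by blast
        then show ?thesis using \<open>0 < e\<close> by (simp add: dist_real_def)
      qed
      then show "\<exists>N. \<forall>i\<ge>N. \<forall>j\<ge>N. dist (game_value g q k (\<sigma> i) x) (game_value g q k (\<sigma> j) x) < e"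
        by blast
    qed
    then show ?thesis
      unfolding v_def by (simp add: Cauchy_convergent_iff convergent_LIMSEQ_iff)
  qed
  have "\<bar>game_value g q k s x - v x\<bar> \<le> e"
    if "x \<in> ?D" "\<exists>N. \<forall>j\<ge>N. \<bar>game_value g q k s x - game_value g q k (\<sigma> j) x\<bar> \<le> e" for s x e
  proof (rule LIMSEQ_le_const2)
    show "(\<lambda>j. \<bar>game_value g q k s x - game_value g q k (\<sigma> j) x\<bar>) \<longlonglongrightarrow> \<bar>game_value g q k s x - v x\<bar>"
      by (intro tendsto_intros lim that)
  qed (use that in blast)
  then show ?thesis
    unfolding is_limit_def using close by (intro exI[of _ v]) meson
qed

end

section \<open>Viscosity solutions\<close>

lemma terminal_zero_iff:
  fixes u :: "real \<times> (real ^ 'w::finite) \<Rightarrow> real"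
  assumes T: "0 < T"
  shows "terminal_zero T u \<longleftrightarrow>
    (\<forall>e>0. \<exists>T1\<ge>0. ereal T1 < T \<and> (\<forall>t p. T1 \<le> t \<longrightarrow> ereal t < T \<longrightarrow> p \<in> prob_simplex \<longrightarrow> \<bar>u (t, p)\<bar> \<le> e))"
proof
  assume tz: "terminal_zero T u"
  show "\<forall>e>0. \<exists>T1\<ge>0. ereal T1 < T \<and> (\<forall>t p. T1 \<le> t \<longrightarrow> ereal t < T \<longrightarrow> p \<in> prob_simplex \<longrightarrow> \<bar>u (t, p)\<bar> \<le> e)"
  proof (intro allI impI)
    fix e :: real assume "0 < e"
    then have "\<forall>\<^sub>F t in filtercomap ereal (at_left T). \<forall>p\<in>prob_simplex. dist (u (t, p)) 0 < e"
      using tz by (simp add: terminal_zero_def uniform_limit_iff)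
    then obtain Q where Q: "eventually Q (at_left T)" "\<And>t p. Q (ereal t) \<Longrightarrow> p \<in> prob_simplex \<Longrightarrow> dist (u (t, p)) 0 < e"
      unfolding eventually_filtercomap by blast
    from Q(1) obtain b where b: "b < T" "\<And>y. b < y \<Longrightarrow> y < T \<Longrightarrow> Q y"
      unfolding eventually_at_left[OF T] by blast
    have "max 0 b < T" using b(1) T by simp
    then obtain T1 where T1: "max 0 b < ereal T1" "ereal T1 < T" using ereal_dense2 by blast
    have "\<bar>u (t, p)\<bar> \<le> e" if "T1 \<le> t" "ereal t < T" "p \<in> prob_simplex" for t p
    proof -
      have "b < ereal T1" using T1(1) by simp
      also have "ereal T1 \<le> ereal t" using that(1) by simp
      finally show ?thesis using Q(2)[OF b(2)] that by (simp add: less_imp_le)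
    qed
    moreover have "0 \<le> T1"
    proof -
      have "0 < ereal T1" using T1(1) by (rule le_less_trans[rotated]) simp
      then show ?thesis by simp
    qed
    ultimately show "\<exists>T1\<ge>0. ereal T1 < T \<and> (\<forall>t p. T1 \<le> t \<longrightarrow> ereal t < T \<longrightarrow> p \<in> prob_simplex \<longrightarrow> \<bar>u (t, p)\<bar> \<le> e)"
      using T1(2) by blast
  qed
next
  assume r: "\<forall>e>0. \<exists>T1\<ge>0. ereal T1 < T \<and> (\<forall>t p. T1 \<le> t \<longrightarrow> ereal t < T \<longrightarrow> p \<in> prob_simplex \<longrightarrow> \<bar>u (t, p)\<bar> \<le> e)"
  show "terminal_zero T u"
    unfolding terminal_zero_def uniform_limit_iff
  proof (intro allI impI)
    fix e :: real assume "0 < e"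
    then have "0 < e / 2" by simp
    with r obtain T1 where T1: "ereal T1 < T" "\<And>t p. T1 \<le> t \<Longrightarrow> ereal t < T \<Longrightarrow> p \<in> prob_simplex \<Longrightarrow> \<bar>u (t, p)\<bar> \<le> e / 2"
      by blast
    show "\<forall>\<^sub>F t in filtercomap ereal (at_left T). \<forall>p\<in>prob_simplex. dist (u (t, p)) 0 < e"
      unfolding eventually_filtercomap
    proof (intro exI conjI allI impI ballI)
      show "\<forall>\<^sub>F y in at_left T. ereal T1 < y \<and> y < T"
        unfolding eventually_at_left[OF T1(1)] using T1(1) by blast
      fix t p assume "ereal T1 < ereal t \<and> ereal t < T" "p \<in> (prob_simplex :: (real ^ 'w) set)"
      then show "dist (u (t, p)) 0 < e"
        using T1(2)[of t p] \<open>0 < e\<close> by (simp add: dist_real_def)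
    qed
  qed
qed

definition visc_sub ::
  "(real \<times> 'a::euclidean_space) set \<Rightarrow> (real \<Rightarrow> 'a \<Rightarrow> 'a \<Rightarrow> real) \<Rightarrow> (real \<times> 'a \<Rightarrow> real) \<Rightarrow> bool" where
  "visc_sub D H u \<longleftrightarrow> (\<forall>\<psi> dt grad t p. C1_on D \<psi> dt grad \<longrightarrow>
     strict_local_max_on D (\<lambda>x. u x - \<psi> x) (t, p) \<longrightarrow> 0 \<le> dt (t, p) + H t p (grad (t, p)))"

lemma C1_on_minus:
  assumes "C1_on D \<psi> dt grad"
  shows "C1_on D (\<lambda>x. - \<psi> x) (\<lambda>x. - dt x) (\<lambda>x. - grad x)"
proof -
  have "((\<lambda>x. - \<psi> x) has_derivative (\<lambda>(r, d). - dt x * r + - grad x \<bullet> d)) (at x within D)" if "x \<in> D" for x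
  proof -
    have "(\<psi> has_derivative (\<lambda>(r, d). dt x * r + grad x \<bullet> d)) (at x within D)"
      using assms that by (simp add: C1_on_def)
    from has_derivative_minus[OF this] show ?thesis
      by (simp add: case_prod_unfold)
  qed
  then show ?thesis
    using assms by (auto simp: C1_on_def intro!: continuous_on_minus)
qed

lemma viscosity_solution_iff:
  "viscosity_solution D (hamiltonian g q k) u \<longleftrightarrow>
     visc_sub D (ham matrix_game_value g q k) u \<and>
     visc_sub D (ham (dual_operator matrix_game_value) (\<lambda>i j w. - g i j w) q k) (\<lambda>x. - u x)"
    (is "?V \<longleftrightarrow> ?A \<and> ?B")
proof -
  have H: "hamiltonian g q k t p z \<xi> = ham matrix_game_value g q k t p \<xi>" for t p z \<xi>
    by (simp add: hamiltonian_def ham_def)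
  have minmax: "strict_local_max_on D (\<lambda>x. - u x - \<psi> x) y \<longleftrightarrow> strict_local_min_on D (\<lambda>x. u x - - \<psi> x) y" for \<psi> y
  proof -
    have "- u z - \<psi> z < - u y - \<psi> y \<longleftrightarrow> u y - - \<psi> y < u z - - \<psi> z" for z by linarith
    then show ?thesis unfolding strict_local_max_on_def strict_local_min_on_def by (simp only:)
  qed
  have "?B \<longleftrightarrow> (\<forall>\<psi> dt grad t p. C1_on D \<psi> dt grad \<longrightarrow> strict_local_min_on D (\<lambda>x. u x - \<psi> x) (t, p) \<longrightarrow>
      0 \<ge> dt (t, p) + ham matrix_game_value g q k t p (grad (t, p)))" (is "_ \<longleftrightarrow> ?B'")
  proof
    assume B: ?B
    show ?B'
    proof (intro allI impI)
      fix \<psi> dt grad t p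
      assume C: "C1_on D \<psi> dt grad" and m: "strict_local_min_on D (\<lambda>x. u x - \<psi> x) (t, p)"
      have "strict_local_max_on D (\<lambda>x. - u x - - \<psi> x) (t, p)" unfolding minmax using m by simp
      with B C1_on_minus[OF C] have "0 \<le> - dt (t, p) + ham (dual_operator matrix_game_value) (\<lambda>i j w. - g i j w) q k t p (- grad (t, p))"
        unfolding visc_sub_def by blast
      then show "0 \<ge> dt (t, p) + ham matrix_game_value g q k t p (grad (t, p))" by (simp add: ham_dual)
    qed
  next
    assume B': ?B'
    show ?B
      unfolding visc_sub_def
    proof (intro allI impI)
      fix \<psi> dt grad t p
      assume C: "C1_on D \<psi> dt grad" and m: "strict_local_max_on D (\<lambda>x. - u x - \<psi> x) (t, p)"
      from B' C1_on_minus[OF C] m[unfolded minmax]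
      have "0 \<ge> - dt (t, p) + ham matrix_game_value g q k t p (- grad (t, p))" by blast
      then show "0 \<le> dt (t, p) + ham (dual_operator matrix_game_value) (\<lambda>i j w. - g i j w) q k t p (grad (t, p))"
        by (simp add: ham_dual)
    qed
  qed
  moreover have "?A \<longleftrightarrow> (\<forall>\<psi> dt grad t p. C1_on D \<psi> dt grad \<longrightarrow> strict_local_max_on D (\<lambda>x. u x - \<psi> x) (t, p) \<longrightarrow>
      0 \<le> dt (t, p) + ham matrix_game_value g q k t p (grad (t, p)))"
    by (simp add: visc_sub_def)
  ultimately show ?thesis
    unfolding viscosity_solution_def H by blast
qed

text \<open>The two added squares, centred at time \<open>d\<close> and belief \<open>c\<close>,
  turn a maximum at that point into a strict one, while their derivatives vanish there.\<close>

lemma has_derivative_penalty: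
  fixes a c :: "'a::euclidean_space"
  assumes "\<epsilon> \<noteq> 0"
  shows "((\<lambda>x. penalty \<epsilon> \<eta> a b (fst x) (snd x) + (norm (snd x - c))\<^sup>2 + (fst x - d)\<^sup>2) has_derivative
     (\<lambda>(r, v). ((fst x - b) / \<epsilon> - \<eta> + 2 * (fst x - d)) * r +
        ((1 / \<epsilon>) *\<^sub>R (snd x - a) + 2 *\<^sub>R (snd x - c)) \<bullet> v)) (at x within D)"
proof -
  have N: "((\<lambda>x. (norm (snd x - e))\<^sup>2) has_derivative (\<lambda>y. 2 * ((snd x - e) \<bullet> snd y))) (at x within D)"
    for e :: 'a
    unfolding power2_norm_eq_inner
    by (auto intro!: derivative_eq_intros simp: fun_eq_iff inner_commute)
  have S: "((\<lambda>x. (fst x - e)\<^sup>2) has_derivative (\<lambda>y. 2 * (fst x - e) * fst y)) (at x within D)" for e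
    by (auto intro!: derivative_eq_intros simp: fun_eq_iff)
  have "((\<lambda>x. (1 / (2 * \<epsilon>)) * (norm (snd x - a))\<^sup>2 + (1 / (2 * \<epsilon>)) * (fst x - b)\<^sup>2 - \<eta> * fst x +
      (norm (snd x - c))\<^sup>2 + (fst x - d)\<^sup>2) has_derivative
      (\<lambda>y. (1 / (2 * \<epsilon>)) * (2 * ((snd x - a) \<bullet> snd y)) + (1 / (2 * \<epsilon>)) * (2 * (fst x - b) * fst y) - \<eta> * fst y +
      2 * ((snd x - c) \<bullet> snd y) + 2 * (fst x - d) * fst y)) (at x within D)"
    by (intro has_derivative_add has_derivative_diff has_derivative_mult_right N S has_derivative_fst has_derivative_ident)
  also have "(\<lambda>y. (1 / (2 * \<epsilon>)) * (2 * ((snd x - a) \<bullet> snd y)) + (1 / (2 * \<epsilon>)) * (2 * (fst x - b) * fst y) - \<eta> * fst y +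
      2 * ((snd x - c) \<bullet> snd y) + 2 * (fst x - d) * fst y) = (\<lambda>(r, v). ((fst x - b) / \<epsilon> - \<eta> + 2 * (fst x - d)) * r +
        ((1 / \<epsilon>) *\<^sub>R (snd x - a) + 2 *\<^sub>R (snd x - c)) \<bullet> v)"
  proof -
    have "(1 / (2 * \<epsilon>)) * (2 * X) + (1 / (2 * \<epsilon>)) * (2 * Y * r) - \<eta> * r + 2 * Z + 2 * W * r =
       (Y / \<epsilon> - \<eta> + 2 * W) * r + ((1 / \<epsilon>) * X + 2 * Z)" for X Y Z W r :: real
      using assms by (simp add: field_simps)
    then show ?thesis
      by (simp only: fun_eq_iff case_prod_unfold inner_add_left inner_scaleR_left simp_thms)
  qed
  finally show ?thesis by (simp add: penalty_def)
qed

lemma C1_on_penalty: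
  fixes a c :: "'a::euclidean_space"
  assumes "\<epsilon> \<noteq> 0"
  shows "C1_on D (\<lambda>x. penalty \<epsilon> \<eta> a b (fst x) (snd x) + (norm (snd x - c))\<^sup>2 + (fst x - d)\<^sup>2)
    (\<lambda>x. (fst x - b) / \<epsilon> - \<eta> + 2 * (fst x - d))
    (\<lambda>x. (1 / \<epsilon>) *\<^sub>R (snd x - a) + 2 *\<^sub>R (snd x - c))"
  unfolding C1_on_def using assms
  by (intro conjI ballI has_derivative_penalty continuous_intros)

text \<open>Because \<open>t \<le> t0 < t1\<close>, the interval \<open>[0, t1]\<close> contains a
  neighbourhood of \<open>t\<close> in the time domain. A global maximum over the truncated domain
  is therefore a local one on the full domain.\<close>

lemma visc_sub_imp_approx_sub:
  fixes u :: "real \<times> (real ^ 'w::finite) \<Rightarrow> real"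
  assumes visc: "visc_sub (time_domain T \<times> prob_simplex) H u"
    and t01: "t0 < t1" "ereal t1 < T" and \<epsilon>: "0 < \<epsilon>" and \<gamma>: "0 \<le> \<gamma>"
  shows "approx_sub H {0..t1} t0 \<epsilon> \<eta> \<gamma> u"
  unfolding approx_sub_def
proof (intro ballI allI impI)
  fix t b and p a :: "real ^ 'w"
  let ?D = "time_domain T \<times> (prob_simplex :: (real ^ 'w) set)"
  assume t: "t \<in> {0..t1}" "t \<le> t0" and p: "p \<in> prob_simplex"
    and max: "\<forall>t'\<in>{0..t1}. \<forall>p'\<in>prob_simplex.
           u (t', p') - penalty \<epsilon> \<eta> a b t' p' \<le> u (t, p) - penalty \<epsilon> \<eta> a b t p"
  let ?\<psi> = "\<lambda>x. penalty \<epsilon> \<eta> a b (fst x) (snd x) + (norm (snd x - p))\<^sup>2 + (fst x - t)\<^sup>2"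
  have "ereal t < T"
    using t t01 by (meson ereal_less_eq(3) le_less_trans less_imp_le order_trans)
  then have D: "(t, p) \<in> ?D" using t p by (simp add: time_domain_def)
  have "\<forall>\<^sub>F x in at (t, p) within ?D. fst x < t1"
    using t t01 by (intro order_tendstoD(2)[of fst "t"]) (auto intro!: tendsto_eq_intros)
  moreover have "\<forall>\<^sub>F x in at (t, p) within ?D. x \<in> ?D \<and> x \<noteq> (t, p)"
    by (auto simp: eventually_at_filter)
  ultimately have "\<forall>\<^sub>F x in at (t, p) within ?D. u x - ?\<psi> x < u (t, p) - ?\<psi> (t, p)"
  proof eventually_elim
    case (elim x)
    obtain t' p' where x: "x = (t', p')" by (cases x)
    have "0 < (norm (p' - p))\<^sup>2 + (t' - t)\<^sup>2"
      using elim by (cases "p' = p") (auto simp: x add_pos_nonneg)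
    moreover have "u (t', p') - penalty \<epsilon> \<eta> a b t' p' \<le> u (t, p) - penalty \<epsilon> \<eta> a b t p"
      using max elim by (auto simp: x time_domain_def)
    ultimately show ?case by (simp add: x)
  qed
  then have "strict_local_max_on ?D (\<lambda>x. u x - ?\<psi> x) (t, p)"
    using D by (simp add: strict_local_max_on_def)
  then have "0 \<le> ((t - b) / \<epsilon> - \<eta> + 2 * (t - t)) + H t p ((1 / \<epsilon>) *\<^sub>R (p - a) + 2 *\<^sub>R (p - p))"
    using visc C1_on_penalty[of \<epsilon> ?D \<eta> a b p t] \<epsilon> unfolding visc_sub_def by fastforce
  then show "0 \<le> (t - b) / \<epsilon> - \<eta> + H t p ((1 / \<epsilon>) *\<^sub>R (p - a)) + \<gamma>"
    using \<gamma> by simp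
qed

text \<open>The base point of a step varies with the partition, so differentiability at one point is
  too weak. The mean value form moves the derivatives to a point of the segment, where their
  continuity at the limit point controls them.\<close>

lemma C1_on_increment:
  fixes \<psi> :: "real \<times> 'a::euclidean_space \<Rightarrow> real"
  assumes C: "C1_on D \<psi> dt grad" and D: "convex D" and x: "(t, p) \<in> D" "(t + h, p + h *\<^sub>R d) \<in> D"
  obtains r where "r \<in> {0..1}" "(t + r * h, p + (r * h) *\<^sub>R d) \<in> D"
    "\<psi> (t + h, p + h *\<^sub>R d) - \<psi> (t, p) =
      h * (dt (t + r * h, p + (r * h) *\<^sub>R d) + grad (t + r * h, p + (r * h) *\<^sub>R d) \<bullet> d)"
proof -
  let ?z = "\<lambda>r. (t + r * h, p + (r * h) *\<^sub>R d)"
  have z: "?z r \<in> D" if "r \<in> {0..1}" for r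
  proof -
    have "(1 - r) *\<^sub>R (t, p) + r *\<^sub>R (t + h, p + h *\<^sub>R d) \<in> D"
      using that x by (intro convexD[OF D]) auto
    also have "(1 - r) *\<^sub>R (t, p) + r *\<^sub>R (t + h, p + h *\<^sub>R d) = ?z r"
      by (simp add: algebra_simps)
    finally show ?thesis .
  qed
  have "((\<lambda>r. \<psi> (?z r)) has_derivative (\<lambda>v. dt (?z r) * (v * h) + grad (?z r) \<bullet> ((v * h) *\<^sub>R d))) (at r within {0..1})"
    if r: "r \<in> {0..1}" for r
  proof -
    have "(?z has_derivative (\<lambda>v. (v * h, (v * h) *\<^sub>R d))) (at r within {0..1})"
      by (auto intro!: derivative_eq_intros)
    moreover have "(\<psi> has_derivative (\<lambda>(r', d). dt (?z r) * r' + grad (?z r) \<bullet> d)) (at (?z r) within ?z ` {0..1})"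
    proof (rule has_derivative_subset)
      show "(\<psi> has_derivative (\<lambda>(r', d). dt (?z r) * r' + grad (?z r) \<bullet> d)) (at (?z r) within D)"
        using C z[OF r] unfolding C1_on_def by blast
      show "?z ` {0..1} \<subseteq> D" using z by blast
    qed
    ultimately have "(\<psi> \<circ> ?z has_derivative (\<lambda>(r', d). dt (?z r) * r' + grad (?z r) \<bullet> d) \<circ> (\<lambda>v. (v * h, (v * h) *\<^sub>R d))) (at r within {0..1})"
      by (rule diff_chain_within)
    then show ?thesis by (simp add: o_def)
  qed
  then have "\<exists>r\<in>{0..1}. \<psi> (?z 1) - \<psi> (?z 0) = dt (?z r) * ((1 - 0) * h) + grad (?z r) \<bullet> (((1 - 0) * h) *\<^sub>R d)"
    by (intro mvt_very_simple) auto
  then obtain r where "r \<in> {0..1}" "\<psi> (?z 1) - \<psi> (?z 0) = dt (?z r) * ((1 - 0) * h) + grad (?z r) \<bullet> (((1 - 0) * h) *\<^sub>R d)" by blast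
  then show ?thesis
    using z[of r] by (intro that[of r]) (auto simp: distrib_left)
qed

section \<open>Properties of the limit and uniqueness\<close>

lemma convex_prob_simplex: "convex (prob_simplex :: (real ^ 'w::finite) set)"
  by (rule convexI) (auto simp: prob_simplex_def sum.distrib simp flip: sum_distrib_left)

lemma convex_time_domain: "convex (time_domain T)"
proof -
  have "is_interval (time_domain T)"
    unfolding is_interval_1 time_domain_def by (auto intro: le_less_trans[of "ereal _" "ereal _"])
  then show ?thesis by (rule is_interval_convex)
qed

lemma dist_Pair_le: "dist (a, b) (c, d) \<le> dist a c + dist b d"
  by (simp add: dist_Pair_Pair sqrt_sum_squares_le_sum)

context fine_partition
begin

lemma continuous_on_grid_minus:
  "continuous_on ((range s \<inter> {..t1}) \<times> prob_simplex) (\<lambda>x. - game_value g q k s x)"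
  by (intro continuous_on_minus continuous_on_grid)

end

section \<open>Regularity, terminal behaviour and identification of the limit\<close>

context continuous_game
begin

lemma limit_lipschitz:
  assumes lim: "is_limit (game_value g q k) v"
    and t: "0 \<le> t" "ereal t < T" "0 \<le> t'" "ereal t' < T" and p: "p \<in> prob_simplex" "p' \<in> prob_simplex"
  shows "\<bar>v (t, p) - v (t', p')\<bar> \<le> value_speed * \<bar>t - t'\<bar> + value_lip * norm (p - p')"
proof (rule field_le_epsilon)
  fix e :: real assume e: "0 < e"
  \<comment> \<open>Two approximations of \<open>v\<close> cost \<open>e / 4\<close> each; the
    second bound keeps the mesh term \<open>3 * value_speed * \<delta>\<close> below the remaining
    \<open>e / 2\<close>.\<close>
  have "0 < e / 4" "0 < min 1 (e / (8 * (value_speed + 1)))"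
    using e value_speed_nonneg by auto
  then obtain \<delta> where \<delta>: "0 < \<delta>" "\<delta> \<le> min 1 (e / (8 * (value_speed + 1)))"
    "\<And>s x. partition_of T s \<Longrightarrow> mesh s < ereal \<delta> \<Longrightarrow> x \<in> time_domain T \<times> prob_simplex \<Longrightarrow> \<bar>game_value g q k s x - v x\<bar> \<le> e / 4"
    using is_limitE[OF lim] by metis
  obtain s where s: "partition_of T s" "mesh s < ereal \<delta>" using partition_exists[OF T_pos \<delta>(1)] by blast
  interpret A: fine_partition T k g q s \<delta> using fine_partitionI[OF s] \<delta>(2) by simp
  have "\<delta> * (8 * (value_speed + 1)) \<le> e"
    using \<delta>(2) value_speed_nonneg by (simp add: pos_le_divide_eq)
  moreover have "\<delta> * (8 * (value_speed + 1)) = 8 * (value_speed * \<delta>) + 8 * \<delta>" by (simp add: algebra_simps)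
  ultimately have "3 * value_speed * \<delta> \<le> e / 2"
    using \<delta>(1) mult_nonneg_nonneg[OF value_speed_nonneg less_imp_le[OF \<delta>(1)]] by linarith
  moreover have "\<bar>game_value g q k s (t, p) - v (t, p)\<bar> \<le> e / 4" "\<bar>game_value g q k s (t', p') - v (t', p')\<bar> \<le> e / 4"
    using \<delta>(3)[OF s] t p by (auto simp: time_domain_def)
  ultimately show "\<bar>v (t, p) - v (t', p')\<bar> \<le> value_speed * \<bar>t - t'\<bar> + value_lip * norm (p - p') + e"
    using A.game_value_almost_lipschitz[OF t p] by linarith
qed

lemma limit_continuous:
  assumes "is_limit (game_value g q k) v"
  shows "continuous_on (time_domain T \<times> prob_simplex) v"
proof -
  have "\<bar>v (t, p) - v (t', p')\<bar> \<le> (value_speed + value_lip) * dist (t, p) (t', p')"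
    if "0 \<le> t" "ereal t < T" "0 \<le> t'" "ereal t' < T" "p \<in> prob_simplex" "p' \<in> prob_simplex" for t t' p p'
  proof -
    have "\<bar>t - t'\<bar> \<le> dist (t, p) (t', p')" "norm (p - p') \<le> dist (t, p) (t', p')"
      using dist_fst_le[of "(t, p)" "(t', p')"] dist_snd_le[of "(t, p)" "(t', p')"]
      by (auto simp: dist_norm)
    then have "value_speed * \<bar>t - t'\<bar> + value_lip * norm (p - p') \<le> (value_speed + value_lip) * dist (t, p) (t', p')"
      using value_speed_nonneg value_lip_pos by (simp add: distrib_right add_mono mult_left_mono)
    then show ?thesis using limit_lipschitz[OF assms that] by linarith
  qed
  then have "(value_speed + value_lip)-lipschitz_on (time_domain T \<times> prob_simplex) v"
    using value_speed_nonneg value_lip_pos by (intro lipschitz_onI) (auto simp: dist_real_def time_domain_def)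
  then show ?thesis by (rule lipschitz_on_continuous_on)
qed

lemma limit_terminal_zero:
  assumes lim: "is_limit (game_value g q k) v"
  shows "terminal_zero T v"
  unfolding terminal_zero_iff[OF T_pos]
proof (intro allI impI)
  fix e :: real assume e: "0 < e"
  define \<kappa> where "\<kappa> = e / 4"
  have \<kappa>: "0 < \<kappa>" using e by (simp add: \<kappa>_def)
  obtain T0 where T0: "0 \<le> T0" "ereal T0 < T" "\<And>a b. T0 \<le> a \<Longrightarrow> ereal b < T \<Longrightarrow> integral {a..b} k \<le> tail_level \<kappa>"
    using integral_k_tail_uniform[OF tail_level_pos[OF \<kappa>]] by blast
  obtain T0' t0 T1 where "T0 \<le> T0'" "T0' < t0" "t0 < T1" "ereal T1 < T"
    using intermediate_times[OF T0(2) T0(2)] by metis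
  then have T1: "T0 < T1" "ereal T1 < T" by auto
  have "0 < T1 - T0" using T1 by simp
  from choose_mesh[OF \<kappa> zero_less_one zero_less_one this \<kappa>]
  obtain d where d: "0 < d" "d \<le> 1" "d \<le> T1 - T0" "payoff_const * (tail_level \<kappa> + d * k 0) \<le> \<kappa>"
      "d * (kernel_const\<^sup>2 + 1) / (2 * 1) \<le> 1" "value_speed * d \<le> \<kappa>" "d\<^sup>2 / (2 * 1) \<le> \<kappa>"
    by metis
  from is_limitE[OF lim \<kappa> d(1)]
  obtain \<delta> where \<delta>: "0 < \<delta>" "\<delta> \<le> d"
    "\<And>s x. partition_of T s \<Longrightarrow> mesh s < ereal \<delta> \<Longrightarrow> x \<in> time_domain T \<times> prob_simplex \<Longrightarrow> \<bar>game_value g q k s x - v x\<bar> \<le> \<kappa>"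
    by metis
  obtain s where s: "partition_of T s" "mesh s < ereal \<delta>" using partition_exists[OF T_pos \<delta>(1)] by blast
  have "mesh s < ereal d" using s(2) by (rule less_le_trans) (simp add: \<delta>(2))
  then interpret A: fine_partition T k g q s d using fine_partitionI[OF s(1)] d(2) by simp
  have "\<bar>v (t, p)\<bar> \<le> e" if "T1 \<le> t" "ereal t < T" "p \<in> prob_simplex" for t p
  proof -
    have t: "T0 + d \<le> t" "0 \<le> t" using that T1 T0(1) d(3) by auto
    have "\<bar>game_value g q k s (t, p) - v (t, p)\<bar> \<le> \<kappa>"
      using \<delta>(3)[OF s] that t by (auto simp: time_domain_def)
    then show ?thesis
      using A.abs_game_value_le_tail[OF t(1) T0(1) that(2,3) T0(3)] d(4,6) e unfolding \<kappa>_def by linarith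
  qed
  then show "\<exists>T1\<ge>0. ereal T1 < T \<and> (\<forall>t p. T1 \<le> t \<longrightarrow> ereal t < T \<longrightarrow> p \<in> prob_simplex \<longrightarrow> \<bar>v (t, p)\<bar> \<le> e)"
    using T1 T0(1) by (intro exI[of _ T1]) auto
qed

lemma visc_sub_candidate:
  assumes "visc_sub (time_domain T \<times> prob_simplex) (ham F f q k) u"
    and "continuous_on (time_domain T \<times> prob_simplex) u"
    and "t0 < t1" "ereal t1 < T" "0 < \<epsilon>" "0 \<le> \<gamma>"
    and "\<And>t p. t \<in> {0..t1} \<Longrightarrow> p \<in> prob_simplex \<Longrightarrow> \<bar>u (t, p)\<bar> \<le> B"
    and "\<And>t p. t \<in> {0..t1} \<Longrightarrow> T1 \<le> t \<Longrightarrow> p \<in> prob_simplex \<Longrightarrow> \<bar>u (t, p)\<bar> \<le> \<kappa>"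
  shows "candidate F f t1 t0 T1 B \<kappa> \<epsilon> \<eta> \<gamma> {0..t1} u"
proof -
  have "{0..t1} \<times> prob_simplex \<subseteq> time_domain T \<times> (prob_simplex :: (real ^ 'w) set)"
    using assms(4) by (auto simp: time_domain_def intro: le_less_trans[of "ereal _" "ereal t1"])
  then have "continuous_on ({0..t1} \<times> prob_simplex) u"
    using assms(2) continuous_on_subset by blast
  moreover have "approx_sub (ham F f q k) {0..t1} t0 \<epsilon> \<eta> \<gamma> u"
    by (rule visc_sub_imp_approx_sub[OF assms(1,3-6)])
  ultimately show ?thesis
    using assms(7,8) by (simp add: candidate_def)
qed

text \<open>Both inequalities compare \<open>u\<close> with one fine discretisation, whose Lipschitz
  bound fills the disjunction in the comparison lemma, so continuity of \<open>u\<close> suffices.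
  In eighths of \<open>e\<close>: two for the tails, one each for tilt, time offset, grid value and
  distance to \<open>v\<close>.\<close>

lemma viscosity_solution_eq_limit:
  assumes lim: "is_limit (game_value g q k) v"
    and cont: "continuous_on (time_domain T \<times> prob_simplex) u" and tz: "terminal_zero T u"
    and sol: "viscosity_solution (time_domain T \<times> prob_simplex) (hamiltonian g q k) u"
    and t: "0 \<le> t" "ereal t < T" and p: "p \<in> prob_simplex"
  shows "u (t, p) = v (t, p)"
proof -
  have "\<bar>u (t, p) - v (t, p)\<bar> \<le> 0 + e" if e: "0 < e" for e
  proof -
    define \<kappa> where "\<kappa> = e / 8"
    have \<kappa>: "0 < \<kappa>" using e by (simp add: \<kappa>_def)
    have e8: "0 < e / 8" using e by simp
    obtain T0 where T0: "0 \<le> T0" "ereal T0 < T" "\<And>a b. T0 \<le> a \<Longrightarrow> ereal b < T \<Longrightarrow> integral {a..b} k \<le> tail_level \<kappa>"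
      using integral_k_tail_uniform[OF tail_level_pos[OF \<kappa>]] by blast
    obtain Tu where Tu: "0 \<le> Tu" "ereal Tu < T" "\<And>t p. Tu \<le> t \<Longrightarrow> ereal t < T \<Longrightarrow> p \<in> prob_simplex \<Longrightarrow> \<bar>u (t, p)\<bar> \<le> \<kappa>"
      using tz \<kappa> unfolding terminal_zero_iff[OF T_pos] by metis
    have m: "ereal (max T0 Tu) < T" using T0(2) Tu(2) by (simp add: max_def)
    obtain T1 t0 t1 where t01: "max T0 Tu \<le> T1" "t \<le> T1" "T1 < t0" "t0 < t1" "ereal t1 < T"
      using intermediate_times[OF m t(2)] by metis
    have T1: "0 \<le> T1" using T0(1) t01(1) by simp
    have tail: "integral {a..b} k \<le> tail_level \<kappa>" if "T1 \<le> a" "ereal b < T" for a b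
      using T0(3) t01(1) that by simp
    have sub: "{0..t1} \<times> prob_simplex \<subseteq> time_domain T \<times> (prob_simplex :: (real ^ 'w) set)"
      using t01(5) by (auto simp: time_domain_def intro: le_less_trans[of "ereal _" "ereal t1"])
    have "compact (u ` ({0..t1} \<times> prob_simplex))"
      by (intro compact_continuous_image continuous_on_subset[OF cont sub] compact_Times compact_prob_simplex) auto
    from compact_imp_bounded[OF this] obtain Bu where "\<forall>y\<in>u ` ({0..t1} \<times> prob_simplex). norm y \<le> Bu"
      unfolding bounded_iff by blast
    then have Bu: "\<bar>u x\<bar> \<le> Bu" if "x \<in> {0..t1} \<times> prob_simplex" for x
    proof -
      have "u x \<in> u ` ({0..t1} \<times> prob_simplex)" using that by (rule imageI)
      with \<open>\<forall>y\<in>u ` ({0..t1} \<times> prob_simplex). norm y \<le> Bu\<close> have "norm (u x) \<le> Bu" by (rule bspec)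
      then show ?thesis by simp
    qed
    \<comment> \<open>The comparison asks for one bound valid for both functions; for
      \<open>u\<close> it comes from compactness of the truncated domain.\<close>
    define B where "B = max value_bound Bu"
    have B: "value_bound \<le> B" "0 \<le> B" using value_bound_nonneg by (auto simp: B_def)
    have u_bound: "\<bar>u (t, p)\<bar> \<le> B" if "t \<in> {0..t1}" "p \<in> prob_simplex" for t p
      using Bu[of "(t, p)"] that by (simp add: B_def)
    have u_tail: "\<bar>u (t, p)\<bar> \<le> \<kappa>" if "t \<in> {0..t1}" "T1 \<le> t" "p \<in> prob_simplex" for t p
    proof -
      have "ereal t \<le> ereal t1" using that by simp
      then have "ereal t < T" using t01(5) by (rule le_less_trans)
      then show ?thesis using Tu(3) that t01(1) by simp
    qed
    obtain \<epsilon> \<eta> \<gamma> where pos: "0 < \<epsilon>" "0 < \<eta>" "0 < \<gamma>" and comparison: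
      "\<And>S R u w t t' p.
         candidate matrix_game_value g t1 t0 T1 B \<kappa> \<epsilon> \<eta> \<gamma> S u \<Longrightarrow>
         candidate (dual_operator matrix_game_value) (\<lambda>i j w. - g i j w) t1 t0 T1 B \<kappa> \<epsilon> 0 \<gamma> R (\<lambda>x. - w x) \<Longrightarrow>
         (\<forall>t\<in>S. \<forall>p\<in>prob_simplex. \<forall>p'\<in>prob_simplex. u (t, p) - u (t, p') \<le> value_lip * norm (p - p')) \<or>
         (\<forall>t\<in>R. \<forall>p\<in>prob_simplex. \<forall>p'\<in>prob_simplex. w (t, p) - w (t, p') \<le> value_lip * norm (p - p')) \<Longrightarrow>
         t \<in> S \<Longrightarrow> t' \<in> R \<Longrightarrow> p \<in> prob_simplex \<Longrightarrow>
         u (t, p) - w (t', p) \<le> 2 * \<kappa> + e / 8 + (t - t')\<^sup>2 / (2 * \<epsilon>)"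
      using candidate_comparison[OF value_operator_matrix_game_value T1 t01(3-5) B(2) value_lip_pos less_imp_le[OF \<kappa>] e8]
      by blast
    have "0 < t1 - t0" using t01 by simp
    from choose_mesh[OF \<kappa> pos(1,3) this e8]
    obtain \<delta> where \<delta>: "0 < \<delta>" "\<delta> \<le> 1" "\<delta> \<le> t1 - t0" "payoff_const * (tail_level \<kappa> + \<delta> * k 0) \<le> \<kappa>"
      "\<delta> * (kernel_const\<^sup>2 + 1) / (2 * \<epsilon>) \<le> \<gamma>" "value_speed * \<delta> \<le> e / 8" "\<delta>\<^sup>2 / (2 * \<epsilon>) \<le> e / 8"
      by metis
    from is_limitE[OF lim e8 \<delta>(1)]
    obtain \<delta>' where \<delta>': "0 < \<delta>'" "\<delta>' \<le> \<delta>"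
      "\<And>s x. partition_of T s \<Longrightarrow> mesh s < ereal \<delta>' \<Longrightarrow> x \<in> time_domain T \<times> prob_simplex \<Longrightarrow> \<bar>game_value g q k s x - v x\<bar> \<le> e / 8"
      by metis
    obtain s where s: "partition_of T s" "mesh s < ereal \<delta>'" using partition_exists[OF T_pos \<delta>'(1)] by blast
    have "mesh s < ereal \<delta>" using s(2) by (rule less_le_trans) (simp add: \<delta>'(2))
    then interpret A: fine_partition T k g q s \<delta> using fine_partitionI[OF s(1)] \<delta>(2) by simp
    obtain n where n: "s n \<le> t" "t < s (Suc n)" using A.locate t by blast
    have S: "t \<in> {0..t1}" "s n \<in> range s \<inter> {..t1}" using t n t01 by auto
    have t0\<delta>: "t0 + \<delta> \<le> t1" using \<delta>(3) by simp
    have cand: "candidate matrix_game_value g t1 t0 T1 B \<kappa> \<epsilon> \<eta> \<gamma> (range s \<inter> {..t1}) (game_value g q k s)"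
      by (rule A.game_value_candidate(1)[OF T1 t01(3) t0\<delta> t01(5) _ \<delta>(4) B(1) pos(1) \<delta>(5)]) (rule tail)
    have cand': "candidate (dual_operator matrix_game_value) (\<lambda>i j w. - g i j w) t1 t0 T1 B \<kappa> \<epsilon> 0 \<gamma>
        (range s \<inter> {..t1}) (\<lambda>x. - game_value g q k s x)"
      by (rule A.game_value_candidate(2)[OF T1 t01(3) t0\<delta> t01(5) _ \<delta>(4) B(1) pos(1) \<delta>(5)]) (rule tail)
    have lip: "\<forall>t\<in>range s \<inter> {..t1}. \<forall>p\<in>prob_simplex. \<forall>p'\<in>prob_simplex.
        game_value g q k s (t, p) - game_value g q k s (t, p') \<le> value_lip * norm (p - p')"
      using A.stage_value_lipschitz by (auto simp: A.game_value_grid)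
    have sols: "visc_sub (time_domain T \<times> prob_simplex) (ham matrix_game_value g q k) u"
      "visc_sub (time_domain T \<times> prob_simplex) (ham (dual_operator matrix_game_value) (\<lambda>i j w. - g i j w) q k) (\<lambda>x. - u x)"
      using sol unfolding viscosity_solution_iff by auto
    have "u (t, p) - game_value g q k s (s n, p) \<le> 2 * \<kappa> + e / 8 + (t - s n)\<^sup>2 / (2 * \<epsilon>)"
    proof (rule comparison[OF _ cand' disjI2[OF lip] S p])
      show "candidate matrix_game_value g t1 t0 T1 B \<kappa> \<epsilon> \<eta> \<gamma> {0..t1} u"
        using pos u_bound u_tail by (intro visc_sub_candidate[OF sols(1) cont t01(4,5)]) auto
    qed
    moreover have "game_value g q k s (s n, p) - u (t, p) \<le> 2 * \<kappa> + e / 8 + (s n - t)\<^sup>2 / (2 * \<epsilon>)"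
    proof (rule comparison[OF cand _ disjI1[OF lip] S(2,1) p])
      show "candidate (dual_operator matrix_game_value) (\<lambda>i j w. - g i j w) t1 t0 T1 B \<kappa> \<epsilon> 0 \<gamma> {0..t1} (\<lambda>x. - u x)"
        using pos u_bound u_tail by (intro visc_sub_candidate[OF sols(2) continuous_on_minus[OF cont] t01(4,5)]) auto
    qed
    moreover have "(t - s n)\<^sup>2 / (2 * \<epsilon>) \<le> e / 8" "(s n - t)\<^sup>2 / (2 * \<epsilon>) \<le> e / 8"
    proof -
      have "\<bar>t - s n\<bar> \<le> \<delta>" using n A.duration_less[of n] by (simp add: duration_def)
      then have "(t - s n)\<^sup>2 \<le> \<delta>\<^sup>2" using \<delta>(1) by (simp add: abs_le_square_iff[symmetric])
      then show "(t - s n)\<^sup>2 / (2 * \<epsilon>) \<le> e / 8" using pos by (intro order_trans[OF divide_right_mono \<delta>(7)]) auto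
      then show "(s n - t)\<^sup>2 / (2 * \<epsilon>) \<le> e / 8" by (simp only: power2_commute)
    qed
    moreover have "\<bar>game_value g q k s (t, p) - game_value g q k s (s n, p)\<bar> \<le> e / 8"
      using A.game_value_near_grid[OF n p] \<delta>(6) by (simp add: A.game_value_grid)
    moreover have "\<bar>game_value g q k s (t, p) - v (t, p)\<bar> \<le> e / 8"
      using \<delta>'(3)[OF s] t p by (simp add: time_domain_def)
    ultimately show ?thesis using e unfolding \<kappa>_def by linarith
  qed
  then have "\<bar>u (t, p) - v (t, p)\<bar> \<le> 0" by (rule field_le_epsilon)
  then show ?thesis by simp
qed

end

section \<open>Stability\<close>

context continuous_game
begin

text \<open>\<open>U\<close> is the value, or its negative together with the dual operator, so both
  halves of the viscosity property follow from this lemma. Instead of a sequence of maxima, one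
  sufficiently fine partition is used for each error \<open>e\<close>.\<close>

lemma visc_sub_limit:
  fixes U :: "(nat \<Rightarrow> real) \<Rightarrow> real \<times> (real ^ 'w) \<Rightarrow> real"
  assumes F: "value_operator F"
    and dp: "\<And>s \<delta> n p. partition_of T s \<Longrightarrow> mesh s < ereal \<delta> \<Longrightarrow> \<delta> \<le> 1 \<Longrightarrow> p \<in> prob_simplex \<Longrightarrow>
      U s (s n, p) = F (\<lambda>i j. duration s n * (k (s n) * (\<Sum>w\<in>UNIV. p $ w * g i j w)) +
        U s (s (Suc n), p + duration s n *\<^sub>R (p v* q i j)))"
    and cont_U: "\<And>s \<delta> t1. partition_of T s \<Longrightarrow> mesh s < ereal \<delta> \<Longrightarrow> \<delta> \<le> 1 \<Longrightarrow>
      continuous_on ((range s \<inter> {..t1}) \<times> prob_simplex) (U s)"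
    and lim: "is_limit U v"
    and cont: "continuous_on (time_domain T \<times> prob_simplex) v"
  shows "visc_sub (time_domain T \<times> prob_simplex) (ham F g q k) v"
  unfolding visc_sub_def
proof (intro allI impI)
  let ?D = "time_domain T \<times> (prob_simplex :: (real ^ 'w) set)"
  fix \<psi> dt grad tb and pb :: "real ^ 'w"
  assume C1: "C1_on ?D \<psi> dt grad" and max: "strict_local_max_on ?D (\<lambda>x. v x - \<psi> x) (tb, pb)"
  let ?x = "(tb, pb)"
  define A where "A = dt ?x"
  define \<xi> where "\<xi> = grad ?x"
  define \<phi> where "\<phi> x = v x - \<psi> x" for x
  have x: "?x \<in> ?D" using max by (simp add: strict_local_max_on_def)
  then have tb: "0 \<le> tb" "ereal tb < T" and pb: "pb \<in> prob_simplex" by (auto simp: time_domain_def)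
  have cont_dt: "continuous_on ?D dt" and cont_grad: "continuous_on ?D grad"
    using C1 by (auto simp: C1_on_def)
  have cont_\<psi>: "continuous_on ?D \<psi>"
  proof (rule has_derivative_continuous_on)
    show "(\<psi> has_derivative (\<lambda>(r, d). dt y * r + grad y \<bullet> d)) (at y within ?D)" if "y \<in> ?D" for y
      using C1 that unfolding C1_on_def by blast
  qed
  have cont_\<phi>: "continuous_on ?D \<phi>"
    unfolding \<phi>_def by (intro continuous_on_diff cont cont_\<psi>)
  have convD: "convex ?D" by (intro convex_Times convex_time_domain convex_prob_simplex)
  show "0 \<le> dt ?x + ham F g q k tb pb (grad ?x)"
    unfolding A_def[symmetric] \<xi>_def[symmetric]
  proof (rule field_le_epsilon)
    fix e :: real assume e: "0 < e"
    \<comment> \<open>The one-step inequality costs \<open>e1 * (1 + kernel_const)\<close>, namely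
      \<open>e1\<close> for the time derivative and the rest for the gradient along the drift;
      moving the Hamiltonian to \<open>(tb, pb)\<close> costs \<open>2 * e1\<close>.\<close>
    define e1 where "e1 = e / (3 + kernel_const)"
    have e1: "0 < e1" using e kernel_const_nonneg by (simp add: e1_def)
    have e1_e: "e1 * (3 + kernel_const) = e" using kernel_const_nonneg by (simp add: e1_def)
    obtain t1 where t1: "tb < t1" "ereal t1 < T"
      using ereal_dense2[OF tb(2)] by auto
    have "continuous_on ?D (\<lambda>y. k (fst y))"
      by (rule continuous_on_compose2[OF k_continuous]) (auto simp: time_domain_def intro!: continuous_intros)
    then have "((\<lambda>y. k (fst y) * payoff_const) \<longlongrightarrow> k tb * payoff_const) (at ?x within ?D)"
      using x by (auto simp: continuous_on_def intro!: tendsto_eq_intros)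
    then have "\<forall>\<^sub>F y in at ?x within ?D. dist (k (fst y) * payoff_const) (k tb * payoff_const) < e1"
      using e1 by (rule tendstoD)
    moreover have "\<forall>\<^sub>F y in at ?x within ?D. dist (dt y) A < e1"
      using cont_dt x e1 unfolding A_def continuous_on_def by (intro tendstoD) auto
    moreover have "\<forall>\<^sub>F y in at ?x within ?D. dist (grad y) \<xi> < e1"
      using cont_grad x e1 unfolding \<xi>_def continuous_on_def by (intro tendstoD) auto
    moreover have "\<forall>\<^sub>F y in at ?x within ?D. \<phi> y < \<phi> ?x"
      using max by (simp add: strict_local_max_on_def \<phi>_def)
    ultimately have "\<forall>\<^sub>F y in at ?x within ?D. dist (k (fst y) * payoff_const) (k tb * payoff_const) < e1 \<and>
        dist (dt y) A < e1 \<and> dist (grad y) \<xi> < e1 \<and> \<phi> y < \<phi> ?x"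
      by eventually_elim simp
    then obtain r0 where r0: "0 < r0" "\<And>y. y \<in> ?D \<Longrightarrow> y \<noteq> ?x \<Longrightarrow> dist y ?x < r0 \<Longrightarrow>
        dist (k (fst y) * payoff_const) (k tb * payoff_const) < e1 \<and>
        dist (dt y) A < e1 \<and> dist (grad y) \<xi> < e1 \<and> \<phi> y < \<phi> ?x"
      unfolding eventually_at by blast
    \<comment> \<open>The coefficient of \<open>norm (p - pb)\<close> in \<open>ham_diff_le\<close>;
      the radius \<open>r\<close> makes this term at most \<open>e1\<close>.\<close>
    define c0 where "c0 = k 0 * payoff_const + kernel_const * norm \<xi>"
    have c0: "0 \<le> c0" using k0_nonneg payoff_const_nonneg kernel_const_nonneg by (simp add: c0_def)
    define r where "r = min (r0 / 2) (min (t1 - tb) (e1 / (c0 + 1)))"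
    have r: "0 < r" "r < r0" "r \<le> t1 - tb" "r \<le> e1 / (c0 + 1)"
    proof -
      have "0 < e1 / (c0 + 1)" using e1 c0 by (intro divide_pos_pos) auto
      then show "0 < r" using r0(1) t1(1) by (simp add: r_def)
      have "r \<le> r0 / 2" unfolding r_def by (rule min.cobounded1)
      then show "r < r0" using r0(1) by linarith
    qed (simp_all add: r_def)
    have c0r: "c0 * r \<le> e1"
    proof -
      have "r * (c0 + 1) \<le> e1" using r(4) c0 by (simp add: pos_le_divide_eq)
      then show ?thesis using r(1) by (simp add: algebra_simps)
    qed
    have near: "\<bar>k (fst y) - k tb\<bar> * payoff_const \<le> e1" "dt y \<le> A + e1" "norm (grad y - \<xi>) \<le> e1"
      if "y \<in> ?D" "dist y ?x \<le> r" for y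
    proof -
      have "dist (k (fst y) * payoff_const) (k tb * payoff_const) \<le> e1 \<and> dist (dt y) A \<le> e1 \<and> dist (grad y) \<xi> \<le> e1"
      proof (cases "y = ?x")
        case True
        then show ?thesis using e1 by (simp add: A_def \<xi>_def)
      next
        case False
        then show ?thesis using r0(2)[OF that(1)] that(2) r(2) by (simp add: less_imp_le)
      qed
      moreover have "dist (k (fst y) * payoff_const) (k tb * payoff_const) = \<bar>k (fst y) - k tb\<bar> * payoff_const"
        using payoff_const_nonneg by (simp add: dist_real_def abs_mult flip: left_diff_distrib)
      ultimately show "\<bar>k (fst y) - k tb\<bar> * payoff_const \<le> e1" "dt y \<le> A + e1" "norm (grad y - \<xi>) \<le> e1"
        by (auto simp: dist_real_def dist_norm abs_le_iff)
    qed
    have sub: "{0..t1} \<times> prob_simplex \<subseteq> ?D"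
      using t1(2) by (auto simp: time_domain_def intro: le_less_trans[of "ereal _" "ereal t1"])
    \<comment> \<open>Compactness turns strictness into a gap: on the closed shell between the radii
      \<open>r / 2\<close> and \<open>r\<close> the function \<phi> stays below some
      \<open>\<mu>\<close> less than its value at the centre.\<close>
    define R where "R = ({0..t1} \<times> prob_simplex) \<inter> {y. r / 2 \<le> dist y ?x} \<inter> cball ?x r"
    have R_D: "R \<subseteq> ?D" using sub by (auto simp: R_def)
    have "compact R"
      unfolding R_def
      by (intro compact_Int_closed compact_Times compact_prob_simplex closed_Collect_le continuous_intros) auto
    have "\<exists>\<mu><\<phi> ?x. \<forall>y\<in>R. \<phi> y \<le> \<mu>"
    proof (cases "R = {}")
      case True
      then show ?thesis by (intro exI[of _ "\<phi> ?x - 1"]) auto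
    next
      case False
      then obtain z where z: "z \<in> R" "\<And>y. y \<in> R \<Longrightarrow> \<phi> y \<le> \<phi> z"
        using continuous_attains_sup[OF \<open>compact R\<close> _ continuous_on_subset[OF cont_\<phi> R_D]] by blast
      have "\<phi> z < \<phi> ?x"
      proof -
        have "r / 2 \<le> dist z ?x" "dist z ?x \<le> r" using z(1) by (auto simp: R_def dist_commute)
        then have "z \<noteq> ?x" "dist z ?x < r0" using r(1,2) by auto
        then show ?thesis using r0(2) z(1) R_D by blast
      qed
      then show ?thesis using z(2) by blast
    qed
    then obtain \<mu> where \<mu>: "\<mu> < \<phi> ?x" "\<And>y. y \<in> R \<Longrightarrow> \<phi> y \<le> \<mu>" by blast
    \<comment> \<open>A quarter of the gap. Passing to the grid point before \<open>tb\<close> loses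
      less than \<open>c\<close>, exchanging \<open>U s\<close> and \<open>v\<close> at two points
      at most \<open>2 * c\<close>; so at the grid maximum \<phi> still exceeds \<mu>, which keeps
      that point off the shell.\<close>
    define c where "c = (\<phi> ?x - \<mu>) / 4"
    have c: "0 < c" using \<mu>(1) by (simp add: c_def)
    obtain d where d: "0 < d" "\<And>y. y \<in> ?D \<Longrightarrow> dist y ?x < d \<Longrightarrow> dist (\<phi> y) (\<phi> ?x) < c"
      using cont_\<phi> x c unfolding continuous_on_iff by blast
    \<comment> \<open>\<open>d / 2\<close> puts the grid point preceding \<open>tb\<close> where
      \<phi> is within \<open>c\<close> of its maximum; the last entry bounds the joint move of time
      and belief in one step by \<open>r / 2\<close>.\<close>
    define \<delta>0 where "\<delta>0 = min 1 (min (d / 2) (r / (2 * (1 + kernel_const))))"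
    have \<delta>0: "0 < \<delta>0" "\<delta>0 \<le> 1" "\<delta>0 < d" "\<delta>0 \<le> r / (2 * (1 + kernel_const))"
    proof -
      have "0 < r / (2 * (1 + kernel_const))" using r(1) kernel_const_nonneg by (intro divide_pos_pos) auto
      then show "0 < \<delta>0" using d(1) by (simp add: \<delta>0_def)
      have "\<delta>0 \<le> d / 2" unfolding \<delta>0_def by (rule min.coboundedI2[OF min.cobounded1])
      then show "\<delta>0 < d" using d(1) by linarith
    qed (simp_all add: \<delta>0_def)
    from is_limitE[OF lim c \<delta>0(1)]
    obtain \<delta> where \<delta>: "0 < \<delta>" "\<delta> \<le> \<delta>0"
      "\<And>s x. partition_of T s \<Longrightarrow> mesh s < ereal \<delta> \<Longrightarrow> x \<in> time_domain T \<times> prob_simplex \<Longrightarrow> \<bar>U s x - v x\<bar> \<le> c"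
      by metis
    have \<delta>r: "\<delta> * (1 + kernel_const) \<le> r / 2"
    proof -
      have "\<delta> \<le> r / (2 * (1 + kernel_const))" using \<delta>(2) \<delta>0(4) by simp
      then have "\<delta> * (2 * (1 + kernel_const)) \<le> r" using kernel_const_nonneg by (simp add: pos_le_divide_eq)
      then show ?thesis by (simp add: algebra_simps)
    qed
    have \<delta>_le_r: "\<delta> \<le> r / 2"
      using \<delta>r mult_nonneg_nonneg[OF less_imp_le[OF \<delta>(1)] kernel_const_nonneg] by (simp add: algebra_simps)
    obtain s where s: "partition_of T s" "mesh s < ereal \<delta>" using partition_exists[OF T_pos \<delta>(1)] by blast
    have \<delta>1: "\<delta> \<le> 1" using \<delta>(2) \<delta>0(2) by simp
    interpret P: fine_partition T k g q s \<delta> by (rule fine_partitionI[OF s \<delta>1])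
    define K where "K = ((range s \<inter> {..t1}) \<times> prob_simplex) \<inter> cball ?x r"
    have K_sub: "K \<subseteq> (range s \<inter> {..t1}) \<times> prob_simplex" by (auto simp: K_def)
    have "(range s \<inter> {..t1}) \<times> prob_simplex \<subseteq> {0..t1} \<times> (prob_simplex :: (real ^ 'w) set)"
      using P.s_nonneg by auto
    then have K_D: "K \<subseteq> ?D" using K_sub sub by blast
    have K: "compact K"
      unfolding K_def
      by (intro compact_Int_closed compact_Times compact_prob_simplex finite_imp_compact P.finite_grid t1(2)) auto
    obtain n where n: "s n \<le> tb" "tb < s (Suc n)" using P.locate tb by blast
    have n\<delta>: "dist (s n, pb) ?x \<le> \<delta>"
      using dist_Pair_le[of "s n" pb tb pb] n P.duration_less[of n] by (simp add: dist_real_def duration_def)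
    then have y0: "(s n, pb) \<in> K"
      using n(1) t1(1) pb \<delta>_le_r r(1) by (auto simp: K_def dist_commute)
    have "continuous_on K (\<lambda>y. U s y - \<psi> y)"
      by (intro continuous_on_diff continuous_on_subset[OF cont_U[OF s \<delta>1] K_sub] continuous_on_subset[OF cont_\<psi> K_D])
    then obtain y where y: "y \<in> K" "\<And>z. z \<in> K \<Longrightarrow> U s z - \<psi> z \<le> U s y - \<psi> y"
      using continuous_attains_sup[OF K] y0 by blast
    obtain m p where y_eq: "y = (s m, p)" and p: "p \<in> prob_simplex"
      using y(1) by (auto simp: K_def)
    have U_v: "\<bar>U s z - v z\<bar> \<le> c" if "z \<in> K" for z
      using \<delta>(3)[OF s] K_D that by blast
    have "dist (\<phi> (s n, pb)) (\<phi> ?x) < c"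
      using d(2)[of "(s n, pb)"] y0 K_D n\<delta> \<delta>(2) \<delta>0(3) by auto
    then have "\<phi> ?x - c < \<phi> (s n, pb)" by (simp add: dist_real_def abs_less_iff)
    then have "\<phi> ?x - 3 * c < \<phi> y"
      using y(2)[OF y0] U_v[OF y0] U_v[OF y(1)] unfolding \<phi>_def by linarith
    moreover have "\<mu> = \<phi> ?x - 4 * c" by (simp add: c_def field_simps)
    ultimately have "y \<notin> R" using \<mu>(2)[of y] c by auto
    moreover have "y \<in> {0..t1} \<times> prob_simplex" "y \<in> cball ?x r"
      using y(1) P.s_nonneg by (auto simp: K_def)
    ultimately have y_near: "dist y ?x < r / 2"
      by (auto simp: R_def)
    let ?h = "duration s m" and ?d = "\<lambda>i j. p v* q i j"
    \<comment> \<open>The maximum lies within \<open>r / 2\<close> of the centre, so the whole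
      segment of a step stays in the ball on which the derivatives of \<psi> are controlled;
      \<open>a = 1\<close> gives the successor itself.\<close>
    have moved: "dist (s m + a * ?h, p + (a * ?h) *\<^sub>R ?d i j) ?x \<le> r" if a: "a \<in> {0..1}" for a i j
    proof -
      have ah: "0 \<le> a * ?h" "a * ?h \<le> \<delta>"
        using a P.duration_pos[of m] P.duration_less[of m] mult_mono[of a 1 ?h \<delta>] by auto
      have "dist (s m + a * ?h, p + (a * ?h) *\<^sub>R ?d i j) (s m, p) \<le> \<bar>a * ?h\<bar> + norm ((a * ?h) *\<^sub>R ?d i j)"
        using dist_Pair_le[of "s m + a * ?h" "p + (a * ?h) *\<^sub>R ?d i j" "s m" p] by (simp add: dist_norm)
      also have "\<dots> = a * ?h * (1 + norm (?d i j))" using ah by (simp add: algebra_simps)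
      also have "\<dots> \<le> \<delta> * (1 + kernel_const)"
        using ah norm_drift_simplex_le[OF p, of i j] \<delta>(1) by (intro mult_mono) auto
      finally show ?thesis
        using \<delta>r y_near dist_triangle[of "(s m + a * ?h, p + (a * ?h) *\<^sub>R ?d i j)" ?x "(s m, p)"]
        unfolding y_eq by linarith
    qed
    have "0 \<le> A + F (\<lambda>i j. k (s m) * (\<Sum>w\<in>UNIV. p $ w * g i j w) + ?d i j \<bullet> \<xi>) + e1 * (1 + kernel_const)"
    proof (rule one_step_inequality[OF F P.duration_pos dp[OF s \<delta>1 p]])
      fix i j
      let ?y' = "(s (Suc m), p + ?h *\<^sub>R ?d i j)"
      have y'_near: "dist ?y' ?x \<le> r" using moved[of 1 i j] by (simp add: P.s_Suc)
      have step: "p + ?h *\<^sub>R ?d i j \<in> prob_simplex" by (rule P.belief_step'[OF p])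
      have "\<bar>s (Suc m) - tb\<bar> \<le> r"
        using y'_near dist_fst_le[of ?y' ?x] by (simp add: dist_real_def)
      then have "s (Suc m) \<le> t1" using r(3) by simp
      then have y'_K: "?y' \<in> K" using step y'_near by (auto simp: K_def dist_commute)
      then have "U s ?y' - U s (s m, p) \<le> \<psi> ?y' - \<psi> (s m, p)"
        using y(2) unfolding y_eq by fastforce
      also have "\<dots> \<le> ?h * (A + ?d i j \<bullet> \<xi> + e1 * (1 + kernel_const))"
      proof -
        have D: "(s m, p) \<in> ?D" "(s m + ?h, p + ?h *\<^sub>R ?d i j) \<in> ?D"
          using y(1) y'_K K_D unfolding y_eq P.s_Suc by auto
        obtain a where a: "a \<in> {0..1}" "(s m + a * ?h, p + (a * ?h) *\<^sub>R ?d i j) \<in> ?D"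
          "\<psi> (s m + ?h, p + ?h *\<^sub>R ?d i j) - \<psi> (s m, p) =
            ?h * (dt (s m + a * ?h, p + (a * ?h) *\<^sub>R ?d i j) + grad (s m + a * ?h, p + (a * ?h) *\<^sub>R ?d i j) \<bullet> ?d i j)"
          using C1_on_increment[OF C1 convD D] by metis
        let ?z = "(s m + a * ?h, p + (a * ?h) *\<^sub>R ?d i j)"
        have "grad ?z \<bullet> ?d i j = ?d i j \<bullet> \<xi> + (grad ?z - \<xi>) \<bullet> ?d i j"
          by (simp add: inner_diff_left inner_commute[of \<xi>])
        also have "(grad ?z - \<xi>) \<bullet> ?d i j \<le> norm (grad ?z - \<xi>) * norm (?d i j)"
          by (rule norm_cauchy_schwarz)
        also have "\<dots> \<le> e1 * kernel_const"
          using near(3)[OF a(2) moved[OF a(1)]] norm_drift_simplex_le[OF p] e1 by (intro mult_mono) auto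
        finally have "dt ?z + grad ?z \<bullet> ?d i j \<le> A + ?d i j \<bullet> \<xi> + e1 * (1 + kernel_const)"
          using near(2)[OF a(2) moved[OF a(1)]] by (simp add: algebra_simps)
        then show ?thesis
          unfolding P.s_Suc a(3) using P.duration_pos[of m] by (intro mult_left_mono) auto
      qed
      finally show "U s ?y' \<le> U s (s m, p) + ?h * (A + ?d i j \<bullet> \<xi> + e1 * (1 + kernel_const))" by simp
    qed
    also have "F (\<lambda>i j. k (s m) * (\<Sum>w\<in>UNIV. p $ w * g i j w) + ?d i j \<bullet> \<xi>) = ham F g q k (s m) p \<xi>"
      by (simp add: ham_def)
    finally have "0 \<le> A + ham F g q k (s m) p \<xi> + e1 * (1 + kernel_const)" .
    moreover have "ham F g q k (s m) p \<xi> \<le> ham F g q k tb pb \<xi> + 2 * e1"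
    proof -
      have y_D: "(s m, p) \<in> ?D" "dist (s m, p) ?x \<le> r"
        using y(1) K_D y_near r(1) unfolding y_eq by auto
      have "norm (p - pb) \<le> r"
        using y_D(2) dist_snd_le[of "(s m, p)" ?x] by (simp add: dist_norm)
      then have "c0 * norm (p - pb) \<le> c0 * r" using c0 by (rule mult_left_mono)
      then have "k 0 * payoff_const * norm (p - pb) + kernel_const * norm (p - pb) * norm \<xi> \<le> e1"
        using c0r by (simp add: c0_def algebra_simps)
      moreover have "\<bar>k (s m) - k tb\<bar> * payoff_const \<le> e1"
        using near(1)[OF y_D] by simp
      ultimately show ?thesis
        using ham_diff_le[OF F p pb tb(1) less_imp_le[OF tb(2)], of "s m" \<xi>] by linarith
    qed
    ultimately show "0 \<le> A + ham F g q k tb pb \<xi> + e"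
      using e1_e by (simp add: algebra_simps)
  qed
qed

lemma is_limit_minus: "is_limit U v \<Longrightarrow> is_limit (\<lambda>s x. - U s x) (\<lambda>x. - v x)"
  by (simp add: is_limit_def abs_minus_commute)

lemma limit_viscosity_solution:
  assumes lim: "is_limit (game_value g q k) v"
  shows "viscosity_solution (time_domain T \<times> prob_simplex) (hamiltonian g q k) v"
  unfolding viscosity_solution_iff
proof
  have P: "fine_partition T k q s \<delta>" if "partition_of T s" "mesh s < ereal \<delta>" "\<delta> \<le> 1" for s \<delta>
    by (rule fine_partitionI[OF that])
  show "visc_sub (time_domain T \<times> prob_simplex) (ham matrix_game_value g q k) v"
    by (rule visc_sub_limit[OF value_operator_matrix_game_value
          fine_partition.game_value_dynamic_programming[OF P] fine_partition.continuous_on_grid[OF P]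
          lim limit_continuous[OF lim]])
  show "visc_sub (time_domain T \<times> prob_simplex) (ham (dual_operator matrix_game_value) (\<lambda>i j w. - g i j w) q k) (\<lambda>x. - v x)"
    \<comment> \<open>The locale assumptions concern \<open>T\<close>, \<open>k\<close> and
      \<open>q\<close>, so the same axioms instantiate the lemma for the payoff
      \<open>- g\<close>.\<close>
    by (rule continuous_game.visc_sub_limit[OF continuous_game_axioms
          value_operator_dual_operator[OF value_operator_matrix_game_value]
          fine_partition.game_value_dynamic_programming_dual[OF P] fine_partition.continuous_on_grid_minus[OF P]
          is_limit_minus[OF lim] continuous_on_minus[OF limit_continuous[OF lim]]])
qed

lemma limit_uniform:
  assumes "is_limit (game_value g q k) v"
  shows "uniform_limit (time_domain T \<times> prob_simplex) (game_value g q k) v (vanishing_mesh T)"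
  unfolding uniform_limit_iff eventually_vanishing_mesh
proof (intro allI impI)
  fix e :: real assume e: "0 < e"
  then have "0 < e / 2" by simp
  from is_limitE[OF assms this zero_less_one] obtain \<delta> where \<delta>: "0 < \<delta>"
    "\<And>s x. partition_of T s \<Longrightarrow> mesh s < ereal \<delta> \<Longrightarrow> x \<in> time_domain T \<times> prob_simplex \<Longrightarrow> \<bar>game_value g q k s x - v x\<bar> \<le> e / 2"
    by metis
  have "dist (game_value g q k s x) (v x) < e"
    if "partition_of T s" "mesh s < ereal \<delta>" "x \<in> time_domain T \<times> prob_simplex" for s x
    using \<delta>(2)[OF that] e by (simp add: dist_real_def)
  then show "\<exists>\<delta>>0. \<forall>s. partition_of T s \<longrightarrow> mesh s < ereal \<delta> \<longrightarrow>
      (\<forall>x\<in>time_domain T \<times> prob_simplex. dist (game_value g q k s x) (v x) < e)"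
    using \<delta>(1) by blast
qed

end

theorem theorem2:
  fixes T :: ereal
    and k :: "real \<Rightarrow> real"
    and g :: "'i::finite \<Rightarrow> 'j::finite \<Rightarrow> 'w::finite \<Rightarrow> real"
    and q :: "'i \<Rightarrow> 'j \<Rightarrow> real ^ 'w ^ 'w"
  assumes "\<And>i j. kernel_matrix (q i j)"
    and "0 < T"
    and "continuous_on {t. 0 \<le> t \<and> ereal t \<le> T} k"
    and "antimono_on {t. 0 \<le> t \<and> ereal t \<le> T} k"
    and "\<And>t. 0 \<le> t \<Longrightarrow> ereal t \<le> T \<Longrightarrow> 0 \<le> k t"
    and "(k has_integral 1) {t. 0 \<le> t \<and> ereal t \<le> T}"
  shows "\<exists>v. uniform_limit (time_domain T \<times> prob_simplex) (game_value g q k) v (vanishing_mesh T)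
           \<and> continuous_on (time_domain T \<times> prob_simplex) v
           \<and> terminal_zero T v
           \<and> viscosity_solution (time_domain T \<times> prob_simplex) (hamiltonian g q k) v
           \<and> (\<forall>u. continuous_on (time_domain T \<times> prob_simplex) u
                  \<and> terminal_zero T u
                  \<and> viscosity_solution (time_domain T \<times> prob_simplex) (hamiltonian g q k) u
                \<longrightarrow> (\<forall>x\<in>time_domain T \<times> prob_simplex. u x = v x))"
proof -
  interpret continuous_game T k g q
    by (rule continuous_game.intro) (use assms in auto)
  obtain v where v: "is_limit (game_value g q k) v" using limit_exists by blast
  show ?thesis
  proof (intro exI[of _ v] conjI allI impI ballI)
    fix u x
    assume u: "continuous_on (time_domain T \<times> prob_simplex) u \<and> terminal_zero T u
        \<and> viscosity_solution (time_domain T \<times> prob_simplex) (hamiltonian g q k) u"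
      and x: "x \<in> time_domain T \<times> (prob_simplex :: (real ^ 'w) set)"
    obtain t p where tp: "x = (t, p)" by (cases x)
    show "u x = v x"
      unfolding tp
      by (rule viscosity_solution_eq_limit[OF v]) (use u x tp in \<open>auto simp: time_domain_def\<close>)
  qed (use limit_uniform[OF v] limit_continuous[OF v] limit_terminal_zero[OF v] limit_viscosity_solution[OF v] in simp_all)
qed

end
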